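(* Let $(\mathcal{M},g,\nabla,\nabla^* )$ be a statistical manifold of dimension $d\ge2$ such that both $\nabla$ and $\nabla^*$ are projectively flat and have constant negative sectional curvature $-\alpha$ with respect to $g$, where $\alpha>0$. Then, near each point of $\mathcal{M}$, there exist local coordinate systems $\xi$ and $\eta$ such that the following statements hold: (i) The primal geodesics are straight lines in the $\xi$ coordinates up to time reparameterizations, and the dual geodesics are straight lines in the $\eta$ coordinates up to time reparameterizations. (ii) The coordinates satisfy $1+\alpha\sum_{\ell=1}^d\xi^\ell\eta^\ell>0$. (iii) There exist local $\alpha$-exponentially concave functions $\varphi(\xi)$ and $\psi(\eta)$ such that the generalized Fenchel identity $$\varphi(\xi)+\psi(\eta)\equiv\frac1\alpha\log(1+\alpha\,\xi\cdot\eta)$$ holds ($\xi,\eta$ being the coordinates of the same point). (iv) Under the coordinate systems $\xi$ and $\eta$ respectively, the Riemannian metric is given by $$g_{ij}(\xi)=-\frac{\partial^2\varphi}{\partial\xi^i\partial\xi^j}-\alpha\frac{\partial\varphi}{\partial\xi^i}\frac{\partial\varphi}{\partial\xi^j},\qquad g_{ij}(\eta)=-\frac{\partial^2\psi}{\partial\eta^i\partial\eta^j}-\alpha\frac{\partial\psi}{\partial\eta^i}\frac{\partial\psi}{\partial\eta^j}.$$ If instead the constant curvature of $\nabla$ and $\nabla^*$ is $+\alpha>0$, then (i)–(iv) hold with the functions $\varphi$ and $\psi$ in (iii) being $\alpha$-exponentially convex and with the negative signs in (iv) replaced by positive signs.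
   Context: A statistical manifold (dualistic structure) $(\mathcal{M},g,\nabla,\nabla^* )$ consists of a smooth manifold with a Riemannian metric $g=\langle\cdot,\cdot\rangle$ and torsion-free affine connections $\nabla$ (primal), $\nabla^*$ (dual) with $Z\langle X,Y\rangle=\langle\nabla_ZX,Y\rangle+\langle X,\nabla^*_ZY\rangle$ for all vector fields. Primal (dual) geodesics are geodesics of $\nabla$ ($\nabla^*$). A torsion-free connection $\nabla$ is projectively flat if there are a flat torsion-free connection $\widetilde\nabla$ and a $1$-form $\tau$ with $\nabla_XY=\widetilde\nabla_XY+\tau(X)Y+\tau(Y)X$. It has constant sectional curvature $k$ with respect to $g$ if $R(X,Y)Z=\nabla_X\nabla_YZ-\nabla_Y\nabla_XZ-\nabla_{[X,Y]}Z$ satisfies $R(X,Y)Z=k(\langle Y,Z\rangle X-\langle X,Z\rangle Y)$ for all vector fields. A function $\varphi$ is $\alpha$-exponentially concave (convex) if $e^{\alpha\varphi}$ is concave (convex); "local" means each point has a convex neighbourhood (in the coordinates) on which this holds. *)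

theory Defs
  imports "HOL-Analysis.Analysis"
begin

section \<open>Smooth maps between normed spaces\<close>

text \<open>Only used for open sets \<open>S\<close>.\<close>

primrec C_on :: "nat \<Rightarrow> ('a::real_normed_vector \<Rightarrow> 'b::real_normed_vector) \<Rightarrow> 'a set \<Rightarrow> bool" where
  "C_on 0 f S \<longleftrightarrow> continuous_on S f"
| "C_on (Suc n) f S \<longleftrightarrow>
     (\<forall>x\<in>S. f differentiable (at x)) \<and> (\<forall>v. C_on n (\<lambda>x. frechet_derivative f (at x) v) S)"

definition smooth_on :: "'a::real_normed_vector set \<Rightarrow> ('a \<Rightarrow> 'b::real_normed_vector) \<Rightarrow> bool" where
  "smooth_on S f \<longleftrightarrow> (\<forall>n. C_on n f S)"

definition pderiv_at :: "'d::finite \<Rightarrow> (real^'d \<Rightarrow> real) \<Rightarrow> real^'d \<Rightarrow> real" where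
  "pderiv_at i f x = frechet_derivative f (at x) (axis i 1)"


section \<open>Smooth manifolds\<close>

text \<open>A chart is a pair of its domain and its coordinate map; the coordinate map is
  meaningful only on the domain.\<close>

type_synonym ('m, 'd) chart = "'m set \<times> ('m \<Rightarrow> real^'d)"

definition param :: "('m, 'd::finite) chart \<Rightarrow> real^'d \<Rightarrow> 'm" where
  "param c = inv_into (fst c) (snd c)"

definition is_chart :: "'m topology \<Rightarrow> ('m, 'd::finite) chart \<Rightarrow> bool" where
  "is_chart M c \<longleftrightarrow>
     openin M (fst c) \<and> open (snd c ` fst c) \<and>
     homeomorphic_map (subtopology M (fst c)) (top_of_set (snd c ` fst c)) (snd c)"

definition compatible :: "('m, 'd::finite) chart \<Rightarrow> ('m, 'd) chart \<Rightarrow> bool" where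
  "compatible c c' \<longleftrightarrow>
     smooth_on (snd c ` (fst c \<inter> fst c')) (snd c' \<circ> param c) \<and>
     smooth_on (snd c' ` (fst c \<inter> fst c')) (snd c \<circ> param c')"

definition smooth_manifold :: "'m topology \<Rightarrow> ('m, 'd::finite) chart set \<Rightarrow> bool" where
  "smooth_manifold M A \<longleftrightarrow>
     Hausdorff_space M \<and>
     (\<exists>B. countable B \<and> (\<forall>V\<in>B. openin M V) \<and>
        (\<forall>W p. openin M W \<and> p \<in> W \<longrightarrow> (\<exists>V\<in>B. p \<in> V \<and> V \<subseteq> W))) \<and>
     (\<forall>c\<in>A. is_chart M c) \<and>
     (\<Union>c\<in>A. fst c) = topspace M \<and>
     (\<forall>c\<in>A. \<forall>c'\<in>A. compatible c c')"

text \<open>The atlas is not assumed to be maximal; the local coordinate systems of the manifold are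
  the members of the maximal atlas.\<close>

definition coordinate_system ::
    "'m topology \<Rightarrow> ('m, 'd::finite) chart set \<Rightarrow> ('m, 'd) chart \<Rightarrow> bool" where
  "coordinate_system M A c \<longleftrightarrow> is_chart M c \<and> (\<forall>a\<in>A. compatible a c)"

definition smooth_fun ::
    "'m topology \<Rightarrow> ('m, 'd::finite) chart set \<Rightarrow> 'm set \<Rightarrow> ('m \<Rightarrow> real) \<Rightarrow> bool" where
  "smooth_fun M A W f \<longleftrightarrow>
     openin M W \<and> (\<forall>c\<in>A. smooth_on (snd c ` (W \<inter> fst c)) (f \<circ> param c))"

definition smooth_near ::
    "'m topology \<Rightarrow> ('m, 'd::finite) chart set \<Rightarrow> 'm \<Rightarrow> ('m \<Rightarrow> real) \<Rightarrow> bool" where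
  "smooth_near M A p f \<longleftrightarrow> (\<exists>W. p \<in> W \<and> smooth_fun M A W f)"


section \<open>Tangent vectors, vector fields and metrics\<close>

text \<open>A tangent vector at \<open>p\<close> is a directional derivative acting on the functions that are
  smooth near \<open>p\<close>. It is set to \<open>0\<close> on all other functions, so that equality of tangent
  vectors is equality of HOL functions. Linear combinations are taken pointwise.\<close>

type_synonym 'm tvec = "('m \<Rightarrow> real) \<Rightarrow> real"
type_synonym 'm vfield = "'m \<Rightarrow> 'm tvec"
type_synonym 'm conn = "'m vfield \<Rightarrow> 'm vfield \<Rightarrow> 'm vfield"

definition dir_deriv ::
    "'m topology \<Rightarrow> ('m, 'd::finite) chart set \<Rightarrow> ('m, 'd) chart \<Rightarrow> 'm \<Rightarrow> real^'d \<Rightarrow> 'm tvec" where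
  "dir_deriv M A c p a =
     (\<lambda>f. if smooth_near M A p f then frechet_derivative (f \<circ> param c) (at (snd c p)) a else 0)"

definition tangent_space ::
    "'m topology \<Rightarrow> ('m, 'd::finite) chart set \<Rightarrow> 'm \<Rightarrow> 'm tvec set" where
  "tangent_space M A p = {dir_deriv M A c p a | c a. c \<in> A \<and> p \<in> fst c}"

text \<open>The coordinate vector field \<open>\<partial>/\<partial>x\<^sup>i\<close> on the domain of a coordinate system.\<close>

definition coord_field ::
    "'m topology \<Rightarrow> ('m, 'd::finite) chart set \<Rightarrow> ('m, 'd) chart \<Rightarrow> 'd \<Rightarrow> 'm vfield" where
  "coord_field M A c i = (\<lambda>p. dir_deriv M A c p (axis i 1))"

text \<open>Smooth vector fields on an open set \<open>W\<close>. Values outside \<open>W\<close> are irrelevant.\<close>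

definition vector_fields ::
    "'m topology \<Rightarrow> ('m, 'd::finite) chart set \<Rightarrow> 'm set \<Rightarrow> 'm vfield set" where
  "vector_fields M A W = {X.
     (\<forall>p\<in>W. X p \<in> tangent_space M A p) \<and>
     (\<forall>V f. V \<subseteq> W \<and> smooth_fun M A V f \<longrightarrow> smooth_fun M A V (\<lambda>p. X p f))}"

definition lie_bracket ::
    "'m topology \<Rightarrow> ('m, 'd::finite) chart set \<Rightarrow> 'm vfield \<Rightarrow> 'm vfield \<Rightarrow> 'm vfield" where
  "lie_bracket M A X Y = (\<lambda>p f.
     if smooth_near M A p f then X p (\<lambda>q. Y q f) - Y p (\<lambda>q. X q f) else 0)"

definition riemannian_metric ::
    "'m topology \<Rightarrow> ('m, 'd::finite) chart set \<Rightarrow> ('m \<Rightarrow> 'm tvec \<Rightarrow> 'm tvec \<Rightarrow> real) \<Rightarrow> bool" where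
  "riemannian_metric M A g \<longleftrightarrow>
     (\<forall>p\<in>topspace M.
        (\<forall>u\<in>tangent_space M A p. \<forall>v\<in>tangent_space M A p. g p u v = g p v u) \<and>
        (\<forall>u\<in>tangent_space M A p. \<forall>v\<in>tangent_space M A p. \<forall>w\<in>tangent_space M A p. \<forall>a b.
           g p (\<lambda>f. a * u f + b * v f) w = a * g p u w + b * g p v w) \<and>
        (\<forall>u\<in>tangent_space M A p. u \<noteq> (\<lambda>f. 0) \<longrightarrow> g p u u > 0)) \<and>
     (\<forall>W. openin M W \<longrightarrow>
        (\<forall>X\<in>vector_fields M A W. \<forall>Y\<in>vector_fields M A W.
           smooth_fun M A W (\<lambda>p. g p (X p) (Y p))))"

definition one_form ::
    "'m topology \<Rightarrow> ('m, 'd::finite) chart set \<Rightarrow> ('m \<Rightarrow> 'm tvec \<Rightarrow> real) \<Rightarrow> bool" where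
  "one_form M A \<tau> \<longleftrightarrow>
     (\<forall>p\<in>topspace M. \<forall>u\<in>tangent_space M A p. \<forall>v\<in>tangent_space M A p. \<forall>a b.
        \<tau> p (\<lambda>f. a * u f + b * v f) = a * \<tau> p u + b * \<tau> p v) \<and>
     (\<forall>W. openin M W \<longrightarrow>
        (\<forall>X\<in>vector_fields M A W. smooth_fun M A W (\<lambda>p. \<tau> p (X p))))"


section \<open>Affine connections\<close>

text \<open>A connection acts on the smooth vector fields over every open set \<open>W\<close>, compatibly with
  restriction (so that, e.g., it can be applied to coordinate vector fields). The second clause
  also says that values outside \<open>W\<close> do not matter. Correspondingly, conditions ``for all
  vector fields'' range over the vector fields on all open sets. Homogeneity over the reals in
  the second argument is the Leibniz rule for constant functions.\<close>

definition affine_connection ::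
    "'m topology \<Rightarrow> ('m, 'd::finite) chart set \<Rightarrow> 'm conn \<Rightarrow> bool" where
  "affine_connection M A D \<longleftrightarrow> (\<forall>W. openin M W \<longrightarrow>
     (\<forall>X\<in>vector_fields M A W. \<forall>Y\<in>vector_fields M A W. D X Y \<in> vector_fields M A W) \<and>
     (\<forall>X\<in>vector_fields M A W. \<forall>X'\<in>vector_fields M A W.
      \<forall>Y\<in>vector_fields M A W. \<forall>Y'\<in>vector_fields M A W.
        (\<forall>p\<in>W. X p = X' p \<and> Y p = Y' p) \<longrightarrow> (\<forall>p\<in>W. D X Y p = D X' Y' p)) \<and>
     (\<forall>X\<in>vector_fields M A W. \<forall>X'\<in>vector_fields M A W. \<forall>Y\<in>vector_fields M A W. \<forall>h h'.
        smooth_fun M A W h \<and> smooth_fun M A W h' \<longrightarrow>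
        (\<forall>p\<in>W. D (\<lambda>q f. h q * X q f + h' q * X' q f) Y p =
               (\<lambda>f. h p * D X Y p f + h' p * D X' Y p f))) \<and>
     (\<forall>X\<in>vector_fields M A W. \<forall>Y\<in>vector_fields M A W. \<forall>Y'\<in>vector_fields M A W.
        \<forall>p\<in>W. D X (\<lambda>q f. Y q f + Y' q f) p = (\<lambda>f. D X Y p f + D X Y' p f)) \<and>
     (\<forall>X\<in>vector_fields M A W. \<forall>Y\<in>vector_fields M A W. \<forall>h. smooth_fun M A W h \<longrightarrow>
        (\<forall>p\<in>W. D X (\<lambda>q f. h q * Y q f) p = (\<lambda>f. X p h * Y p f + h p * D X Y p f))))"

definition torsion_free ::
    "'m topology \<Rightarrow> ('m, 'd::finite) chart set \<Rightarrow> 'm conn \<Rightarrow> bool" where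
  "torsion_free M A D \<longleftrightarrow> (\<forall>W. openin M W \<longrightarrow>
     (\<forall>X\<in>vector_fields M A W. \<forall>Y\<in>vector_fields M A W. \<forall>p\<in>W.
        (\<lambda>f. D X Y p f - D Y X p f) = lie_bracket M A X Y p))"

definition curvature ::
    "'m topology \<Rightarrow> ('m, 'd::finite) chart set \<Rightarrow> 'm conn \<Rightarrow>
     'm vfield \<Rightarrow> 'm vfield \<Rightarrow> 'm vfield \<Rightarrow> 'm vfield" where
  "curvature M A D X Y Z = (\<lambda>p f.
     D X (D Y Z) p f - D Y (D X Z) p f - D (lie_bracket M A X Y) Z p f)"

definition flat_connection ::
    "'m topology \<Rightarrow> ('m, 'd::finite) chart set \<Rightarrow> 'm conn \<Rightarrow> bool" where
  "flat_connection M A D \<longleftrightarrow> (\<forall>W. openin M W \<longrightarrow>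
     (\<forall>X\<in>vector_fields M A W. \<forall>Y\<in>vector_fields M A W. \<forall>Z\<in>vector_fields M A W. \<forall>p\<in>W.
        curvature M A D X Y Z p = (\<lambda>f. 0)))"

definition constant_sectional_curvature ::
    "'m topology \<Rightarrow> ('m, 'd::finite) chart set \<Rightarrow> ('m \<Rightarrow> 'm tvec \<Rightarrow> 'm tvec \<Rightarrow> real) \<Rightarrow>
     'm conn \<Rightarrow> real \<Rightarrow> bool" where
  "constant_sectional_curvature M A g D k \<longleftrightarrow> (\<forall>W. openin M W \<longrightarrow>
     (\<forall>X\<in>vector_fields M A W. \<forall>Y\<in>vector_fields M A W. \<forall>Z\<in>vector_fields M A W. \<forall>p\<in>W.
        curvature M A D X Y Z p =
          (\<lambda>f. k * (g p (Y p) (Z p) * X p f - g p (X p) (Z p) * Y p f))))"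

definition projectively_flat ::
    "'m topology \<Rightarrow> ('m, 'd::finite) chart set \<Rightarrow> 'm conn \<Rightarrow> bool" where
  "projectively_flat M A D \<longleftrightarrow> (\<exists>D' \<tau>.
     affine_connection M A D' \<and> torsion_free M A D' \<and> flat_connection M A D' \<and>
     one_form M A \<tau> \<and>
     (\<forall>W. openin M W \<longrightarrow>
        (\<forall>X\<in>vector_fields M A W. \<forall>Y\<in>vector_fields M A W. \<forall>p\<in>W.
           D X Y p = (\<lambda>f. D' X Y p f + \<tau> p (X p) * Y p f + \<tau> p (Y p) * X p f))))"

definition dual_connections ::
    "'m topology \<Rightarrow> ('m, 'd::finite) chart set \<Rightarrow> ('m \<Rightarrow> 'm tvec \<Rightarrow> 'm tvec \<Rightarrow> real) \<Rightarrow>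
     'm conn \<Rightarrow> 'm conn \<Rightarrow> bool" where
  "dual_connections M A g D D' \<longleftrightarrow> (\<forall>W. openin M W \<longrightarrow>
     (\<forall>X\<in>vector_fields M A W. \<forall>Y\<in>vector_fields M A W. \<forall>Z\<in>vector_fields M A W. \<forall>p\<in>W.
        Z p (\<lambda>q. g q (X q) (Y q)) = g p (D Z X p) (Y p) + g p (X p) (D' Z Y p)))"

definition statistical_manifold ::
    "'m topology \<Rightarrow> ('m, 'd::finite) chart set \<Rightarrow> ('m \<Rightarrow> 'm tvec \<Rightarrow> 'm tvec \<Rightarrow> real) \<Rightarrow>
     'm conn \<Rightarrow> 'm conn \<Rightarrow> bool" where
  "statistical_manifold M A g D D' \<longleftrightarrow>
     smooth_manifold M A \<and> riemannian_metric M A g \<and>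
     affine_connection M A D \<and> torsion_free M A D \<and>
     affine_connection M A D' \<and> torsion_free M A D' \<and>
     dual_connections M A g D D'"

definition metric_coeff ::
    "'m topology \<Rightarrow> ('m, 'd::finite) chart set \<Rightarrow> ('m \<Rightarrow> 'm tvec \<Rightarrow> 'm tvec \<Rightarrow> real) \<Rightarrow>
     ('m, 'd) chart \<Rightarrow> 'd \<Rightarrow> 'd \<Rightarrow> 'm \<Rightarrow> real" where
  "metric_coeff M A g c i j p = g p (coord_field M A c i p) (coord_field M A c j p)"


section \<open>Geodesics\<close>

text \<open>\<open>christoffel M A D c i j k\<close> is the coefficient of \<open>\<partial>/\<partial>x\<^sup>k\<close> in the covariant derivative
  of \<open>\<partial>/\<partial>x\<^sup>j\<close> along \<open>\<partial>/\<partial>x\<^sup>i\<close>.\<close>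

definition christoffel ::
    "'m topology \<Rightarrow> ('m, 'd::finite) chart set \<Rightarrow> 'm conn \<Rightarrow> ('m, 'd) chart \<Rightarrow>
     'd \<Rightarrow> 'd \<Rightarrow> 'd \<Rightarrow> 'm \<Rightarrow> real" where
  "christoffel M A D c i j k p =
     D (coord_field M A c i) (coord_field M A c j) p (\<lambda>q. snd c q $ k)"

definition geodesic ::
    "'m topology \<Rightarrow> ('m, 'd::finite) chart set \<Rightarrow> 'm conn \<Rightarrow> real set \<Rightarrow> (real \<Rightarrow> 'm) \<Rightarrow> bool" where
  "geodesic M A D I \<gamma> \<longleftrightarrow>
     open I \<and> is_interval I \<and> continuous_map (top_of_set I) M \<gamma> \<and>
     (\<forall>c\<in>A.
        smooth_on {t\<in>I. \<gamma> t \<in> fst c} (\<lambda>t. snd c (\<gamma> t)) \<and>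
        (\<forall>t\<in>I. \<gamma> t \<in> fst c \<longrightarrow> (\<forall>k.
           deriv (deriv (\<lambda>s. snd c (\<gamma> s) $ k)) t +
           (\<Sum>i\<in>UNIV. \<Sum>j\<in>UNIV. christoffel M A D c i j k (\<gamma> t) *
              deriv (\<lambda>s. snd c (\<gamma> s) $ i) t * deriv (\<lambda>s. snd c (\<gamma> s) $ j) t) = 0)))"

text \<open>In the coordinate system \<open>c\<close> the geodesics are the straight lines, up to smooth regular
  reparameterization: every geodesic runs along a straight line (\<open>v = 0\<close> accounts for constant
  geodesics), and every straight line becomes a geodesic after a reparameterization.\<close>

definition geodesics_straight ::
    "'m topology \<Rightarrow> ('m, 'd::finite) chart set \<Rightarrow> 'm conn \<Rightarrow> ('m, 'd) chart \<Rightarrow> bool" where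
  "geodesics_straight M A D c \<longleftrightarrow>
     (\<forall>I \<gamma>. geodesic M A D I \<gamma> \<and> \<gamma> ` I \<subseteq> fst c \<longrightarrow>
        (\<exists>a v s. smooth_on I s \<and> (\<forall>t\<in>I. deriv s t > 0) \<and>
           (\<forall>t\<in>I. snd c (\<gamma> t) = a + s t *\<^sub>R v))) \<and>
     (\<forall>J a v. open J \<and> is_interval J \<and> (\<forall>r\<in>J. a + r *\<^sub>R v \<in> snd c ` fst c) \<longrightarrow>
        (\<exists>I s. smooth_on I s \<and> (\<forall>t\<in>I. deriv s t > 0) \<and> s ` I = J \<and>
           geodesic M A D I (\<lambda>t. param c (a + s t *\<^sub>R v))))"


section \<open>Exponential concavity and convexity\<close>

definition exp_concave_on :: "real \<Rightarrow> 'a::real_vector set \<Rightarrow> ('a \<Rightarrow> real) \<Rightarrow> bool" where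
  "exp_concave_on \<alpha> S \<phi> \<longleftrightarrow> concave_on S (\<lambda>x. exp (\<alpha> * \<phi> x))"

definition exp_convex_on :: "real \<Rightarrow> 'a::real_vector set \<Rightarrow> ('a \<Rightarrow> real) \<Rightarrow> bool" where
  "exp_convex_on \<alpha> S \<phi> \<longleftrightarrow> convex_on S (\<lambda>x. exp (\<alpha> * \<phi> x))"

definition locally_exp_concave_on ::
    "real \<Rightarrow> 'a::real_normed_vector set \<Rightarrow> ('a \<Rightarrow> real) \<Rightarrow> bool" where
  "locally_exp_concave_on \<alpha> S \<phi> \<longleftrightarrow>
     (\<forall>x\<in>S. \<exists>N. open N \<and> convex N \<and> x \<in> N \<and> N \<subseteq> S \<and> exp_concave_on \<alpha> N \<phi>)"

definition locally_exp_convex_on ::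
    "real \<Rightarrow> 'a::real_normed_vector set \<Rightarrow> ('a \<Rightarrow> real) \<Rightarrow> bool" where
  "locally_exp_convex_on \<alpha> S \<phi> \<longleftrightarrow>
     (\<forall>x\<in>S. \<exists>N. open N \<and> convex N \<and> x \<in> N \<and> N \<subseteq> S \<and> exp_convex_on \<alpha> N \<phi>)"

end

theory Submission
  imports Defs
begin

text \<open>
  Let \<open>k = \<plusminus>\<alpha>\<close> be the curvature. Duality and torsion-freeness make \<open>\<nabla>g\<close> totally symmetric, and this together
  with the constant curvature is exactly the integrability condition of the equation
  \<open>Hess f = - k f g\<close>. By Frobenius' theorem its local solutions form a space of dimension \<open>d + 1\<close>; this
  already yields the projectively flat coordinates. Choose a basis \<open>f\<^sub>0, \<dots>, f\<^sub>d\<close> of solutions for \<open>\<nabla>\<close> with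
  \<open>f\<^sub>0 > 0\<close> and put \<open>\<xi>\<^sup>l = f\<^sub>l / f\<^sub>0\<close>. Along a geodesic all \<open>f\<^sub>l\<close> solve the same scalar equation \<open>y'' = - k q y\<close>,
  so their Wronskians with \<open>f\<^sub>0\<close> are constant and \<open>\<xi>' = w / f\<^sub>0\<^sup>2\<close> has a constant direction \<open>w\<close>.
  In the coordinates \<open>\<xi>\<close> the ordinary Hessian of \<open>1 / f\<^sub>0\<close> is \<open>(k / f\<^sub>0) g\<close>, which gives the metric and the
  convexity of \<open>e\<^sup>\<alpha>\<^sup>\<phi> = 1 / f\<^sub>0\<close>. Solutions \<open>h\<^sub>0, \<dots>, h\<^sub>d\<close> of the dual equation with suitable initial jets satisfy
  \<open>f\<^sub>0 h\<^sub>0 + \<alpha> \<Sum> f\<^sub>l h\<^sub>l = 1\<close>, because the jets of both sides solve one linear system; dividing by \<open>f\<^sub>0 h\<^sub>0\<close> gives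
  \<open>1 + \<alpha> \<xi> \<cdot> \<eta> = 1 / (f\<^sub>0 h\<^sub>0)\<close>, the generalized Fenchel identity.
\<close>

section \<open>Calculus of smooth maps\<close>

text \<open>The pair (f, df) is a section of a bundle of rank d + 1, and the Hessian equation says
  that this section is parallel for a connection there. The obstacle is to tie the primal solutions
  to the dual ones, which satisfy a different equation. The link is the bilinear form that is 1/k on
  values and g on differentials: it is parallel for the pair formed by the dual and the primal jet
  connection. Its mixed blocks force the constant 1/k, and its metric block expresses the duality of
  the connections. Once the differentials of the primal solutions at the base point are the
  coordinate covectors, those of the dual solutions must be \<sigma> g(\<partial>_l, .) with
  \<sigma> the sign of k. The weights of the pairing are 1/k for the index 0 and \<sigma> for the
  others; after multiplication by k the latter become \<alpha> for either sign of the curvature.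
  Geometrically the primal solutions form a centroaffine hypersurface, the dual solutions are its
  conormal map up to these weights, and \<xi> and \<eta> are affine charts of the two projective
  spaces.\<close>

lemma sum_delta_left: "(\<Sum>l\<in>UNIV. (if l = m then 1 else 0) * F l) = F m" for F :: "'d::finite \<Rightarrow> real"
proof -
  have "(\<Sum>l\<in>UNIV. (if l = m then 1 else 0) * F l) = (\<Sum>l\<in>UNIV. if l = m then F l else 0)"
    by (intro sum.cong) auto
  then show ?thesis by simp
qed

lemma sum_delta_right: "(\<Sum>l\<in>UNIV. F l * (if m = l then 1 else 0)) = F m" for F :: "'d::finite \<Rightarrow> real"
proof -
  have "(\<Sum>l\<in>UNIV. F l * (if m = l then 1 else 0)) = (\<Sum>l\<in>UNIV. if l = m then F l else 0)"
    by (intro sum.cong) auto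
  then show ?thesis by simp
qed

section \<open>Locality and closure properties of \<open>C_on\<close>\<close>

lemma C_on_cong:
  assumes "open S" "\<And>x. x \<in> S \<Longrightarrow> f x = h x"
  shows "C_on n f S \<longleftrightarrow> C_on n h S"
  using assms(2)
proof (induction n arbitrary: f h)
  case 0
  then show ?case by (auto cong: continuous_on_cong)
next
  case (Suc n)
  have ev: "\<forall>\<^sub>F y in nhds x. f y = h y" if "x \<in> S" for x
    using that Suc.prems eventually_nhds_in_open[OF \<open>open S\<close> that] by (auto elim: eventually_mono)
  have hd: "(f has_derivative F) (at x) \<longleftrightarrow> (h has_derivative F) (at x)" if "x \<in> S" for x F
    using that Suc.prems \<open>open S\<close>
    by (metis has_derivative_transform_within_open)
  have "f differentiable at x \<longleftrightarrow> h differentiable at x" if "x \<in> S" for x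
    using hd[OF that] by (simp add: differentiable_def)
  moreover have "frechet_derivative f (at x) = frechet_derivative h (at x)" if "x \<in> S" for x
    using hd[OF that] by (simp add: frechet_derivative_def)
  then have "C_on n (\<lambda>x. frechet_derivative f (at x) v) S \<longleftrightarrow> C_on n (\<lambda>x. frechet_derivative h (at x) v) S" for v
    by (intro Suc.IH) simp
  ultimately show ?case by simp
qed

lemma C_on_mono: "C_on n f S \<Longrightarrow> T \<subseteq> S \<Longrightarrow> C_on n f T"
  by (induction n arbitrary: f) (auto intro: continuous_on_subset)

lemma C_on_imp_continuous: "C_on n f S \<Longrightarrow> continuous_on S f"
  by (cases n) (auto intro: differentiable_imp_continuous_within continuous_at_imp_continuous_on)

lemma C_on_SucD: "C_on (Suc n) f S \<Longrightarrow> C_on n f S"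
  by (induction n arbitrary: f)
    (auto intro: differentiable_imp_continuous_within continuous_at_imp_continuous_on)

lemma C_on_has_derivative:
  "C_on (Suc n) f S \<Longrightarrow> x \<in> S \<Longrightarrow> (f has_derivative frechet_derivative f (at x)) (at x)"
  by (simp add: frechet_derivative_works[symmetric])

lemma C_on_frechet: "C_on (Suc n) f S \<Longrightarrow> C_on n (\<lambda>x. frechet_derivative f (at x) v) S"
  by simp

text \<open>Lets a known formula \<open>L\<close> stand in for \<open>frechet_derivative\<close>,
  with which it agrees on \<open>S\<close>. The closure properties below differentiate by the usual
  rules and apply the induction hypothesis to the resulting formula.\<close>

lemma C_on_SucI:
  assumes "open S" "\<And>x. x \<in> S \<Longrightarrow> (f has_derivative L x) (at x)" "\<And>v. C_on n (\<lambda>x. L x v) S"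
  shows "C_on (Suc n) f S"
proof -
  have "frechet_derivative f (at x) = L x" if "x \<in> S" for x
    using assms(2)[OF that] frechet_derivative_at by metis
  then have "C_on n (\<lambda>x. frechet_derivative f (at x) v) S" for v
    using assms(3)[of v] C_on_cong[OF \<open>open S\<close>, of "\<lambda>x. frechet_derivative f (at x) v" "\<lambda>x. L x v"] by simp
  then show ?thesis using assms(2) by (auto simp: differentiable_def)
qed

lemma smooth_on_cong:
  assumes "open S" "\<And>x. x \<in> S \<Longrightarrow> f x = h x"
  shows "smooth_on S f \<longleftrightarrow> smooth_on S h"
  using C_on_cong[OF assms] by (simp add: smooth_on_def)

lemma smooth_on_subset: "smooth_on S f \<Longrightarrow> T \<subseteq> S \<Longrightarrow> smooth_on T f"
  by (auto simp: smooth_on_def intro: C_on_mono)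

lemma smooth_on_continuous: "smooth_on S f \<Longrightarrow> continuous_on S f"
  by (auto simp: smooth_on_def intro: C_on_imp_continuous)

lemma smooth_on_differentiable: "smooth_on S f \<Longrightarrow> x \<in> S \<Longrightarrow> f differentiable (at x)"
  unfolding smooth_on_def by (metis C_on.simps(2))

lemma smooth_on_has_derivative:
  "smooth_on S f \<Longrightarrow> x \<in> S \<Longrightarrow> (f has_derivative frechet_derivative f (at x)) (at x)"
  using smooth_on_differentiable frechet_derivative_works by blast

lemma smooth_on_frechet: "smooth_on S f \<Longrightarrow> smooth_on S (\<lambda>x. frechet_derivative f (at x) v)"
  unfolding smooth_on_def by (metis C_on.simps(2))

text \<open>Regularity gains one order per round: if the derivative is given by a formula that is as
  regular as \<open>f\<close> itself, then \<open>f\<close> of class n is of class n + 1. This suits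
  maps known through a differential equation, such as local inverses and solutions of linear
  systems, for which only differentiability is known beforehand.\<close>

lemma smooth_on_bootstrap:
  assumes "open S" "\<And>x. x \<in> S \<Longrightarrow> (f has_derivative L x) (at x)"
    and step: "\<And>n v. C_on n f S \<Longrightarrow> C_on n (\<lambda>x. L x v) S"
  shows "smooth_on S f"
proof -
  have "C_on n f S" for n
  proof (induction n)
    case 0
    show ?case
      using assms(2) by (auto intro!: continuous_at_imp_continuous_on has_derivative_continuous)
  next
    case (Suc n)
    show ?case by (rule C_on_SucI[OF assms(1,2) step[OF Suc]])
  qed
  then show ?thesis by (simp add: smooth_on_def)
qed

lemma C_on_const: "C_on n (\<lambda>x. c) S"
proof (induction n arbitrary: c)
  case (Suc n)
  then show ?case by (simp add: frechet_derivative_const)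
qed simp

lemma C_on_linear:
  assumes "bounded_linear f"
  shows "C_on n f S"
proof (cases n)
  case 0
  then show ?thesis using assms by (simp add: linear_continuous_on)
next
  case (Suc m)
  have "frechet_derivative f (at x) = f" for x
    using bounded_linear_imp_has_derivative[OF assms, of "at x"] frechet_derivative_at by metis
  then show ?thesis using Suc assms C_on_const
    by (auto simp: differentiable_def intro: bounded_linear_imp_has_derivative)
qed

lemma C_on_add:
  assumes "open S"
  shows "C_on n f S \<Longrightarrow> C_on n h S \<Longrightarrow> C_on n (\<lambda>x. f x + h x) S"
proof (induction n arbitrary: f h)
  case (Suc n)
  show ?case
  proof (rule C_on_SucI[OF assms])
    fix x assume "x \<in> S"
    then show "((\<lambda>x. f x + h x) has_derivative
        (\<lambda>v. frechet_derivative f (at x) v + frechet_derivative h (at x) v)) (at x)"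
      using Suc.prems by (intro has_derivative_add) (auto intro: C_on_has_derivative)
  qed (use Suc in auto)
qed (auto intro: continuous_on_add)

text \<open>A single induction on the general product rule serves both products of real functions
  and scalar multiplication of vector-valued ones.\<close>

lemma C_on_bilinear:
  assumes "open S" "bounded_bilinear b"
  shows "C_on n f S \<Longrightarrow> C_on n h S \<Longrightarrow> C_on n (\<lambda>x. b (f x) (h x)) S"
proof (induction n arbitrary: f h)
  case 0
  then show ?case using bounded_bilinear.continuous_on[OF assms(2)] by auto
next
  case (Suc n)
  show ?case
  proof (rule C_on_SucI[OF assms(1)])
    fix x assume "x \<in> S"
    then show "((\<lambda>x. b (f x) (h x)) has_derivative
        (\<lambda>v. b (f x) (frechet_derivative h (at x) v) + b (frechet_derivative f (at x) v) (h x))) (at x)"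
      using Suc.prems by (intro bounded_bilinear.FDERIV[OF assms(2)]) (auto intro: C_on_has_derivative)
  next
    fix v
    show "C_on n (\<lambda>x. b (f x) (frechet_derivative h (at x) v) + b (frechet_derivative f (at x) v) (h x)) S"
      using Suc.prems C_on_SucD[OF Suc.prems(1)] C_on_SucD[OF Suc.prems(2)]
      by (intro C_on_add assms Suc.IH) auto
  qed
qed

lemmas C_on_mult = C_on_bilinear[OF _ bounded_bilinear_mult]
lemmas C_on_scaleR = C_on_bilinear[OF _ bounded_bilinear_scaleR]

lemma C_on_minus: "open S \<Longrightarrow> C_on n f S \<Longrightarrow> C_on n (\<lambda>x. - f x) S"
  using C_on_scaleR[OF _ C_on_const, of S n f "-1"] by simp

lemma C_on_sum: "open S \<Longrightarrow> (\<And>i. i \<in> I \<Longrightarrow> C_on n (f i) S) \<Longrightarrow> C_on n (\<lambda>x. \<Sum>i\<in>I. f i x) S"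
  by (induction I rule: infinite_finite_induct) (simp_all add: C_on_add C_on_const)

lemma C_on_prod:
  fixes f :: "'i \<Rightarrow> 'a::real_normed_vector \<Rightarrow> real"
  shows "open S \<Longrightarrow> (\<And>i. i \<in> I \<Longrightarrow> C_on n (f i) S) \<Longrightarrow> C_on n (\<lambda>x. \<Prod>i\<in>I. f i x) S"
  by (induction I rule: infinite_finite_induct) (simp_all add: C_on_mult C_on_const)

lemma C_on_compose_linear:
  assumes "open S" "bounded_linear l"
  shows "C_on n f S \<Longrightarrow> C_on n (\<lambda>x. l (f x)) S"
proof (induction n arbitrary: f)
  case 0
  then show ?case using assms(2) by (auto intro: bounded_linear.continuous_on)
next
  case (Suc n)
  show ?case
  proof (rule C_on_SucI[OF assms(1)])
    fix x assume "x \<in> S"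
    then show "((\<lambda>x. l (f x)) has_derivative (\<lambda>v. l (frechet_derivative f (at x) v))) (at x)"
      using Suc.prems by (intro bounded_linear.has_derivative[OF assms(2)]) (auto intro: C_on_has_derivative)
  qed (rule Suc.IH[OF C_on_frechet[OF Suc.prems]])
qed

lemma C_on_vec:
  fixes f :: "'a::real_normed_vector \<Rightarrow> real^'n"
  assumes "open S" "\<And>i. C_on n (\<lambda>x. f x $ i) S"
  shows "C_on n f S"
proof -
  have "C_on n (\<lambda>x. \<Sum>i\<in>UNIV. (f x $ i) *\<^sub>R (axis i 1 :: real^'n)) S"
    by (intro C_on_sum C_on_scaleR assms C_on_const)
  moreover have "(\<lambda>x. \<Sum>i\<in>UNIV. (f x $ i) *\<^sub>R (axis i 1 :: real^'n)) = f"
    using basis_expansion[of "f x" for x] unfolding scalar_mult_eq_scaleR by (intro ext)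
  ultimately show ?thesis by (simp only:)
qed

lemma C_on_nth: "open S \<Longrightarrow> C_on n f S \<Longrightarrow> C_on n (\<lambda>x. f x $ i) S"
  by (rule C_on_compose_linear[OF _ bounded_linear_vec_nth])

lemma C_on_inverse:
  fixes f :: "'a::real_normed_vector \<Rightarrow> real"
  assumes "open S" and nz: "\<And>x. x \<in> S \<Longrightarrow> f x \<noteq> 0"
  shows "C_on n f S \<Longrightarrow> C_on n (\<lambda>x. inverse (f x)) S"
proof (induction n)
  case 0
  then show ?case using nz by (auto intro: continuous_on_inverse)
next
  case (Suc n)
  show ?case
  proof (rule C_on_SucI[OF assms(1)])
    fix x assume "x \<in> S"
    show "((\<lambda>x. inverse (f x)) has_derivative
       (\<lambda>v. - (inverse (f x) * frechet_derivative f (at x) v * inverse (f x)))) (at x)"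
      by (rule Deriv.has_derivative_inverse[where f=f, OF nz[OF \<open>x \<in> S\<close>] C_on_has_derivative[OF Suc.prems \<open>x \<in> S\<close>]])
  next
    fix v
    show "C_on n (\<lambda>x. - (inverse (f x) * frechet_derivative f (at x) v * inverse (f x))) S"
      by (intro C_on_minus C_on_mult assms(1) Suc.IH C_on_SucD[OF Suc.prems] C_on_frechet[OF Suc.prems])
  qed
qed

text \<open>In the chain rule the derivative of \<open>f\<close> is applied to a direction that
  varies with the point, whereas the induction hypothesis covers fixed directions only. Expanding
  the direction in a basis separates the two dependences, which is why the middle space is
  Euclidean.\<close>

lemma C_on_compose:
  fixes g :: "'a::real_normed_vector \<Rightarrow> 'b::euclidean_space" and f :: "'b \<Rightarrow> 'c::real_normed_vector"
  assumes "open S" "\<And>x. x \<in> S \<Longrightarrow> g x \<in> T"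
  shows "C_on n f T \<Longrightarrow> C_on n g S \<Longrightarrow> C_on n (\<lambda>x. f (g x)) S"
proof (induction n arbitrary: f)
  case 0
  then show ?case using assms(2) by (auto intro: continuous_on_compose2)
next
  case (Suc n)
  have df: "(f has_derivative frechet_derivative f (at (g x))) (at (g x))" if "x \<in> S" for x
    by (rule C_on_has_derivative[OF Suc.prems(1) assms(2)[OF that]])
  have dg: "(g has_derivative frechet_derivative g (at x)) (at x)" if "x \<in> S" for x
    by (rule C_on_has_derivative[OF Suc.prems(2) that])
  have lin: "frechet_derivative f (at (g x)) w = (\<Sum>b\<in>Basis. (w \<bullet> b) *\<^sub>R frechet_derivative f (at (g x)) b)"
    if "x \<in> S" for x w
  proof -
    interpret linear "frechet_derivative f (at (g x))"
      using df[OF that] has_derivative_linear by blast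
    have "frechet_derivative f (at (g x)) w = frechet_derivative f (at (g x)) (\<Sum>b\<in>Basis. (w \<bullet> b) *\<^sub>R b)"
      by (simp only: euclidean_representation)
    also have "\<dots> = (\<Sum>b\<in>Basis. (w \<bullet> b) *\<^sub>R frechet_derivative f (at (g x)) b)"
      by (simp only: sum scaleR)
    finally show ?thesis .
  qed
  show ?case
  proof (rule C_on_SucI[OF assms(1)])
    fix x assume x: "x \<in> S"
    have "((\<lambda>x. f (g x)) has_derivative
       (\<lambda>v. frechet_derivative f (at (g x)) (frechet_derivative g (at x) v))) (at x)"
      by (rule has_derivative_compose[OF dg[OF x] df[OF x]])
    moreover have "(\<lambda>v. frechet_derivative f (at (g x)) (frechet_derivative g (at x) v)) =
       (\<lambda>v. \<Sum>b\<in>Basis. (frechet_derivative g (at x) v \<bullet> b) *\<^sub>R frechet_derivative f (at (g x)) b)"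
      by (intro ext lin[OF x])
    ultimately show "((\<lambda>x. f (g x)) has_derivative
       (\<lambda>v. \<Sum>b\<in>Basis. (frechet_derivative g (at x) v \<bullet> b) *\<^sub>R frechet_derivative f (at (g x)) b)) (at x)"
      by (simp only:)
  next
    fix v
    have "C_on n (\<lambda>x. frechet_derivative f (at (g x)) b) S" for b
      by (rule Suc.IH[OF C_on_frechet[OF Suc.prems(1)] C_on_SucD[OF Suc.prems(2)]])
    moreover have "C_on n (\<lambda>x. frechet_derivative g (at x) v \<bullet> b) S" for b
      by (rule C_on_compose_linear[OF assms(1) bounded_linear_inner_left C_on_frechet[OF Suc.prems(2)]])
    ultimately show "C_on n (\<lambda>x. \<Sum>b\<in>Basis. (frechet_derivative g (at x) v \<bullet> b) *\<^sub>R
        frechet_derivative f (at (g x)) b) S"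
      by (intro C_on_sum C_on_scaleR assms)
  qed
qed

lemma C_on_det:
  fixes f :: "'a::real_normed_vector \<Rightarrow> real^'n^'n"
  assumes "open S" "\<And>i j. C_on n (\<lambda>x. f x $ i $ j) S"
  shows "C_on n (\<lambda>x. det (f x)) S"
  unfolding det_def by (intro C_on_sum C_on_mult C_on_prod assms C_on_const)

text \<open>By Cramer's rule the components of \<open>w\<close> are quotients of determinants, hence
  rational in the entries of \<open>f\<close> and \<open>b\<close>; the solution of a nonsingular
  linear system is as regular as its data.\<close>

lemma C_on_cramer:
  fixes f :: "'a::real_normed_vector \<Rightarrow> real^'n^'n"
  assumes S: "open S" and f: "\<And>i j. C_on n (\<lambda>x. f x $ i $ j) S" and b: "\<And>i. C_on n (\<lambda>x. b x $ i) S"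
    and nz: "\<And>x. x \<in> S \<Longrightarrow> det (f x) \<noteq> 0" and eq: "\<And>x. x \<in> S \<Longrightarrow> f x *v w x = b x"
  shows "C_on n w S"
proof (rule C_on_vec[OF S])
  fix k
  have "C_on n (\<lambda>x. if j = k then b x $ i else f x $ i $ j) S" for i j
    using f b by (cases "j = k") simp_all
  then have "C_on n (\<lambda>x. det (\<chi> i j. if j = k then b x $ i else f x $ i $ j) * inverse (det (f x))) S"
    by (intro C_on_mult C_on_det C_on_inverse S nz f) simp_all
  moreover have "det (\<chi> i j. if j = k then b x $ i else f x $ i $ j) * inverse (det (f x)) = w x $ k"
    if "x \<in> S" for x
    using cramer[OF nz[OF that], of "w x" "b x"] eq[OF that] by (simp add: vec_eq_iff divide_inverse)
  ultimately show "C_on n (\<lambda>x. w x $ k) S"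
    by (subst C_on_cong[OF S, symmetric]) auto
qed

section \<open>Closure properties of \<open>smooth_on\<close>\<close>

lemma smooth_on_const: "smooth_on S (\<lambda>x. c)"
  by (simp add: smooth_on_def C_on_const)

lemma smooth_on_linear: "bounded_linear f \<Longrightarrow> smooth_on S f"
  by (simp add: smooth_on_def C_on_linear)

lemma smooth_on_ident: "smooth_on S (\<lambda>x. x)"
  by (rule smooth_on_linear) (rule bounded_linear_ident)

lemma smooth_on_add: "open S \<Longrightarrow> smooth_on S f \<Longrightarrow> smooth_on S h \<Longrightarrow> smooth_on S (\<lambda>x. f x + h x)"
  by (simp add: smooth_on_def C_on_add)

lemma smooth_on_mult:
  fixes f h :: "'a::real_normed_vector \<Rightarrow> real"
  shows "open S \<Longrightarrow> smooth_on S f \<Longrightarrow> smooth_on S h \<Longrightarrow> smooth_on S (\<lambda>x. f x * h x)"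
  by (simp add: smooth_on_def C_on_mult)

lemma smooth_on_scaleR:
  "open S \<Longrightarrow> smooth_on S f \<Longrightarrow> smooth_on S h \<Longrightarrow> smooth_on S (\<lambda>x. f x *\<^sub>R h x)"
  by (simp add: smooth_on_def C_on_scaleR)

lemma smooth_on_sum:
  "open S \<Longrightarrow> (\<And>i. i \<in> I \<Longrightarrow> smooth_on S (f i)) \<Longrightarrow> smooth_on S (\<lambda>x. \<Sum>i\<in>I. f i x)"
  by (simp add: smooth_on_def C_on_sum)

lemma smooth_on_inverse:
  fixes f :: "'a::real_normed_vector \<Rightarrow> real"
  shows "open S \<Longrightarrow> (\<And>x. x \<in> S \<Longrightarrow> f x \<noteq> 0) \<Longrightarrow> smooth_on S f \<Longrightarrow> smooth_on S (\<lambda>x. inverse (f x))"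
  by (simp add: smooth_on_def C_on_inverse)

lemma smooth_on_vec:
  fixes f :: "'a::real_normed_vector \<Rightarrow> real^'n"
  shows "open S \<Longrightarrow> (\<And>i. smooth_on S (\<lambda>x. f x $ i)) \<Longrightarrow> smooth_on S f"
  by (simp add: smooth_on_def C_on_vec)

lemma smooth_on_nth: "open S \<Longrightarrow> smooth_on S f \<Longrightarrow> smooth_on S (\<lambda>x. f x $ i)"
  by (simp add: smooth_on_def C_on_nth)

lemma smooth_on_compose:
  fixes g :: "'a::real_normed_vector \<Rightarrow> 'b::euclidean_space"
  shows "open S \<Longrightarrow> (\<And>x. x \<in> S \<Longrightarrow> g x \<in> T) \<Longrightarrow> smooth_on T f \<Longrightarrow> smooth_on S g \<Longrightarrow>
    smooth_on S (\<lambda>x. f (g x))"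
  unfolding smooth_on_def by (blast intro: C_on_compose)

lemma smooth_on_ln:
  fixes f :: "'a::real_normed_vector \<Rightarrow> real"
  assumes "open S" "smooth_on S f" and pos: "\<And>x. x \<in> S \<Longrightarrow> f x > 0"
  shows "smooth_on S (\<lambda>x. ln (f x))"
proof (rule smooth_on_bootstrap[OF assms(1)])
  fix x assume x: "x \<in> S"
  show "((\<lambda>x. ln (f x)) has_derivative (\<lambda>v. inverse (f x) * frechet_derivative f (at x) v)) (at x)"
    using has_derivative_ln[OF pos[OF x] smooth_on_has_derivative[OF assms(2) x]]
    by (simp add: divide_inverse mult.commute)
next
  fix n v
  have "f x \<noteq> 0" if "x \<in> S" for x using pos[OF that] by simp
  then have "smooth_on S (\<lambda>x. inverse (f x) * frechet_derivative f (at x) v)"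
    by (intro smooth_on_mult smooth_on_inverse smooth_on_frechet assms)
  then show "C_on n (\<lambda>x. inverse (f x) * frechet_derivative f (at x) v) S"
    by (simp add: smooth_on_def)
qed

text \<open>Differentiating \<open>f (g y) = y\<close> shows that \<open>L y v\<close> solves a
  linear system whose matrix is the Jacobian of \<open>f\<close> at \<open>g y\<close>. The system
  is nonsingular and its coefficients are as regular as \<open>g\<close>, so the bootstrap
  applies.\<close>

lemma smooth_on_local_inverse:
  fixes f g :: "real^'n \<Rightarrow> real^'n"
  assumes S: "open S" and V: "open V" and f: "smooth_on S f"
    and gS: "\<And>y. y \<in> V \<Longrightarrow> g y \<in> S" and fg: "\<And>y. y \<in> V \<Longrightarrow> f (g y) = y"
    and dg: "\<And>y. y \<in> V \<Longrightarrow> g differentiable (at y)"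
  shows "smooth_on V g"
proof -
  define L where "L y = frechet_derivative g (at y)" for y
  have gd: "(g has_derivative L y) (at y)" if "y \<in> V" for y
    using dg[OF that] frechet_derivative_works by (auto simp: L_def)
  have fd: "(f has_derivative frechet_derivative f (at (g y))) (at (g y))" if "y \<in> V" for y
    using smooth_on_has_derivative[OF f gS[OF that]] .
  have inv: "frechet_derivative f (at (g y)) (L y v) = v" if y: "y \<in> V" for y v
  proof -
    have "((\<lambda>y. f (g y)) has_derivative (\<lambda>v. frechet_derivative f (at (g y)) (L y v))) (at y)"
      by (rule has_derivative_compose[OF gd[OF y] fd[OF y]])
    moreover have "((\<lambda>y. f (g y)) has_derivative (\<lambda>v. v)) (at y)"
      using has_derivative_transform_within_open[OF has_derivative_ident V y, of "\<lambda>y. f (g y)"] fg by simp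
    ultimately show ?thesis using has_derivative_unique by metis
  qed
  define J where "J y = matrix (frechet_derivative f (at (g y)))" for y
  have Jv: "J y *v v = frechet_derivative f (at (g y)) v" if "y \<in> V" for y v
    using fd[OF that] by (simp add: J_def matrix_works has_derivative_linear)
  have det: "det (J y) \<noteq> 0" if y: "y \<in> V" for y
  proof -
    have "J y ** matrix (L y) = mat 1"
      using inv[OF y] Jv[OF y] gd[OF y]
      by (simp add: matrix_eq matrix_vector_mul_assoc[symmetric] matrix_works has_derivative_linear)
    then show ?thesis using invertible_right_inverse invertible_det_nz by blast
  qed
  show ?thesis
  proof (rule smooth_on_bootstrap[OF V gd])
    fix n v assume g: "C_on n g V"
    show "C_on n (\<lambda>y. L y v) V"
    proof (rule C_on_cramer[OF V _ _ det])
      fix i j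
      have "C_on n (\<lambda>y. frechet_derivative f (at (g y)) (axis j 1)) V"
        using smooth_on_frechet[OF f, of "axis j 1"] C_on_compose[OF V gS _ g]
        by (auto simp: smooth_on_def)
      then show "C_on n (\<lambda>y. J y $ i $ j) V"
        by (simp add: J_def matrix_def C_on_nth[OF V])
    qed (auto simp: Jv inv C_on_const)
  qed
qed

section \<open>Frobenius' theorem for linear systems\<close>

text \<open>The solution is the limit of the radial Picard iterates \<open>F\<close>. By flatness the defect \<open>DF - A F\<close> of an
  iterate is, up to a small error, an integral of the defect of the previous one, hence tends to \<open>0\<close>.\<close>

lemma frobenius_blinfun:
  fixes A :: "'a::euclidean_space \<Rightarrow> 'a \<Rightarrow>\<^sub>L ('e::banach \<Rightarrow>\<^sub>L 'e)"
    and A' :: "'a \<Rightarrow> 'a \<Rightarrow> 'a \<Rightarrow>\<^sub>L ('e \<Rightarrow>\<^sub>L 'e)"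
  assumes r: "r > 0" and K: "K \<ge> 0" "K * r \<le> 1 / 8" "\<And>x. x \<in> ball 0 r \<Longrightarrow> norm (A x) \<le> K"
    and dA: "\<And>x. x \<in> ball 0 r \<Longrightarrow> (A has_derivative A' x) (at x)"
    and cA': "\<And>v. continuous_on (ball 0 r) (\<lambda>x. A' x v)"
    and flat: "\<And>x u v e. x \<in> ball 0 r \<Longrightarrow> A' x u v e + A x v (A x u e) = A' x v u e + A x u (A x v e)"
  shows "\<exists>F. F 0 = e0 \<and> (\<forall>x\<in>ball 0 r. (F has_derivative (\<lambda>v. A x v (F x))) (at x))"
proof -
  define S where "S = ball (0::'a) r"
  have S: "open S" "convex S" "0 \<in> S" using r by (auto simp: S_def)
  have star: "t *\<^sub>R x \<in> S" if "x \<in> S" "t \<in> {0..1}" for x and t :: real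
  proof -
    have "\<bar>t\<bar> * norm x \<le> norm x" using that by (intro mult_left_le_one_le) auto
    then show ?thesis using that by (simp add: S_def)
  qed
  have cA: "continuous_on S A"
    using dA has_derivative_continuous by (fastforce simp: S_def intro: continuous_at_imp_continuous_on)
  have bound: "norm (A x v e) \<le> K * norm v * norm e" if "x \<in> S" for x v e
  proof -
    have "norm (A x v e) \<le> norm (A x v) * norm e" by (rule norm_blinfun)
    also have "\<dots> \<le> norm (A x) * norm v * norm e" by (intro mult_right_mono norm_blinfun norm_ge_zero)
    also have "\<dots> \<le> K * norm v * norm e" using K(3) that by (intro mult_right_mono) (auto simp: S_def)
    finally show ?thesis .
  qed
  have bound': "norm (A y x e) \<le> 1 / 8 * norm e" if "y \<in> S" "x \<in> S" for y x e
  proof -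
    have "K * norm x \<le> K * r" using that K(1) by (intro mult_left_mono) (auto simp: S_def)
    then have "K * norm x * norm e \<le> 1 / 8 * norm e" using K(2) by (intro mult_right_mono) auto
    then show ?thesis using bound[OF that(1), of x e] by linarith
  qed
  \<comment> \<open>Along the ray from 0 to \<open>x\<close> a solution satisfies d/dt F(tx) = A(tx)
    x F(tx); \<open>P\<close> is the integrated form of this on the unit interval.\<close>
  define P where "P F x = e0 + integral {0..1} (\<lambda>t. A (t *\<^sub>R x) x (F (t *\<^sub>R x)))" for F :: "'a \<Rightarrow> 'e" and x
  have comp: "continuous_on (S \<times> {0..1}) (\<lambda>(x, t). h (t *\<^sub>R x))" if "continuous_on S h"
    for h :: "'a \<Rightarrow> 'z::topological_space"
    unfolding case_prod_beta
    by (rule continuous_on_compose2[OF that]) (auto intro!: continuous_intros star)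
  have comp1: "continuous_on {0..1} (\<lambda>t. h (t *\<^sub>R x))" if "continuous_on S h" "x \<in> S"
    for h :: "'a \<Rightarrow> 'z::topological_space" and x
    by (rule continuous_on_compose2[OF that(1)]) (auto intro!: continuous_intros star that)
  have int: "(\<lambda>t. A (t *\<^sub>R x) x (F (t *\<^sub>R x))) integrable_on {0..1}" if "continuous_on S F" "x \<in> S" for F x
    by (intro integrable_continuous_interval continuous_intros comp1[OF cA that(2)] comp1[OF that])
  \<comment> \<open>\<open>Q F \<epsilon>\<close> records that \<open>F\<close> is continuously
    differentiable with defect DF - A F at most \<epsilon> in operator norm. Continuity of the
    derivative is what permits differentiation under the integral sign in the next iterate.\<close>
  define Q where "Q F \<epsilon> \<longleftrightarrow> (\<exists>F'. (\<forall>x\<in>S. (F has_derivative blinfun_apply (F' x)) (at x)) \<and> continuous_on S F' \<and>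
      (\<forall>x\<in>S. \<forall>v. norm (F' x v - A x v (F x)) \<le> \<epsilon> * norm v))" for F \<epsilon>
  \<comment> \<open>The summand \<open>K * \<delta>\<close> pays for replacing \<open>F\<close> by
    \<open>P F\<close> in A F. The summand \<open>\<epsilon> / 4\<close> is the integrated defect of
    \<open>F\<close>, which enters twice with the factor 1/8.\<close>
  have step: "Q (P F) (K * \<delta> + \<epsilon> / 4)"
    if QF: "Q F \<epsilon>" and \<delta>: "\<And>x. x \<in> S \<Longrightarrow> norm (P F x - F x) \<le> \<delta>" and "\<epsilon> \<ge> 0" for F \<delta> \<epsilon>
  proof -
    obtain F' where F': "\<And>x. x \<in> S \<Longrightarrow> (F has_derivative blinfun_apply (F' x)) (at x)"
      and cF': "continuous_on S F'"
      and E: "\<And>x v. x \<in> S \<Longrightarrow> norm (F' x v - A x v (F x)) \<le> \<epsilon> * norm v"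
      using QF by (auto simp: Q_def)
    have cF: "continuous_on S F"
      using F' has_derivative_continuous by (blast intro: continuous_at_imp_continuous_on)
    \<comment> \<open>The derivative in direction \<open>v\<close> of the integrand of
      \<open>P F\<close>. It is packed into a bounded linear function because the Leibniz rule
      integrates the derivatives as elements of that space.\<close>
    define \<phi> where "\<phi> x t v = t *\<^sub>R A' (t *\<^sub>R x) v x (F (t *\<^sub>R x)) + A (t *\<^sub>R x) v (F (t *\<^sub>R x))
        + t *\<^sub>R A (t *\<^sub>R x) x (F' (t *\<^sub>R x) v)" for x and t :: real and v
    define fx where "fx x t = Blinfun (\<phi> x t)" for x t
    have bl: "bounded_linear (\<phi> x t)" if "x \<in> S" "t \<in> {0..1}" for x t
    proof -
      have "bounded_linear (A' (t *\<^sub>R x))"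
        using has_derivative_bounded_linear[OF dA[of "t *\<^sub>R x"]] star[OF that] by (simp add: S_def)
      then have "bounded_linear (\<lambda>v. A' (t *\<^sub>R x) v x (F (t *\<^sub>R x)))"
        by (intro bounded_linear_compose[OF blinfun.bounded_linear_left, of "\<lambda>v. blinfun_apply (A' (t *\<^sub>R x) v) x"]
            bounded_linear_compose[OF blinfun.bounded_linear_left, of "A' (t *\<^sub>R x)"])
      moreover have "bounded_linear (\<lambda>v. A (t *\<^sub>R x) v (F (t *\<^sub>R x)))"
        by (rule bounded_linear_compose[OF blinfun.bounded_linear_left blinfun.bounded_linear_right])
      moreover have "bounded_linear (\<lambda>v. A (t *\<^sub>R x) x (F' (t *\<^sub>R x) v))"
        by (rule bounded_linear_compose[OF blinfun.bounded_linear_right blinfun.bounded_linear_right])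
      ultimately show ?thesis unfolding \<phi>_def
        by (intro bounded_linear_add bounded_linear_const_scaleR)
    qed
    have fx: "blinfun_apply (fx x t) = \<phi> x t" if "x \<in> S" "t \<in> {0..1}" for x t
      unfolding fx_def by (rule bounded_linear_Blinfun_apply[OF bl[OF that]])
    have cfx: "continuous_on (S \<times> {0..1}) (\<lambda>(x, t). fx x t)"
    proof (rule continuous_on_blinfun_componentwise)
      fix v :: 'a assume "v \<in> Basis"
      have "continuous_on (S \<times> {0..1}) (\<lambda>(x, t). \<phi> x t v)"
        unfolding \<phi>_def case_prod_beta
        by (intro continuous_intros comp[unfolded case_prod_beta] cA cF cF' cA'[folded S_def])
      then show "continuous_on (S \<times> {0..1}) (\<lambda>z. blinfun_apply (case z of (x, t) \<Rightarrow> fx x t) v)"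
        by (rule continuous_on_eq) (auto simp: fx)
    qed
    have der: "((\<lambda>x. A (t *\<^sub>R x) x (F (t *\<^sub>R x))) has_derivative blinfun_apply (fx x t)) (at x)"
      if x: "x \<in> S" and t: "t \<in> {0..1}" for x t
    proof -
      note tx = star[OF that]
      have s: "((\<lambda>x. t *\<^sub>R x) has_derivative (\<lambda>v. t *\<^sub>R v)) (at x)" by (auto intro!: derivative_eq_intros)
      have 1: "((\<lambda>x. A (t *\<^sub>R x)) has_derivative (\<lambda>v. A' (t *\<^sub>R x) (t *\<^sub>R v))) (at x)"
        using has_derivative_compose[OF s dA] tx by (simp add: S_def)
      have 2: "((\<lambda>x. F (t *\<^sub>R x)) has_derivative (\<lambda>v. F' (t *\<^sub>R x) (t *\<^sub>R v))) (at x)"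
        using has_derivative_compose[OF s F'] tx by simp
      have "((\<lambda>x. A (t *\<^sub>R x) x (F (t *\<^sub>R x))) has_derivative
         (\<lambda>v. A (t *\<^sub>R x) x (F' (t *\<^sub>R x) (t *\<^sub>R v)) +
           (A (t *\<^sub>R x) v + A' (t *\<^sub>R x) (t *\<^sub>R v) x) (F (t *\<^sub>R x)))) (at x)"
        by (rule blinfun.FDERIV[OF blinfun.FDERIV[OF 1 has_derivative_ident] 2])
      moreover have "linear (A' (t *\<^sub>R x))"
        using has_derivative_linear[OF dA[of "t *\<^sub>R x"]] tx by (simp add: S_def)
      then have "(\<lambda>v. A (t *\<^sub>R x) x (F' (t *\<^sub>R x) (t *\<^sub>R v)) +
           (A (t *\<^sub>R x) v + A' (t *\<^sub>R x) (t *\<^sub>R v) x) (F (t *\<^sub>R x))) = blinfun_apply (fx x t)"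
        by (simp add: fun_eq_iff fx[OF that] \<phi>_def linear_cmul blinfun.bilinear_simps)
      ultimately show ?thesis by (simp only:)
    qed
    define G where "G x = integral {0..1} (fx x)" for x
    have "continuous_on S (\<lambda>x. integral (cbox 0 1) (fx x))"
      using cfx by (intro integral_continuous_on_param) auto
    then have cG: "continuous_on S G" by (simp add: G_def)
    have dP: "(P F has_derivative blinfun_apply (G x)) (at x)" if x: "x \<in> S" for x
    proof -
      have "((\<lambda>x. integral (cbox 0 1) (\<lambda>t. A (t *\<^sub>R x) x (F (t *\<^sub>R x)))) has_derivative
          blinfun_apply (integral (cbox 0 1) (fx x))) (at x within S)"
        by (rule leibniz_rule[OF _ _ _ x S(2)])
          (use der cfx int[OF cF] in \<open>auto intro: has_derivative_at_withinI\<close>)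
      then have "(P F has_derivative blinfun_apply (G x)) (at x within S)"
        unfolding P_def[abs_def] G_def using has_derivative_add[OF has_derivative_const[of e0]] by fastforce
      then show ?thesis using at_within_open[OF x S(1)] by simp
    qed
    have EP: "norm (G x v - A x v (P F x)) \<le> (K * \<delta> + \<epsilon> / 4) * norm v" if x: "x \<in> S" for x v
    proof -
      \<comment> \<open>\<open>\<psi>\<close> is the derivative in t of t A(tx) v F(tx), so it
        integrates to A(x) v F(x), the term with which the derivative of \<open>P F\<close> is
        compared. In the difference of the two integrands flatness exchanges the derivatives of
        \<open>A\<close> for products of values of \<open>A\<close>; what is left, \<open>D\<close>,
        involves the defect of \<open>F\<close> only.\<close>
      define \<psi> where "\<psi> t = t *\<^sub>R A' (t *\<^sub>R x) x v (F (t *\<^sub>R x)) + A (t *\<^sub>R x) v (F (t *\<^sub>R x))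
        + t *\<^sub>R A (t *\<^sub>R x) v (F' (t *\<^sub>R x) x)" for t :: real
      define D where "D t = t *\<^sub>R (A (t *\<^sub>R x) x (F' (t *\<^sub>R x) v - A (t *\<^sub>R x) v (F (t *\<^sub>R x)))
         - A (t *\<^sub>R x) v (F' (t *\<^sub>R x) x - A (t *\<^sub>R x) x (F (t *\<^sub>R x))))" for t :: real
      have "((\<lambda>t. t *\<^sub>R A (t *\<^sub>R x) v (F (t *\<^sub>R x))) has_vector_derivative \<psi> t) (at t within {0..1})"
        if t: "t \<in> {0..1}" for t
      proof -
        note tx = star[OF x t]
        have s: "((\<lambda>t. t *\<^sub>R x) has_derivative (\<lambda>h. h *\<^sub>R x)) (at t)" by (auto intro!: derivative_eq_intros)
        have 1: "((\<lambda>t. A (t *\<^sub>R x)) has_derivative (\<lambda>h. A' (t *\<^sub>R x) (h *\<^sub>R x))) (at t)"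
          using has_derivative_compose[OF s dA] tx by (simp add: S_def)
        have 2: "((\<lambda>t. F (t *\<^sub>R x)) has_derivative (\<lambda>h. F' (t *\<^sub>R x) (h *\<^sub>R x))) (at t)"
          using has_derivative_compose[OF s F'] tx by simp
        have "((\<lambda>t. t *\<^sub>R A (t *\<^sub>R x) v (F (t *\<^sub>R x))) has_derivative
           (\<lambda>h. t *\<^sub>R (A (t *\<^sub>R x) v (F' (t *\<^sub>R x) (h *\<^sub>R x)) +
             (A (t *\<^sub>R x) 0 + A' (t *\<^sub>R x) (h *\<^sub>R x) v) (F (t *\<^sub>R x))) + h *\<^sub>R A (t *\<^sub>R x) v (F (t *\<^sub>R x)))) (at t)"
          by (rule has_derivative_scaleR[OF has_derivative_ident
               blinfun.FDERIV[OF blinfun.FDERIV[OF 1 has_derivative_const] 2]])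
        moreover have "linear (A' (t *\<^sub>R x))"
          using has_derivative_linear[OF dA[of "t *\<^sub>R x"]] tx by (simp add: S_def)
        then have "(\<lambda>h. t *\<^sub>R (A (t *\<^sub>R x) v (F' (t *\<^sub>R x) (h *\<^sub>R x)) +
             (A (t *\<^sub>R x) 0 + A' (t *\<^sub>R x) (h *\<^sub>R x) v) (F (t *\<^sub>R x))) + h *\<^sub>R A (t *\<^sub>R x) v (F (t *\<^sub>R x)))
            = (\<lambda>h. h *\<^sub>R \<psi> t)"
          by (simp add: fun_eq_iff \<psi>_def linear_cmul blinfun.bilinear_simps algebra_simps)
        ultimately have "((\<lambda>t. t *\<^sub>R A (t *\<^sub>R x) v (F (t *\<^sub>R x))) has_derivative (\<lambda>h. h *\<^sub>R \<psi> t)) (at t)"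
          by (simp only:)
        then show ?thesis by (simp add: has_vector_derivative_def has_derivative_at_withinI)
      qed
      then have "(\<psi> has_integral 1 *\<^sub>R A (1 *\<^sub>R x) v (F (1 *\<^sub>R x)) - 0 *\<^sub>R A (0 *\<^sub>R x) v (F (0 *\<^sub>R x))) {0..1}"
        by (intro fundamental_theorem_of_calculus) auto
      then have I1: "(\<psi> has_integral A x v (F x)) {0..1}" by simp
      have "continuous_on {0..1} (\<lambda>t. (\<lambda>(x, t). fx x t) (x, t))"
        by (rule continuous_on_compose2[OF cfx]) (auto intro!: continuous_intros x)
      then have ifx: "fx x integrable_on {0..1}" by (auto intro: integrable_continuous_interval)
      then have "((\<lambda>t. fx x t v) has_integral G x v) {0..1}"
        using has_integral_linear[OF integrable_integral blinfun.bounded_linear_left] by (fastforce simp: G_def comp_def)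
      then have I2: "((\<lambda>t. \<phi> x t v) has_integral G x v) {0..1}"
        by (rule has_integral_eq[rotated]) (use fx[OF x] in auto)
      have "\<phi> x t v - \<psi> t = D t" if t: "t \<in> {0..1}" for t
      proof -
        have "t *\<^sub>R (A' (t *\<^sub>R x) v x (F (t *\<^sub>R x)) + A (t *\<^sub>R x) x (A (t *\<^sub>R x) v (F (t *\<^sub>R x)))) =
            t *\<^sub>R (A' (t *\<^sub>R x) x v (F (t *\<^sub>R x)) + A (t *\<^sub>R x) v (A (t *\<^sub>R x) x (F (t *\<^sub>R x))))"
          using flat[of "t *\<^sub>R x" v x "F (t *\<^sub>R x)"] star[OF x t] by (simp add: S_def)
        then show ?thesis by (simp add: \<phi>_def \<psi>_def D_def blinfun.bilinear_simps algebra_simps)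
      qed
      then have ID: "(D has_integral G x v - A x v (F x)) {0..1}"
        by (rule has_integral_eq[OF _ has_integral_diff[OF I2 I1]])
      have "norm (D t) \<le> \<epsilon> / 4 * norm v" if t: "t \<in> {0..1}" for t
      proof -
        note tx = star[OF x t]
        have "norm (A (t *\<^sub>R x) x (F' (t *\<^sub>R x) v - A (t *\<^sub>R x) v (F (t *\<^sub>R x)))) \<le> 1 / 8 * (\<epsilon> * norm v)"
          by (intro order_trans[OF bound'[OF tx x]] mult_left_mono E[OF tx]) auto
        moreover have "norm (A (t *\<^sub>R x) v (F' (t *\<^sub>R x) x - A (t *\<^sub>R x) x (F (t *\<^sub>R x)))) \<le> 1 / 8 * (\<epsilon> * norm v)"
        proof -
          have "norm (A (t *\<^sub>R x) v (F' (t *\<^sub>R x) x - A (t *\<^sub>R x) x (F (t *\<^sub>R x)))) \<le> K * norm v * (\<epsilon> * norm x)"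
            using K(1) by (intro order_trans[OF bound[OF tx]] mult_left_mono E[OF tx]) auto
          also have "\<dots> = (K * norm x) * (\<epsilon> * norm v)" by simp
          also have "\<dots> \<le> (K * r) * (\<epsilon> * norm v)"
            using K(1) x \<open>\<epsilon> \<ge> 0\<close> by (intro mult_right_mono mult_left_mono) (auto simp: S_def)
          also have "\<dots> \<le> 1 / 8 * (\<epsilon> * norm v)" using K(2) \<open>\<epsilon> \<ge> 0\<close> by (intro mult_right_mono) auto
          finally show ?thesis .
        qed
        ultimately have "norm (A (t *\<^sub>R x) x (F' (t *\<^sub>R x) v - A (t *\<^sub>R x) v (F (t *\<^sub>R x)))
         - A (t *\<^sub>R x) v (F' (t *\<^sub>R x) x - A (t *\<^sub>R x) x (F (t *\<^sub>R x)))) \<le> \<epsilon> / 4 * norm v"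
          by (intro order_trans[OF norm_triangle_ineq4]) linarith
        moreover have "\<bar>t\<bar> \<le> 1" using t by auto
        ultimately show ?thesis unfolding D_def norm_scaleR
          by (intro order_trans[OF mult_left_le_one_le]) auto
      qed
      then have "norm (G x v - A x v (F x)) \<le> \<epsilon> / 4 * norm v"
        using has_integral_bound[OF _ ID[folded cbox_interval], of "\<epsilon> / 4 * norm v"] \<open>\<epsilon> \<ge> 0\<close> by simp
      moreover have "norm (A x v (F x - P F x)) \<le> K * norm v * \<delta>"
        using K(1) \<delta>[OF x] by (intro order_trans[OF bound[OF x]] mult_left_mono) (auto simp: norm_minus_commute)
      moreover have "G x v - A x v (P F x) = (G x v - A x v (F x)) + A x v (F x - P F x)"
        by (simp add: blinfun.bilinear_simps)
      ultimately show ?thesis using norm_triangle_ineq[of "G x v - A x v (F x)" "A x v (F x - P F x)"]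
        by (simp add: algebra_simps)
    qed
    show ?thesis unfolding Q_def using dP cG EP by blast
  qed
  define F where "F n = (P ^^ n) (\<lambda>x. e0)" for n
  have F0: "F 0 = (\<lambda>x. e0)" and FS: "F (Suc n) = P (F n)" for n by (simp_all add: F_def)
  define N where "N = norm e0"
  \<comment> \<open>Each Picard increment is at most 1/8 of the preceding one, so the bound N / 4^n
    holds with room to spare. For the defect, K N / 4^n + K N / 2^n is at most 2 K N / 2^n, half of
    the bound 4 K N / 2^n of the step before.\<close>
  have main: "Q (F n) (4 * K * N * (1 / 2) ^ n) \<and> (\<forall>x\<in>S. norm (F (Suc n) x - F n x) \<le> N * (1 / 4) ^ n)" for n
  proof (induction n)
    case 0
    have "Q (\<lambda>x. e0) (4 * K * N)"
      unfolding Q_def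
    proof (intro exI[of _ "\<lambda>x. 0"] conjI ballI allI)
      fix x v :: 'a assume "x \<in> S"
      have "K * norm v * norm e0 \<le> 4 * K * N * norm v" using K(1) by (auto simp: N_def)
      then show "norm (blinfun_apply (0 :: 'a \<Rightarrow>\<^sub>L 'e) v - A x v e0) \<le> 4 * K * N * norm v"
        using bound[OF \<open>x \<in> S\<close>, of v e0] by simp
    qed (auto intro!: derivative_eq_intros)
    moreover have "norm (P (\<lambda>x. e0) x - e0) \<le> N" if x: "x \<in> S" for x
    proof -
      have "norm (integral {0..1} (\<lambda>t. A (t *\<^sub>R x) x e0)) \<le> (1 / 8 * norm e0) * (1 - 0)"
      proof (rule integral_bound)
        show "norm (A (t *\<^sub>R x) x e0) \<le> 1 / 8 * norm e0" if "t \<in> {0..1}" for t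
          by (rule bound'[OF star[OF x that] x])
      qed (auto intro!: continuous_intros comp1 cA x)
      moreover have "(1 / 8 * norm e0) * (1 - 0) \<le> N" by (simp add: N_def)
      ultimately show ?thesis unfolding P_def by (simp add: add_diff_cancel_left')
    qed
    ultimately show ?case by (simp add: F0 FS)
  next
    case (Suc n)
    have nonneg: "0 \<le> 4 * K * N * (1 / 2) ^ n" using K(1) by (simp add: N_def)
    have Q: "Q (F (Suc n)) (K * (N * (1 / 4) ^ n) + 4 * K * N * (1 / 2) ^ n / 4)"
      unfolding FS by (rule step) (use Suc nonneg FS in auto)
    have "K * N * (1 / 4) ^ n \<le> K * N * (1 / 2) ^ n"
      using K(1) by (intro mult_left_mono power_mono) (auto simp: N_def)
    then have le: "K * (N * (1 / 4) ^ n) + 4 * K * N * (1 / 2) ^ n / 4 \<le> 4 * K * N * (1 / 2) ^ Suc n"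
      by simp
    have "Q (F (Suc n)) (4 * K * N * (1 / 2) ^ Suc n)"
      using Q unfolding Q_def by (meson le mult_right_mono norm_ge_zero order_trans)
    moreover have "norm (F (Suc (Suc n)) x - F (Suc n) x) \<le> N * (1 / 4) ^ Suc n" if x: "x \<in> S" for x
    proof -
      have c: "continuous_on S (F m)" if "Q (F m) \<epsilon>" for m \<epsilon>
        using that has_derivative_continuous unfolding Q_def by (blast intro: continuous_at_imp_continuous_on)
      note c1 = c[OF Q] and c0 = c[OF Suc.IH[THEN conjunct1]]
      have "F (Suc (Suc n)) x - F (Suc n) x =
          integral {0..1} (\<lambda>t. A (t *\<^sub>R x) x (F (Suc n) (t *\<^sub>R x)) - A (t *\<^sub>R x) x (F n (t *\<^sub>R x)))"
        using integral_diff[OF int[OF c1 x] int[OF c0 x]] unfolding FS[of "Suc n"] FS[of n, symmetric]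
        by (simp add: P_def FS)
      also have "\<dots> = integral {0..1} (\<lambda>t. A (t *\<^sub>R x) x (F (Suc n) (t *\<^sub>R x) - F n (t *\<^sub>R x)))"
        by (simp add: blinfun.bilinear_simps)
      also have "norm \<dots> \<le> (1 / 8 * (N * (1 / 4) ^ n)) * (1 - 0)"
      proof (rule integral_bound)
        fix t :: real assume t: "t \<in> {0..1}"
        show "norm (A (t *\<^sub>R x) x (F (Suc n) (t *\<^sub>R x) - F n (t *\<^sub>R x))) \<le> 1 / 8 * (N * (1 / 4) ^ n)"
          using Suc.IH star[OF x t] by (intro order_trans[OF bound'[OF star[OF x t] x]] mult_left_mono) auto
      qed (auto intro!: continuous_intros comp1 cA x c0 c1)
      also have "\<dots> \<le> N * (1 / 4) ^ Suc n" by (simp add: N_def)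
      finally show ?thesis .
    qed
    ultimately show ?case by blast
  qed
  then have "\<forall>n. \<exists>F'. (\<forall>x\<in>S. (F n has_derivative blinfun_apply (F' x)) (at x)) \<and>
      (\<forall>x\<in>S. \<forall>v. norm (F' x v - A x v (F n x)) \<le> 4 * K * N * (1 / 2) ^ n * norm v)"
    unfolding Q_def by blast
  then obtain F' where F': "\<And>n x. x \<in> S \<Longrightarrow> (F n has_derivative blinfun_apply (F' n x)) (at x)"
    and E: "\<And>n x v. x \<in> S \<Longrightarrow> norm (F' n x v - A x v (F n x)) \<le> 4 * K * N * (1 / 2) ^ n * norm v"
    by metis
  define L where "L x = e0 + suminf (\<lambda>i. F (Suc i) x - F i x)" for x
  have "uniform_limit S (\<lambda>n x. \<Sum>i<n. F (Suc i) x - F i x) (\<lambda>x. suminf (\<lambda>i. F (Suc i) x - F i x)) sequentially"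
    by (rule Weierstrass_m_test[of _ _ "\<lambda>n. N * (1 / 4) ^ n"])
      (use main in \<open>auto intro!: summable_mult summable_geometric\<close>)
  then have ul: "uniform_limit S F L sequentially"
    unfolding uniform_limit_iff by (simp add: sum_lessThan_telescope[of "\<lambda>i. F i x" for x] L_def F0 dist_norm algebra_simps)
  \<comment> \<open>The derivatives of the iterates converge uniformly to A L, because the defects
    tend to 0 and the iterates tend to \<open>L\<close> uniformly; this is what termwise
    differentiation asks for. The \<open>K + 1\<close> in the denominator guards against
    \<open>K = 0\<close>.\<close>
  have near: "\<forall>\<^sub>F n in sequentially. \<forall>x\<in>S. \<forall>h. norm (F' n x h - A x h (L x)) \<le> e * norm h" if "e > 0" for e
  proof -
    have "(\<lambda>n. 4 * K * N * (1 / 2) ^ n) \<longlonglongrightarrow> 4 * K * N * 0"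
      by (intro tendsto_mult tendsto_const LIMSEQ_power_zero) auto
    then have 1: "\<forall>\<^sub>F n in sequentially. 4 * K * N * (1 / 2) ^ n < e / 2"
      by (rule order_tendstoD(2)) (use that in auto)
    have 2: "\<forall>\<^sub>F n in sequentially. \<forall>x\<in>S. dist (F n x) (L x) < e / (2 * (K + 1))"
      using ul that K(1) by (auto simp: uniform_limit_iff)
    from 1 2 show ?thesis
    proof eventually_elim
      case (elim n)
      show ?case
      proof (intro ballI allI)
        fix x h assume x: "x \<in> S"
        have "norm (F' n x h - A x h (F n x)) \<le> e / 2 * norm h"
          using elim(1) by (intro order_trans[OF E[OF x]] mult_right_mono) auto
        moreover have "norm (A x h (F n x - L x)) \<le> e / 2 * norm h"
        proof -
          have "norm (A x h (F n x - L x)) \<le> K * norm h * (e / (2 * (K + 1)))"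
            using K(1) elim(2) x by (intro order_trans[OF bound[OF x]] mult_left_mono) (auto simp: dist_norm intro: less_imp_le)
          also have "\<dots> = (K / (K + 1)) * (e / 2 * norm h)" using K(1) by (simp add: field_simps)
          also have "\<dots> \<le> 1 * (e / 2 * norm h)"
            using K(1) that by (intro mult_right_mono) auto
          finally show ?thesis by simp
        qed
        ultimately have "norm ((F' n x h - A x h (F n x)) + A x h (F n x - L x)) \<le> e / 2 * norm h + e / 2 * norm h"
          by (rule norm_triangle_mono)
        then show "norm (F' n x h - A x h (L x)) \<le> e * norm h"
          by (simp add: blinfun.bilinear_simps)
      qed
    qed
  qed
  have "\<exists>g. \<forall>x\<in>S. (\<lambda>n. F n x) \<longlonglongrightarrow> g x \<and> (g has_derivative (\<lambda>h. A x h (L x))) (at x within S)"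
    by (rule has_derivative_sequence[OF S(2) has_derivative_at_withinI[OF F'] near S(3) tendsto_uniform_limitI[OF ul S(3)]])
  then obtain g where g: "\<And>x. x \<in> S \<Longrightarrow> (\<lambda>n. F n x) \<longlonglongrightarrow> g x"
    and dg: "\<And>x. x \<in> S \<Longrightarrow> (g has_derivative (\<lambda>h. A x h (L x))) (at x within S)" by blast
  have gL: "g x = L x" if "x \<in> S" for x
    using LIMSEQ_unique[OF g[OF that] tendsto_uniform_limitI[OF ul that]] .
  have "F n 0 = e0" for n
    by (induction n) (simp_all add: F0 FS P_def)
  then have "g 0 = e0" using LIMSEQ_unique[OF g[OF S(3)]] by simp
  moreover have "\<forall>x\<in>S. (g has_derivative (\<lambda>v. A x v (g x))) (at x)"
    using dg gL at_within_open[OF _ S(1)] by metis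
  ultimately show ?thesis unfolding S_def by blast
qed

section \<open>Partial derivatives and the coordinate form of Frobenius' theorem\<close>

lemma frechet_pderiv:
  fixes f :: "real^'d \<Rightarrow> real"
  assumes "f differentiable (at x)"
  shows "frechet_derivative f (at x) w = (\<Sum>n\<in>UNIV. w $ n * pderiv_at n f x)"
proof -
  interpret linear "frechet_derivative f (at x)"
    using assms frechet_derivative_works has_derivative_linear by blast
  have "frechet_derivative f (at x) w = frechet_derivative f (at x) (\<Sum>n\<in>UNIV. w $ n *\<^sub>R axis n 1)"
    using basis_expansion[of w] by (simp only: scalar_mult_eq_scaleR)
  also have "\<dots> = (\<Sum>n\<in>UNIV. w $ n * pderiv_at n f x)"
    by (simp only: sum scaleR pderiv_at_def real_scaleR_def)
  finally show ?thesis .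
qed

lemma has_derivative_pderiv:
  fixes f :: "real^'d \<Rightarrow> real"
  assumes "f differentiable (at x)"
  shows "(f has_derivative (\<lambda>w. \<Sum>n\<in>UNIV. w $ n * pderiv_at n f x)) (at x)"
proof -
  have "frechet_derivative f (at x) = (\<lambda>w. \<Sum>n\<in>UNIV. w $ n * pderiv_at n f x)"
    by (intro ext frechet_pderiv assms)
  then show ?thesis using assms frechet_derivative_works by metis
qed

lemma pderiv_atI: "(f has_derivative L) (at x) \<Longrightarrow> pderiv_at n f x = L (axis n 1)"
  unfolding pderiv_at_def using frechet_derivative_at by metis

lemma smooth_on_pderiv: "smooth_on S f \<Longrightarrow> smooth_on S (pderiv_at n f)"
  unfolding pderiv_at_def[abs_def] by (rule smooth_on_frechet)

text \<open>The matrices \<open>a m\<close> are the coefficients of a flat connection on a trivial vector bundle.\<close>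

theorem frobenius_linear:
  fixes a :: "'d::finite \<Rightarrow> 'n::finite \<Rightarrow> 'n \<Rightarrow> real^'d \<Rightarrow> real"
  assumes \<Omega>: "open \<Omega>" "x0 \<in> \<Omega>" and smooth: "\<And>m i j. smooth_on \<Omega> (a m i j)"
    and flat: "\<And>x m n i j. x \<in> \<Omega> \<Longrightarrow>
      pderiv_at n (a m i j) x + (\<Sum>l\<in>UNIV. a m i l x * a n l j x) =
      pderiv_at m (a n i j) x + (\<Sum>l\<in>UNIV. a n i l x * a m l j x)"
  shows "\<exists>r>0. ball x0 r \<subseteq> \<Omega> \<and> (\<forall>e. \<exists>F::real^'d \<Rightarrow> real^'n. F x0 = e \<and> smooth_on (ball x0 r) F \<and>
     (\<forall>x\<in>ball x0 r. \<forall>m i. pderiv_at m (\<lambda>x. F x $ i) x = (\<Sum>j\<in>UNIV. a m i j x * F x $ j)))"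
proof -
  \<comment> \<open>\<open>G i j\<close> is the elementary matrix with entry 1 at (i, j), and
    \<open>E m i j\<close> is its product with the m-th coordinate covector; they assemble the
    scalar coefficients into an operator-valued map.\<close>
  define G where "G i j = Blinfun (\<lambda>e::real^'n. (e $ j) *\<^sub>R (axis i 1 :: real^'n))" for i j
  define E where "E m i j = Blinfun (\<lambda>v::real^'d. (v $ m) *\<^sub>R G i j)" for m i j
  have G: "blinfun_apply (G i j) e = (e $ j) *\<^sub>R axis i 1" for i j e
    unfolding G_def
    by (subst bounded_linear_Blinfun_apply) (auto intro!: bounded_linear_scaleR_const[OF bounded_linear_vec_nth])
  have E: "blinfun_apply (E m i j) v = (v $ m) *\<^sub>R G i j" for m i j v
    unfolding E_def
    by (subst bounded_linear_Blinfun_apply) (auto intro!: bounded_linear_scaleR_const[OF bounded_linear_vec_nth])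
  define A where "A x = (\<Sum>m\<in>UNIV. \<Sum>i\<in>UNIV. \<Sum>j\<in>UNIV. a m i j (x0 + x) *\<^sub>R E m i j)" for x
  define A' where "A' x w = (\<Sum>m\<in>UNIV. \<Sum>i\<in>UNIV. \<Sum>j\<in>UNIV. frechet_derivative (a m i j) (at (x0 + x)) w *\<^sub>R E m i j)" for x w
  have comp: "blinfun_apply (blinfun_apply (\<Sum>m\<in>UNIV. \<Sum>i\<in>UNIV. \<Sum>j\<in>UNIV. b m i j *\<^sub>R E m i j) v) e $ i
      = (\<Sum>m\<in>UNIV. \<Sum>j\<in>UNIV. b m i j * v $ m * e $ j)" for b v e i
  proof -
    have "blinfun_apply (blinfun_apply (\<Sum>m\<in>UNIV. \<Sum>i\<in>UNIV. \<Sum>j\<in>UNIV. b m i j *\<^sub>R E m i j) v) e $ i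
       = (\<Sum>m\<in>UNIV. \<Sum>i'\<in>UNIV. \<Sum>j\<in>UNIV. if i' = i then b m i' j * v $ m * e $ j else 0)"
      by (simp add: blinfun.sum_left blinfun.scaleR_left E G axis_def if_distrib mult.assoc cong: if_cong)
        (intro sum.cong refl, simp)
    also have "\<dots> = (\<Sum>m\<in>UNIV. \<Sum>j\<in>UNIV. \<Sum>i'\<in>UNIV. if i' = i then b m i' j * v $ m * e $ j else 0)"
      by (intro sum.cong refl sum.swap)
    finally show ?thesis by simp
  qed
  define D where "D = (\<lambda>x. x0 + x) -` \<Omega>"
  have D: "open D" "0 \<in> D" using \<Omega> unfolding D_def by (auto intro!: open_vimage continuous_intros)
  have dA: "(A has_derivative A' x) (at x)" if x: "x \<in> D" for x
    unfolding A_def[abs_def] A'_def[abs_def]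
  proof (intro has_derivative_sum has_derivative_scaleR_left)
    fix m i j
    have "((\<lambda>x. x0 + x) has_derivative (\<lambda>x. x)) (at x)" by (auto intro!: derivative_eq_intros)
    then show "((\<lambda>x. a m i j (x0 + x)) has_derivative frechet_derivative (a m i j) (at (x0 + x))) (at x)"
      using has_derivative_compose[OF _ smooth_on_has_derivative[OF smooth]] x by (fastforce simp: D_def)
  qed
  have cA': "continuous_on D (\<lambda>x. A' x v)" for v
    unfolding A'_def
  proof (intro continuous_intros)
    fix m i j
    show "continuous_on D (\<lambda>x. frechet_derivative (a m i j) (at (x0 + x)) v)"
      by (rule continuous_on_compose2[OF smooth_on_continuous[OF smooth_on_frechet[OF smooth]]])
        (auto simp: D_def intro!: continuous_intros)
  qed
  have flat': "A' x u v e + A x v (A x u e) = A' x v u e + A x u (A x v e)" if x: "x \<in> D" for x u v e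
  proof -
    \<comment> \<open>One side of the flatness hypothesis, hence symmetric in \<open>n\<close> and
      \<open>m\<close>. By \<open>key\<close> the expression to be symmetrized is a sum of
      \<open>c n m\<close> against the products of the m-th component of \<open>v\<close> and the
      n-th of \<open>u\<close>, so exchanging \<open>u\<close> and \<open>v\<close> only exchanges
      \<open>n\<close> and \<open>m\<close>.\<close>
    define c where "c n m i j = pderiv_at n (a m i j) (x0 + x) + (\<Sum>l\<in>UNIV. a m i l (x0 + x) * a n l j (x0 + x))" for n m i j
    have c: "c n m i j = c m n i j" for n m i j
      unfolding c_def using flat[of "x0 + x"] x by (simp add: D_def)
    have fr: "frechet_derivative (a m i j) (at (x0 + x)) u = (\<Sum>n\<in>UNIV. u $ n * pderiv_at n (a m i j) (x0 + x))" for m i j u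
      by (rule frechet_pderiv[OF smooth_on_differentiable[OF smooth]]) (use x in \<open>simp add: D_def\<close>)
    have key: "(A' x u v e + A x v (A x u e)) $ i = (\<Sum>m\<in>UNIV. \<Sum>n\<in>UNIV. \<Sum>j\<in>UNIV. c n m i j * v $ m * u $ n * e $ j)" for u v i
    proof -
      have "A' x u v e $ i = (\<Sum>m\<in>UNIV. \<Sum>j\<in>UNIV. \<Sum>n\<in>UNIV. pderiv_at n (a m i j) (x0 + x) * v $ m * u $ n * e $ j)"
        unfolding A'_def comp fr by (simp add: sum_distrib_left sum_distrib_right ac_simps)
      also have "\<dots> = (\<Sum>m\<in>UNIV. \<Sum>n\<in>UNIV. \<Sum>j\<in>UNIV. pderiv_at n (a m i j) (x0 + x) * v $ m * u $ n * e $ j)"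
        by (intro sum.cong refl sum.swap)
      finally have 1: "A' x u v e $ i = \<dots>" .
      have "A x v (A x u e) $ i = (\<Sum>m\<in>UNIV. \<Sum>l\<in>UNIV. \<Sum>n\<in>UNIV. \<Sum>j\<in>UNIV. a m i l (x0 + x) * a n l j (x0 + x) * v $ m * u $ n * e $ j)"
        unfolding A_def comp by (simp add: sum_distrib_left sum_distrib_right ac_simps)
      also have "\<dots> = (\<Sum>m\<in>UNIV. \<Sum>n\<in>UNIV. \<Sum>l\<in>UNIV. \<Sum>j\<in>UNIV. a m i l (x0 + x) * a n l j (x0 + x) * v $ m * u $ n * e $ j)"
        by (intro sum.cong refl sum.swap)
      also have "\<dots> = (\<Sum>m\<in>UNIV. \<Sum>n\<in>UNIV. \<Sum>j\<in>UNIV. \<Sum>l\<in>UNIV. a m i l (x0 + x) * a n l j (x0 + x) * v $ m * u $ n * e $ j)"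
        by (intro sum.cong refl sum.swap)
      finally have 2: "A x v (A x u e) $ i = \<dots>" .
      show ?thesis unfolding vector_add_component 1 2 c_def
        by (simp add: sum_distrib_right sum.distrib[symmetric] distrib_right)
    qed
    have "(A' x u v e + A x v (A x u e)) $ i = (A' x v u e + A x u (A x v e)) $ i" for i
      unfolding key by (subst sum.swap) (simp add: c ac_simps)
    then show ?thesis by (simp add: vec_eq_iff)
  qed
  have "isCont A 0" using dA[OF D(2)] by (rule has_derivative_continuous)
  then obtain r1 where r1: "r1 > 0" "\<And>x. dist x 0 < r1 \<Longrightarrow> dist (A x) (A 0) < 1"
    unfolding continuous_at_eps_delta by (metis zero_less_one)
  obtain r2 where r2: "r2 > 0" "ball 0 r2 \<subseteq> D" using D open_contains_ball by blast
  define K where "K = norm (A 0) + 1"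
  \<comment> \<open>The bound 1 / (8 K) gives \<open>K * r \<le> 1 / 8\<close>. The radius depends
    on the coefficients alone, so one ball serves all initial values \<open>e\<close>.\<close>
  define r where "r = min (min r1 r2) (1 / (8 * K))"
  have K: "K > 0" by (simp add: K_def add_nonneg_pos)
  have r: "r > 0" using r1 r2 K by (simp add: r_def)
  have rD: "ball 0 r \<subseteq> D" using r2(2) by (auto simp: r_def)
  have Kr: "K * r \<le> 1 / 8"
  proof -
    have "K * r \<le> K * (1 / (8 * K))" using K by (intro mult_left_mono) (auto simp: r_def)
    then show ?thesis using K by simp
  qed
  have bA: "norm (A x) \<le> K" if "x \<in> ball 0 r" for x
  proof -
    have "norm (A x - A 0) < 1" using r1(2)[of x] that by (auto simp: r_def dist_norm)
    then show ?thesis unfolding K_def using norm_triangle_sub[of "A x" "A 0"] by simp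
  qed
  have "ball x0 r \<subseteq> \<Omega>"
  proof
    fix x assume "x \<in> ball x0 r"
    then have "x - x0 \<in> ball 0 r" by (simp add: dist_norm norm_minus_commute)
    then show "x \<in> \<Omega>" using rD by (auto simp: D_def)
  qed
  moreover have "\<exists>F::real^'d \<Rightarrow> real^'n. F x0 = e \<and> smooth_on (ball x0 r) F \<and>
     (\<forall>x\<in>ball x0 r. \<forall>m i. pderiv_at m (\<lambda>x. F x $ i) x = (\<Sum>j\<in>UNIV. a m i j x * F x $ j))" for e
  proof -
    obtain F where F0: "F 0 = e" and dF: "\<And>x. x \<in> ball 0 r \<Longrightarrow> (F has_derivative (\<lambda>v. A x v (F x))) (at x)"
      using frobenius_blinfun[OF r less_imp_le[OF K] Kr bA dA continuous_on_subset[OF cA' rD] flat', of e] rD by blast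
    define H where "H x = F (x - x0)" for x
    have dH: "(H has_derivative (\<lambda>v. A (x - x0) v (H x))) (at x)" if "x \<in> ball x0 r" for x
    proof -
      have "((\<lambda>x. x - x0) has_derivative (\<lambda>v. v)) (at x)" by (auto intro!: derivative_eq_intros)
      moreover have "x - x0 \<in> ball 0 r" using that by (simp add: dist_norm norm_minus_commute)
      ultimately show ?thesis unfolding H_def using has_derivative_compose[OF _ dF] by fastforce
    qed
    have AH: "A (x - x0) v (H x) $ i = (\<Sum>m\<in>UNIV. \<Sum>j\<in>UNIV. a m i j x * v $ m * H x $ j)" for x v i
      unfolding A_def comp by simp
    \<comment> \<open>The right-hand side of the equation is as regular as \<open>H\<close>, so the
      bootstrap upgrades the differentiable solution to a smooth one.\<close>
    have "smooth_on (ball x0 r) H"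
    proof (rule smooth_on_bootstrap[OF open_ball dH])
      fix n v assume "C_on n H (ball x0 r)"
      then show "C_on n (\<lambda>x. A (x - x0) v (H x)) (ball x0 r)"
        using smooth_on_subset[OF smooth \<open>ball x0 r \<subseteq> \<Omega>\<close>]
        by (intro C_on_vec[OF open_ball]) (simp only: AH, intro C_on_sum C_on_mult open_ball C_on_const C_on_nth;
            simp add: smooth_on_def)
    qed
    moreover have "pderiv_at m (\<lambda>x. H x $ i) x = (\<Sum>j\<in>UNIV. a m i j x * H x $ j)" if "x \<in> ball x0 r" for x m i
    proof -
      have "((\<lambda>x. H x $ i) has_derivative (\<lambda>v. A (x - x0) v (H x) $ i)) (at x)"
        by (rule bounded_linear.has_derivative[OF bounded_linear_vec_nth dH[OF that]])
      then have "pderiv_at m (\<lambda>x. H x $ i) x = (\<Sum>m'\<in>UNIV. \<Sum>j\<in>UNIV. if m' = m then a m' i j x * H x $ j else 0)"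
        unfolding AH by (simp add: pderiv_atI axis_def if_distrib if_distribR cong: if_cong)
      also have "\<dots> = (\<Sum>j\<in>UNIV. \<Sum>m'\<in>UNIV. if m' = m then a m' i j x * H x $ j else 0)"
        by (rule sum.swap)
      finally show ?thesis by simp
    qed
    moreover have "H x0 = e" by (simp add: H_def F0)
    ultimately show ?thesis by blast
  qed
  ultimately show ?thesis using r by blast
qed

text \<open>A Gronwall argument without integrals: on a ball of radius s the mean value inequality
  bounds each component by C s times the maximum of the sum of all moduli. Adding the components
  bounds this maximum by half of itself, so it vanishes.\<close>

lemma linear_system_unique:
  fixes y :: "'i \<Rightarrow> 'a::euclidean_space \<Rightarrow> real"
  assumes I: "finite I" and r: "r > 0" and C: "C \<ge> 0"
    and der: "\<And>i x. i \<in> I \<Longrightarrow> x \<in> ball x0 r \<Longrightarrow> (y i has_derivative y' i x) (at x)"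
    and bound: "\<And>i x v. i \<in> I \<Longrightarrow> x \<in> ball x0 r \<Longrightarrow> \<bar>y' i x v\<bar> \<le> C * norm v * (\<Sum>j\<in>I. \<bar>y j x\<bar>)"
    and init: "\<And>i. i \<in> I \<Longrightarrow> y i x0 = 0"
  shows "\<exists>s>0. s \<le> r \<and> (\<forall>x\<in>ball x0 s. \<forall>i\<in>I. y i x = 0)"
proof -
  \<comment> \<open>\<open>r / 2\<close> keeps the closed ball inside the domain, where the maximum
    is attained. The other bound yields \<open>card I * C * s \<le> 1 / 2\<close>, the added 1
    guarding against a zero denominator.\<close>
  define s where "s = min (r / 2) (1 / (2 * (real (card I) * C + 1)))"
  have s: "s > 0" "s < r" using r C by (auto simp: s_def min_less_iff_disj add_nonneg_pos)
  have sC: "real (card I) * C * s \<le> 1 / 2"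
  proof -
    have "real (card I) * C * s \<le> real (card I) * C * (1 / (2 * (real (card I) * C + 1)))"
      using C by (intro mult_left_mono) (auto simp: s_def)
    also have "\<dots> \<le> 1 / 2"
    proof -
      have "x * (1 / (2 * (x + 1))) \<le> 1 / 2" if "x \<ge> 0" for x :: real
        using that by (simp add: field_simps)
      then show ?thesis using C by (meson mult_nonneg_nonneg of_nat_0_le_iff)
    qed
    finally show ?thesis .
  qed
  have sub: "cball x0 s \<subseteq> ball x0 r" using s by auto
  define Y where "Y x = (\<Sum>j\<in>I. \<bar>y j x\<bar>)" for x
  have cy: "continuous_on (cball x0 s) (y i)" if "i \<in> I" for i
    using der[OF that] sub has_derivative_continuous by (blast intro: continuous_at_imp_continuous_on)
  have "continuous_on (cball x0 s) Y" unfolding Y_def by (intro continuous_intros cy)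
  then obtain z where z: "z \<in> cball x0 s" "\<And>x. x \<in> cball x0 s \<Longrightarrow> Y x \<le> Y z"
    using continuous_attains_sup[OF compact_cball, of x0 s Y] s by auto
  have Y0: "Y x \<ge> 0" for x by (simp add: Y_def sum_nonneg)
  have "\<bar>y i z\<bar> \<le> C * Y z * s" if i: "i \<in> I" for i
  proof -
    have "norm (y i z - y i x0) \<le> (C * Y z) * norm (z - x0)"
    proof (rule differentiable_bound[OF convex_cball])
      fix x assume x: "x \<in> cball x0 s"
      then show "(y i has_derivative y' i x) (at x within cball x0 s)"
        using der[OF i] sub by (blast intro: has_derivative_at_withinI)
      show "onorm (y' i x) \<le> C * Y z"
      proof (rule onorm_le)
        fix v
        have "\<bar>y' i x v\<bar> \<le> C * norm v * Y x" using bound[OF i] sub x by (auto simp: Y_def)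
        also have "\<dots> \<le> C * norm v * Y z" using C z(2)[OF x] by (intro mult_left_mono) auto
        finally show "norm (y' i x v) \<le> C * Y z * norm v" by (simp add: ac_simps)
      qed
    qed (use z(1) s in auto)
    also have "\<dots> \<le> C * Y z * s"
      using z(1) C Y0 by (intro mult_left_mono) (auto simp: dist_norm norm_minus_commute)
    finally show ?thesis using init[OF i] by simp
  qed
  then have "Y z \<le> (\<Sum>j\<in>I. C * Y z * s)" unfolding Y_def by (intro sum_mono) (simp add: Y_def)
  also have "\<dots> = (real (card I) * C * s) * Y z" by simp
  also have "\<dots> \<le> 1 / 2 * Y z" using sC Y0 by (rule mult_right_mono)
  finally have "Y z = 0" using Y0[of z] by simp
  then have "Y x = 0" if "x \<in> cball x0 s" for x using z(2)[OF that] Y0[of x] by simp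
  then have "\<forall>x\<in>ball x0 s. \<forall>i\<in>I. y i x = 0"
    using I by (auto simp: Y_def sum_nonneg_eq_0_iff)
  then show ?thesis using s by (meson less_imp_le)
qed

section \<open>Vector fields in coordinates\<close>

lemma C_on_local:
  "(\<And>x. x \<in> S \<Longrightarrow> \<exists>T. open T \<and> x \<in> T \<and> C_on n f T) \<Longrightarrow> C_on n f S"
proof (induction n arbitrary: f)
  case 0
  have "isCont f x" if x: "x \<in> S" for x
  proof -
    obtain T where T: "open T" "x \<in> T" "continuous_on T f" using 0[OF x] by auto
    then show ?thesis using continuous_on_eq_continuous_at[OF T(1)] by metis
  qed
  then show ?case by (auto intro: continuous_at_imp_continuous_on)
next
  case (Suc n)
  have "f differentiable at x" if x: "x \<in> S" for x
  proof -
    obtain T where "open T" "x \<in> T" "C_on (Suc n) f T" using Suc.prems[OF x] by metis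
    then show ?thesis by simp
  qed
  moreover have "C_on n (\<lambda>x. frechet_derivative f (at x) v) S" for v
  proof (rule Suc.IH)
    fix x assume "x \<in> S"
    then obtain T where "open T" "x \<in> T" "C_on (Suc n) f T" using Suc.prems by metis
    then show "\<exists>T. open T \<and> x \<in> T \<and> C_on n (\<lambda>x. frechet_derivative f (at x) v) T"
      by (intro exI[of _ T]) simp
  qed
  ultimately show ?case by simp
qed

lemma smooth_on_local:
  "(\<And>x. x \<in> S \<Longrightarrow> \<exists>T. open T \<and> x \<in> T \<and> smooth_on T f) \<Longrightarrow> smooth_on S f"
  unfolding smooth_on_def by (rule allI, rule C_on_local) metis

lemma has_derivative_cong_nhds:
  assumes "(f has_derivative L) (at x)" "\<forall>\<^sub>F y in nhds x. f y = h y"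
  shows "(h has_derivative L) (at x)"
proof -
  obtain S where S: "open S" "x \<in> S" "\<And>y. y \<in> S \<Longrightarrow> f y = h y"
    using assms(2) unfolding eventually_nhds by metis
  show ?thesis by (rule has_derivative_transform_within_open[OF assms(1) S])
qed

section \<open>Charts and their inverse parametrizations\<close>

lemma is_chart_open_image: "is_chart M c \<Longrightarrow> open (snd c ` fst c)"
  by (simp add: is_chart_def)

lemma is_chart_openin: "is_chart M c \<Longrightarrow> openin M (fst c)"
  by (simp add: is_chart_def)

lemma is_chart_inj: "is_chart M c \<Longrightarrow> inj_on (snd c) (fst c)"
proof -
  assume c: "is_chart M c"
  then have "topspace (subtopology M (fst c)) = fst c"
    using openin_subset[OF is_chart_openin[OF c]] by auto
  then show ?thesis
    using c homeomorphic_imp_injective_map[of "subtopology M (fst c)" _ "snd c"] by (auto simp: is_chart_def)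
qed

lemma param_snd: "is_chart M c \<Longrightarrow> p \<in> fst c \<Longrightarrow> param c (snd c p) = p"
  by (simp add: param_def is_chart_inj)

lemma snd_param: "y \<in> snd c ` fst c \<Longrightarrow> snd c (param c y) = y"
  by (simp add: param_def f_inv_into_f)

lemma param_in: "y \<in> snd c ` fst c \<Longrightarrow> param c y \<in> fst c"
  by (simp add: param_def inv_into_into)

lemma param_in': "is_chart M c \<Longrightarrow> W \<subseteq> fst c \<Longrightarrow> y \<in> snd c ` W \<Longrightarrow> param c y \<in> W"
  by (auto simp: param_snd subset_iff)

lemma is_chart_image_open:
  assumes c: "is_chart M c" and W: "openin M W" "W \<subseteq> fst c"
  shows "open (snd c ` W)"
proof -
  have "openin (subtopology M (fst c)) W" using W openin_subset_topspace_eq openin_subtopology_Int2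
    by (metis inf.absorb2)
  then have "openin (top_of_set (snd c ` fst c)) (snd c ` W)"
    using c homeomorphic_imp_open_map unfolding is_chart_def open_map_def by blast
  then show ?thesis using is_chart_open_image[OF c] openin_open_trans by blast
qed

lemma continuous_map_param:
  assumes c: "is_chart M c"
  shows "continuous_map (top_of_set (snd c ` fst c)) M (param c)"
proof -
  obtain h where h: "homeomorphic_maps (subtopology M (fst c)) (top_of_set (snd c ` fst c)) (snd c) h"
    using c homeomorphic_map_maps unfolding is_chart_def by blast
  have "continuous_map (top_of_set (snd c ` fst c)) (subtopology M (fst c)) h"
    using h by (simp add: homeomorphic_maps_def)
  moreover have "h y = param c y" if "y \<in> topspace (top_of_set (snd c ` fst c))" for y
  proof -
    obtain p where p: "p \<in> fst c" "y = snd c p" using \<open>y \<in> _\<close> by auto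
    have "topspace (subtopology M (fst c)) = fst c"
      using openin_subset[OF is_chart_openin[OF c]] by auto
    then have "h (snd c p) = p" using h p by (simp add: homeomorphic_maps_def)
    then show ?thesis using p param_snd[OF c] by simp
  qed
  ultimately have "continuous_map (top_of_set (snd c ` fst c)) (subtopology M (fst c)) (param c)"
    by (rule continuous_map_eq)
  then show ?thesis by (rule continuous_map_into_fulltopology)
qed

lemma is_chart_param_open:
  assumes c: "is_chart M c" and V: "open V" "V \<subseteq> snd c ` fst c"
  shows "openin M (param c ` V)"
proof -
  have cm: "continuous_map (subtopology M (fst c)) (top_of_set (snd c ` fst c)) (snd c)"
    using c homeomorphic_imp_continuous_map unfolding is_chart_def by blast
  have ts: "topspace (subtopology M (fst c)) = fst c"
    using openin_subset[OF is_chart_openin[OF c]] by auto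
  have "openin (top_of_set (snd c ` fst c)) V" using V by (auto simp: openin_open intro!: exI[of _ V])
  then have "openin (subtopology M (fst c)) {p \<in> fst c. snd c p \<in> V}"
    using openin_continuous_map_preimage[OF cm] ts by fastforce
  moreover have "{p \<in> fst c. snd c p \<in> V} = param c ` V"
  proof (intro equalityI subsetI)
    fix p assume "p \<in> {p \<in> fst c. snd c p \<in> V}"
    then show "p \<in> param c ` V" using param_snd[OF c, of p] by (auto intro!: image_eqI[of _ _ "snd c p"])
  next
    fix p assume "p \<in> param c ` V"
    then show "p \<in> {p \<in> fst c. snd c p \<in> V}" using V by (auto simp: param_in snd_param subset_iff)
  qed
  ultimately show ?thesis using is_chart_openin[OF c] openin_trans_full by metis
qed

section \<open>Smooth functions on a manifold\<close>

locale mfd =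
  fixes M :: "'m topology" and A :: "('m, 'd::finite) chart set"
  assumes smooth_manifold: "smooth_manifold M A"
begin

abbreviation "cs \<equiv> coordinate_system M A"
abbreviation "tsp \<equiv> tangent_space M A"
abbreviation "VF \<equiv> vector_fields M A"
abbreviation "cf \<equiv> coord_field M A"
abbreviation "sfun \<equiv> smooth_fun M A"

lemma atlas_cs: "c \<in> A \<Longrightarrow> cs c"
  using smooth_manifold by (simp add: smooth_manifold_def coordinate_system_def)

lemma atlas_cover: "p \<in> topspace M \<Longrightarrow> \<exists>c\<in>A. p \<in> fst c"
  using smooth_manifold by (auto simp: smooth_manifold_def)

lemma cs_chart: "cs c \<Longrightarrow> is_chart M c"
  by (simp add: coordinate_system_def)

lemma cs_atlas_cover: "cs c \<Longrightarrow> p \<in> fst c \<Longrightarrow> \<exists>a\<in>A. p \<in> fst a"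
  using atlas_cover is_chart_openin[OF cs_chart] openin_subset by blast

lemma transition_smooth:
  assumes "cs c" "a \<in> A"
  shows "smooth_on (snd c ` (fst c \<inter> fst a)) (snd a \<circ> param c)" "smooth_on (snd a ` (fst c \<inter> fst a)) (snd c \<circ> param a)"
  using assms by (auto simp: coordinate_system_def compatible_def Int_commute)

lemma sfun_open: "sfun W f \<Longrightarrow> openin M W"
  by (simp add: smooth_fun_def)

text \<open>Smoothness of a function is tested in atlas charts, while \<open>c\<close> is only
  compatible with them. Each point lies in some atlas chart, and composing with the transition map
  gives smoothness near that point; hence the appeal to \<open>smooth_on_local\<close>.\<close>

lemma sfun_cs:
  assumes f: "sfun V f" and c: "cs c"
  shows "smooth_on (snd c ` (V \<inter> fst c)) (f \<circ> param c)"
proof (rule smooth_on_local)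
  fix y assume "y \<in> snd c ` (V \<inter> fst c)"
  then obtain p where p: "p \<in> V" "p \<in> fst c" "y = snd c p" by blast
  obtain a where a: "a \<in> A" "p \<in> fst a" using cs_atlas_cover[OF c p(2)] by blast
  note ca = cs_chart[OF atlas_cs[OF a(1)]] and cc = cs_chart[OF c]
  define T where "T = snd c ` (V \<inter> fst c \<inter> fst a)"
  have op: "openin M (V \<inter> fst c \<inter> fst a)"
    using sfun_open[OF f] is_chart_openin[OF ca] is_chart_openin[OF cc] by blast
  have T: "open T" unfolding T_def by (rule is_chart_image_open[OF cc op]) auto
  have "smooth_on T (\<lambda>x. (f \<circ> param a) ((snd a \<circ> param c) x))"
  proof (rule smooth_on_compose[where f = "f \<circ> param a" and g = "snd a \<circ> param c", OF T])
    show "smooth_on (snd a ` (V \<inter> fst a)) (f \<circ> param a)" using f a by (simp add: smooth_fun_def)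
    show "smooth_on T (snd a \<circ> param c)"
      by (rule smooth_on_subset[OF transition_smooth(1)[OF c a(1)]]) (auto simp: T_def)
    show "(snd a \<circ> param c) x \<in> snd a ` (V \<inter> fst a)" if "x \<in> T" for x
      using that param_snd[OF cc] by (auto simp: T_def)
  qed
  moreover have "(f \<circ> param a) ((snd a \<circ> param c) x) = (f \<circ> param c) x" if "x \<in> T" for x
    using that param_snd[OF cc] param_snd[OF ca] by (auto simp: T_def)
  ultimately have "smooth_on T (f \<circ> param c)"
    using smooth_on_cong[OF T, of "\<lambda>x. (f \<circ> param a) ((snd a \<circ> param c) x)" "f \<circ> param c"] by blast
  then show "\<exists>T. open T \<and> y \<in> T \<and> smooth_on T (f \<circ> param c)"
    using T p a by (auto simp: T_def)
qed

text \<open>Conversely, a single coordinate system covering \<open>V\<close> decides smoothness,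
  again by composition with transition maps. Functions built in one chart become smooth functions on
  the manifold in this way.\<close>

lemma sfun_csI:
  assumes c: "cs c" and V: "openin M V" "V \<subseteq> fst c" and f: "smooth_on (snd c ` V) (f \<circ> param c)"
  shows "sfun V f"
  unfolding smooth_fun_def
proof (intro conjI ballI V(1))
  fix a assume a: "a \<in> A"
  note ca = cs_chart[OF atlas_cs[OF a]] and cc = cs_chart[OF c]
  have T: "open (snd a ` (V \<inter> fst a))"
    by (rule is_chart_image_open[OF ca]) (use V is_chart_openin[OF ca] in auto)
  have "smooth_on (snd a ` (V \<inter> fst a)) (\<lambda>x. (f \<circ> param c) ((snd c \<circ> param a) x))"
  proof (rule smooth_on_compose[where f = "f \<circ> param c" and g = "snd c \<circ> param a", OF T _ f])
    show "smooth_on (snd a ` (V \<inter> fst a)) (snd c \<circ> param a)"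
      by (rule smooth_on_subset[OF transition_smooth(2)[OF c a]]) (use V in auto)
    show "(snd c \<circ> param a) x \<in> snd c ` V" if "x \<in> snd a ` (V \<inter> fst a)" for x
      using that param_snd[OF ca] V by auto
  qed
  moreover have "(f \<circ> param c) ((snd c \<circ> param a) x) = (f \<circ> param a) x" if "x \<in> snd a ` (V \<inter> fst a)" for x
    using that param_snd[OF cc] param_snd[OF ca] V by auto
  ultimately show "smooth_on (snd a ` (V \<inter> fst a)) (f \<circ> param a)"
    using smooth_on_cong[OF T, of "\<lambda>x. (f \<circ> param c) ((snd c \<circ> param a) x)" "f \<circ> param a"] by blast
qed

lemma sfun_subset: "sfun W f \<Longrightarrow> openin M V \<Longrightarrow> V \<subseteq> W \<Longrightarrow> sfun V f"
  unfolding smooth_fun_def by (blast intro: smooth_on_subset)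

lemma sfun_image_open: "openin M W \<Longrightarrow> a \<in> A \<Longrightarrow> open (snd a ` (W \<inter> fst a))"
  by (rule is_chart_image_open[OF cs_chart[OF atlas_cs]])
    (auto intro: is_chart_openin[OF cs_chart[OF atlas_cs]])

lemma sfun_const: "openin M W \<Longrightarrow> sfun W (\<lambda>q. c)"
  by (simp add: smooth_fun_def comp_def smooth_on_const)

lemma sfun_add: "sfun W f \<Longrightarrow> sfun W h \<Longrightarrow> sfun W (\<lambda>q. f q + h q)"
  by (simp add: smooth_fun_def comp_def sfun_image_open smooth_on_add)

lemma sfun_mult: "sfun W f \<Longrightarrow> sfun W h \<Longrightarrow> sfun W (\<lambda>q. f q * h q)"
  by (simp add: smooth_fun_def comp_def sfun_image_open smooth_on_mult)

lemma sfun_sum: "openin M W \<Longrightarrow> (\<And>i. i \<in> I \<Longrightarrow> sfun W (f i)) \<Longrightarrow> sfun W (\<lambda>q. \<Sum>i\<in>I. f i q)"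
  by (simp add: smooth_fun_def comp_def sfun_image_open smooth_on_sum)

lemma sfun_cong:
  assumes "\<And>q. q \<in> W \<Longrightarrow> f q = h q" "sfun W f"
  shows "sfun W h"
  unfolding smooth_fun_def
proof (intro conjI ballI sfun_open[OF assms(2)])
  fix a assume a: "a \<in> A"
  have "(f \<circ> param a) x = (h \<circ> param a) x" if "x \<in> snd a ` (W \<inter> fst a)" for x
    using that param_snd[OF cs_chart[OF atlas_cs[OF a]]] assms(1) by auto
  then show "smooth_on (snd a ` (W \<inter> fst a)) (h \<circ> param a)"
    using assms(2) a smooth_on_cong[OF sfun_image_open[OF sfun_open[OF assms(2)] a]]
    unfolding smooth_fun_def by blast
qed

lemma sfun_coord: "cs c \<Longrightarrow> sfun (fst c) (\<lambda>q. snd c q $ k)"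
proof (rule sfun_csI)
  assume c: "cs c"
  note cc = cs_chart[OF c]
  show "openin M (fst c)" by (rule is_chart_openin[OF cc])
  show "smooth_on (snd c ` fst c) ((\<lambda>q. snd c q $ k) \<circ> param c)"
    using smooth_on_cong[OF is_chart_open_image[OF cc], of "(\<lambda>q. snd c q $ k) \<circ> param c" "\<lambda>y. y $ k"]
      smooth_on_linear[OF bounded_linear_vec_nth] by (auto simp: snd_param)
qed auto

section \<open>Tangent vectors as directional derivatives\<close>

lemma smooth_nearI: "sfun W f \<Longrightarrow> p \<in> W \<Longrightarrow> smooth_near M A p f"
  unfolding smooth_near_def by blast

lemma smooth_near_differentiable:
  assumes "smooth_near M A p f" "cs c" "p \<in> fst c"
  shows "(f \<circ> param c) differentiable (at (snd c p))"
  using assms sfun_cs[of _ f c] smooth_on_differentiable unfolding smooth_near_def by blast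

lemma dir_deriv_has_derivative:
  assumes "smooth_near M A p f" "cs c" "p \<in> fst c"
  shows "((f \<circ> param c) has_derivative (\<lambda>a. dir_deriv M A c p a f)) (at (snd c p))"
  using smooth_near_differentiable[OF assms] assms(1) by (simp add: dir_deriv_def frechet_derivative_works)

lemma dir_derivI:
  assumes "smooth_near M A p f" "((f \<circ> param c) has_derivative L) (at (snd c p))"
  shows "dir_deriv M A c p a f = L a"
  using assms frechet_derivative_at[OF assms(2)] by (simp add: dir_deriv_def)

lemma eventually_chart:
  assumes c: "cs c" and p: "p \<in> fst c" and V: "openin M V" "p \<in> V"
  shows "\<forall>\<^sub>F y in nhds (snd c p). y \<in> snd c ` fst c \<and> param c y \<in> V"
proof -
  note cc = cs_chart[OF c]
  have "open (snd c ` (V \<inter> fst c))"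
    by (rule is_chart_image_open[OF cc]) (use V is_chart_openin[OF cc] in auto)
  moreover have "snd c p \<in> snd c ` (V \<inter> fst c)" using p V by blast
  ultimately show ?thesis
    using param_snd[OF cc] by (auto simp: eventually_nhds intro!: exI[of _ "snd c ` (V \<inter> fst c)"])
qed

text \<open>Being smooth near \<open>p\<close> is itself a local property, so either both functions
  are differentiated or both receive the default value 0.\<close>

lemma dir_deriv_cong:
  assumes c: "cs c" and p: "p \<in> fst c" and V: "openin M V" "p \<in> V" and eq: "\<And>q. q \<in> V \<Longrightarrow> f q = h q"
  shows "dir_deriv M A c p a f = dir_deriv M A c p a h"
proof -
  have sn: "smooth_near M A p h" if "smooth_near M A p f" "\<And>q. q \<in> V \<Longrightarrow> f q = h q" for f h
  proof -
    obtain W where W: "p \<in> W" "sfun W f" using \<open>smooth_near M A p f\<close> by (auto simp: smooth_near_def)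
    then have "sfun (W \<inter> V) f" using V sfun_open[OF W(2)] by (intro sfun_subset[OF W(2)]) auto
    then have "sfun (W \<inter> V) h" using that(2) by (auto intro: sfun_cong)
    then show ?thesis using W V by (auto intro: smooth_nearI)
  qed
  show ?thesis
  proof (cases "smooth_near M A p f")
    case True
    then have h: "smooth_near M A p h" using sn eq by blast
    have "\<forall>\<^sub>F y in nhds (snd c p). (f \<circ> param c) y = (h \<circ> param c) y"
      using eventually_chart[OF c p V] by eventually_elim (simp add: eq)
    then have "((h \<circ> param c) has_derivative (\<lambda>a. dir_deriv M A c p a f)) (at (snd c p))"
      by (rule has_derivative_cong_nhds[OF dir_deriv_has_derivative[OF True c p]])
    then show ?thesis using dir_derivI[OF h] by simp
  next
    case False
    then have "\<not> smooth_near M A p h" using sn[of h f] eq by auto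
    then show ?thesis using False by (simp add: dir_deriv_def)
  qed
qed

lemma dir_deriv_coord:
  assumes c: "cs c" and p: "p \<in> fst c"
  shows "dir_deriv M A c p a (\<lambda>q. snd c q $ k) = a $ k"
proof (rule dir_derivI)
  note cc = cs_chart[OF c]
  show "smooth_near M A p (\<lambda>q. snd c q $ k)" by (rule smooth_nearI[OF sfun_coord[OF c] p])
  have "((\<lambda>y. y $ k) has_derivative (\<lambda>a. a $ k)) (at (snd c p))"
    by (rule bounded_linear_imp_has_derivative[OF bounded_linear_vec_nth])
  then show "((\<lambda>q. snd c q $ k) \<circ> param c has_derivative (\<lambda>a. a $ k)) (at (snd c p))"
    by (rule has_derivative_transform_within_open[OF _ is_chart_open_image[OF cc]]) (use p in \<open>auto simp: snd_param\<close>)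
qed

text \<open>The function \<open>f\<close> is arbitrary: if it is not smooth near \<open>p\<close>,
  every term takes the default value 0. The identity is thus one between tangent vectors.\<close>

lemma dir_deriv_expand:
  assumes c: "cs c" and p: "p \<in> fst c"
  shows "dir_deriv M A c p a f = (\<Sum>k\<in>UNIV. a $ k * cf c k p f)"
proof (cases "smooth_near M A p f")
  case True
  then show ?thesis using frechet_pderiv[OF smooth_near_differentiable[OF True c p], of a]
    by (simp add: dir_deriv_def coord_field_def pderiv_at_def)
qed (simp add: dir_deriv_def coord_field_def)

lemma coord_field_pderiv:
  "smooth_near M A p f \<Longrightarrow> cf c k p f = pderiv_at k (f \<circ> param c) (snd c p)"
  by (simp add: dir_deriv_def coord_field_def pderiv_at_def)

text \<open>Chain rule: the components of a vector in the coordinate system \<open>c\<close> are the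
  derivatives of the coordinate functions of \<open>c\<close> along it.\<close>

lemma dir_deriv_change:
  assumes c: "cs c" "p \<in> fst c" and c': "cs c'" "p \<in> fst c'"
  shows "\<exists>b. dir_deriv M A c' p a = dir_deriv M A c p b"
proof -
  define b where "b = (\<chi> k. dir_deriv M A c' p a (\<lambda>q. snd c q $ k))"
  have "dir_deriv M A c' p a f = dir_deriv M A c p b f" if f: "smooth_near M A p f" for f
  proof (rule dir_derivI[OF f, THEN trans])
    have "((\<lambda>y. snd c (param c' y) $ k) has_derivative (\<lambda>a. dir_deriv M A c' p a (\<lambda>q. snd c q $ k))) (at (snd c' p))" for k
      using dir_deriv_has_derivative[OF smooth_nearI[OF sfun_coord[OF c(1)] c(2)] c'] by (simp add: comp_def)
    then have 1: "((\<lambda>y. snd c (param c' y)) has_derivative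
        (\<lambda>a. \<chi> k. dir_deriv M A c' p a (\<lambda>q. snd c q $ k))) (at (snd c' p))"
      by (subst has_derivative_componentwise_within)
        (auto simp: Basis_vec_def inner_axis)
    have "snd c (param c' (snd c' p)) = snd c p" using param_snd[OF cs_chart[OF c'(1)] c'(2)] by simp
    then have 2: "((f \<circ> param c) has_derivative (\<lambda>a. dir_deriv M A c p a f)) (at (snd c (param c' (snd c' p))))"
      using dir_deriv_has_derivative[OF f c] by simp
    have "((\<lambda>y. (f \<circ> param c) (snd c (param c' y))) has_derivative
        (\<lambda>a. dir_deriv M A c p (\<chi> k. dir_deriv M A c' p a (\<lambda>q. snd c q $ k)) f)) (at (snd c' p))"
      by (rule has_derivative_compose[OF 1 2])
    moreover have "\<forall>\<^sub>F y in nhds (snd c' p). (f \<circ> param c) (snd c (param c' y)) = (f \<circ> param c') y"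
      using eventually_chart[OF c' is_chart_openin[OF cs_chart[OF c(1)]] c(2)]
      by eventually_elim (simp add: param_snd[OF cs_chart[OF c(1)]])
    ultimately show "(f \<circ> param c' has_derivative
        (\<lambda>a. dir_deriv M A c p (\<chi> k. dir_deriv M A c' p a (\<lambda>q. snd c q $ k)) f)) (at (snd c' p))"
      by (rule has_derivative_cong_nhds)
  qed (simp add: b_def)
  then have "dir_deriv M A c' p a = dir_deriv M A c p b"
    by (intro ext) (auto simp: dir_deriv_def)
  then show ?thesis by blast
qed

text \<open>\<open>tangent_space\<close> collects directional derivatives over all atlas charts at
  \<open>p\<close>; one coordinate system around \<open>p\<close> already provides them all. Linear
  combinations and expansions can therefore be computed in that one system.\<close>

lemma tangent_iff:
  assumes c: "cs c" "p \<in> fst c"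
  shows "u \<in> tsp p \<longleftrightarrow> (\<exists>a. u = dir_deriv M A c p a)"
proof
  assume "u \<in> tsp p"
  then obtain c' x where "c' \<in> A" "p \<in> fst c'" "u = dir_deriv M A c' p x" unfolding tangent_space_def by blast
  then show "\<exists>a. u = dir_deriv M A c p a" using dir_deriv_change[OF c atlas_cs] by metis
next
  assume "\<exists>a. u = dir_deriv M A c p a"
  then obtain x where x: "u = dir_deriv M A c p x" by blast
  obtain c' where c': "c' \<in> A" "p \<in> fst c'" using cs_atlas_cover[OF c] by blast
  obtain b where "u = dir_deriv M A c' p b" using dir_deriv_change[OF atlas_cs[OF c'(1)] c'(2) c, of x] x by metis
  then show "u \<in> tsp p" using c' unfolding tangent_space_def by blast
qed

lemma coord_field_tangent: "cs c \<Longrightarrow> p \<in> fst c \<Longrightarrow> cf c i p \<in> tsp p"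
  unfolding coord_field_def using tangent_iff by blast

lemma coord_field_coord: "cs c \<Longrightarrow> p \<in> fst c \<Longrightarrow> cf c i p (\<lambda>q. snd c q $ k) = (if k = i then 1 else 0)"
  by (simp add: coord_field_def dir_deriv_coord axis_def)

text \<open>A tangent vector is determined by its values on the coordinate functions. Vanishing of a
  vector, for instance of a bracket or of the acceleration of a curve, is proved by testing it on
  them.\<close>

lemma tangent_expand:
  assumes c: "cs c" "p \<in> fst c" and u: "u \<in> tsp p"
  shows "u f = (\<Sum>k\<in>UNIV. u (\<lambda>q. snd c q $ k) * cf c k p f)"
proof -
  obtain a where a: "u = dir_deriv M A c p a" using u tangent_iff[OF c] by blast
  show ?thesis unfolding a dir_deriv_expand[OF c, of a f] dir_deriv_coord[OF c] ..
qed

lemma tangent_chart: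
  assumes "u \<in> tsp p" obtains c a where "cs c" "p \<in> fst c" "u = dir_deriv M A c p a"
  using assms atlas_cs unfolding tangent_space_def by blast

lemma tangent_lincomb:
  assumes u: "u \<in> tsp p" "v \<in> tsp p"
  shows "(\<lambda>f. a * u f + b * v f) \<in> tsp p"
proof -
  obtain c x where c: "cs c" "p \<in> fst c" and x: "u = dir_deriv M A c p x" using tangent_chart[OF u(1)] .
  obtain y where y: "v = dir_deriv M A c p y" using u(2) tangent_iff[OF c] by blast
  have "(\<lambda>f. a * u f + b * v f) = dir_deriv M A c p (a *\<^sub>R x + b *\<^sub>R y)"
  proof (rule ext)
    fix f
    show "a * u f + b * v f = dir_deriv M A c p (a *\<^sub>R x + b *\<^sub>R y) f"
      unfolding x y dir_deriv_expand[OF c, of x] dir_deriv_expand[OF c, of y] dir_deriv_expand[OF c, of "a *\<^sub>R x + b *\<^sub>R y"]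
      by (simp add: sum_distrib_left sum.distrib[symmetric] algebra_simps)
  qed
  then show ?thesis using tangent_iff[OF c] by blast
qed

lemma tangent_cong:
  assumes "u \<in> tsp p" "openin M V" "p \<in> V" "\<And>q. q \<in> V \<Longrightarrow> f q = h q"
  shows "u f = u h"
proof -
  obtain c a where c: "cs c" "p \<in> fst c" and a: "u = dir_deriv M A c p a" using tangent_chart[OF assms(1)] .
  show ?thesis unfolding a by (rule dir_deriv_cong[OF c assms(2-4)])
qed

lemma tangent_mult:
  assumes u: "u \<in> tsp p" and f: "smooth_near M A p f" and h: "smooth_near M A p h"
  shows "u (\<lambda>q. f q * h q) = f p * u h + h p * u f"
proof -
  obtain c a where c: "cs c" "p \<in> fst c" and a: "u = dir_deriv M A c p a" using tangent_chart[OF u] .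
  obtain V W where "p \<in> V" "sfun V f" "p \<in> W" "sfun W h" using f h by (auto simp: smooth_near_def)
  then have "sfun (V \<inter> W) (\<lambda>q. f q * h q)" using sfun_open[of V f] sfun_open[of W h]
    by (intro sfun_mult) (auto intro: sfun_subset)
  then have sn: "smooth_near M A p (\<lambda>q. f q * h q)" using \<open>p \<in> V\<close> \<open>p \<in> W\<close> by (auto intro: smooth_nearI)
  have "u (\<lambda>q. f q * h q) = (f \<circ> param c) (snd c p) * dir_deriv M A c p a h + dir_deriv M A c p a f * (h \<circ> param c) (snd c p)"
    unfolding a
    by (rule dir_derivI[OF sn]) (use has_derivative_mult[OF dir_deriv_has_derivative[OF f c] dir_deriv_has_derivative[OF h c]] in \<open>simp add: comp_def\<close>)
  then show ?thesis by (simp add: a param_snd[OF cs_chart[OF c(1)] c(2)])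
qed

text \<open>The smoothness hypotheses matter: with the default value 0, additivity can fail when two
  functions that are not smooth have a smooth sum.\<close>

lemma tangent_add:
  assumes u: "u \<in> tsp p" and f: "smooth_near M A p f" and h: "smooth_near M A p h"
  shows "u (\<lambda>q. f q + h q) = u f + u h"
proof -
  obtain c a where c: "cs c" "p \<in> fst c" and a: "u = dir_deriv M A c p a" using tangent_chart[OF u] .
  obtain V W where "p \<in> V" "sfun V f" "p \<in> W" "sfun W h" using f h by (auto simp: smooth_near_def)
  then have "sfun (V \<inter> W) (\<lambda>q. f q + h q)" using sfun_open[of V f] sfun_open[of W h]
    by (intro sfun_add) (auto intro: sfun_subset)
  then have sn: "smooth_near M A p (\<lambda>q. f q + h q)" using \<open>p \<in> V\<close> \<open>p \<in> W\<close> by (auto intro: smooth_nearI)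
  show ?thesis
    unfolding a
    by (rule dir_derivI[OF sn]) (use has_derivative_add[OF dir_deriv_has_derivative[OF f c] dir_deriv_has_derivative[OF h c]] in \<open>simp add: comp_def\<close>)
qed

lemma tangent_const:
  assumes u: "u \<in> tsp p"
  shows "u (\<lambda>q. k) = 0"
proof -
  obtain c a where c: "cs c" "p \<in> fst c" and a: "u = dir_deriv M A c p a" using tangent_chart[OF u] .
  have "sfun (fst c) (\<lambda>q. k)" by (rule sfun_const[OF is_chart_openin[OF cs_chart[OF c(1)]]])
  then have sn: "smooth_near M A p (\<lambda>q. k)" using c by (auto intro: smooth_nearI)
  show ?thesis unfolding a by (rule dir_derivI[OF sn]) (simp add: comp_def)
qed

lemma tangent_sum:
  assumes u: "u \<in> tsp p" and "finite I" and W: "p \<in> W" "openin M W" and f: "\<And>i. i \<in> I \<Longrightarrow> sfun W (f i)"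
  shows "u (\<lambda>q. \<Sum>i\<in>I. f i q) = (\<Sum>i\<in>I. u (f i))"
  using assms(2) f
proof (induction I rule: finite_induct)
  case empty
  then show ?case by (simp add: tangent_const[OF u])
next
  case (insert i I)
  have "u (\<lambda>q. f i q + (\<Sum>i\<in>I. f i q)) = u (f i) + u (\<lambda>q. \<Sum>i\<in>I. f i q)"
    using insert.prems W by (intro tangent_add[OF u] smooth_nearI[of W] sfun_sum) auto
  then show ?case using insert by simp
qed

section \<open>Smooth vector fields and their coordinate components\<close>

lemma VF_tangent: "X \<in> VF W \<Longrightarrow> p \<in> W \<Longrightarrow> X p \<in> tsp p"
  by (simp add: vector_fields_def)

lemma VF_sfun: "X \<in> VF W \<Longrightarrow> V \<subseteq> W \<Longrightarrow> sfun V f \<Longrightarrow> sfun V (\<lambda>p. X p f)"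
  by (auto simp: vector_fields_def)

lemma VF_lincomb:
  assumes X: "X \<in> VF W" "Y \<in> VF W" and h: "sfun W h" "sfun W k"
  shows "(\<lambda>q f. h q * X q f + k q * Y q f) \<in> VF W"
proof -
  have "sfun V (\<lambda>p. h p * X p f + k p * Y p f)" if "V \<subseteq> W" "sfun V f" for V f
    using that VF_sfun[OF X(1)] VF_sfun[OF X(2)] sfun_open[OF that(2)]
    by (intro sfun_add sfun_mult) (auto intro: sfun_subset[OF h(1)] sfun_subset[OF h(2)])
  then show ?thesis using X by (auto simp: vector_fields_def intro: tangent_lincomb)
qed

lemma VF_zero: "openin M W \<Longrightarrow> (\<lambda>q f. 0) \<in> VF W"
proof -
  assume W: "openin M W"
  have "(\<lambda>f. 0) \<in> tsp q" if q: "q \<in> W" for q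
  proof -
    obtain c where c: "c \<in> A" "q \<in> fst c" using atlas_cover openin_subset[OF W] q by blast
    then have "dir_deriv M A c q 0 \<in> tsp q" unfolding tangent_space_def by blast
    then show ?thesis using tangent_lincomb[of _ q _ 0 0] by fastforce
  qed
  then show ?thesis by (auto simp: vector_fields_def sfun_const sfun_open)
qed

lemma VF_sum:
  assumes W: "openin M W" and "finite I" "\<And>i. i \<in> I \<Longrightarrow> X i \<in> VF W" "\<And>i. i \<in> I \<Longrightarrow> sfun W (h i)"
  shows "(\<lambda>q f. \<Sum>i\<in>I. h i q * X i q f) \<in> VF W"
  using assms(2-)
proof (induction I rule: finite_induct)
  case empty
  then show ?case by (simp add: VF_zero W)
next
  case (insert i I)
  have "(\<lambda>q f. h i q * X i q f + 1 * (\<Sum>i\<in>I. h i q * X i q f)) \<in> VF W"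
    using insert by (intro VF_lincomb sfun_const W) auto
  then show ?case using insert by simp
qed

lemma VF_coord:
  assumes c: "cs c" and W: "W \<subseteq> fst c"
  shows "cf c i \<in> VF W"
proof -
  have "sfun V (\<lambda>p. cf c i p f)" if V: "V \<subseteq> W" and f: "sfun V f" for V f
  proof (rule sfun_csI[OF c sfun_open[OF f]])
    note cc = cs_chart[OF c]
    show sub: "V \<subseteq> fst c" using V W by simp
    have op: "open (snd c ` V)" by (rule is_chart_image_open[OF cc sfun_open[OF f] sub])
    have sm: "smooth_on (snd c ` V) (f \<circ> param c)" using sfun_cs[OF f c] sub by (simp add: Int_absorb2)
    have "pderiv_at i (f \<circ> param c) y = ((\<lambda>p. cf c i p f) \<circ> param c) y" if y: "y \<in> snd c ` V" for y
    proof -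
      have "param c y \<in> V" by (rule param_in'[OF cc sub y])
      moreover have "snd c (param c y) = y" using y sub by (intro snd_param) auto
      ultimately show ?thesis using coord_field_pderiv[OF smooth_nearI[OF f], of "param c y" c i] by simp
    qed
    then show "smooth_on (snd c ` V) ((\<lambda>p. cf c i p f) \<circ> param c)"
      using smooth_on_cong[OF op, of "pderiv_at i (f \<circ> param c)"] smooth_on_pderiv[OF sm] by blast
  qed
  then show ?thesis using coord_field_tangent[OF c] W by (auto simp: vector_fields_def)
qed

lemma VF_expand:
  assumes c: "cs c" "W \<subseteq> fst c" and X: "X \<in> VF W" and q: "q \<in> W"
  shows "X q = (\<lambda>f. \<Sum>k\<in>UNIV. X q (\<lambda>q. snd c q $ k) * cf c k q f)"
  using tangent_expand[OF c(1) _ VF_tangent[OF X q]] q c(2) by blast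

lemma VF_coord_sfun:
  assumes c: "cs c" "W \<subseteq> fst c" and W: "openin M W" and X: "X \<in> VF W"
  shows "sfun W (\<lambda>q. X q (\<lambda>q. snd c q $ k))"
  by (rule VF_sfun[OF X order_refl]) (rule sfun_subset[OF sfun_coord[OF c(1)] W c(2)])

end

section \<open>Connections and the Hessian equation\<close>

text \<open>Only one connection is fixed. The dual connection is a second interpretation with the
  same metric, so every result of this locale is available for both sides.\<close>

locale rconn = mfd M A for M :: "'m topology" and A :: "('m, 'd::finite) chart set" +
  fixes g :: "'m \<Rightarrow> 'm tvec \<Rightarrow> 'm tvec \<Rightarrow> real" and D :: "'m conn"
  assumes riem: "riemannian_metric M A g" and conn: "affine_connection M A D" and tf: "torsion_free M A D"
begin

abbreviation "gm \<equiv> metric_coeff M A g"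
abbreviation "\<Gamma> \<equiv> christoffel M A D"

lemma g_sym: "p \<in> topspace M \<Longrightarrow> u \<in> tsp p \<Longrightarrow> v \<in> tsp p \<Longrightarrow> g p u v = g p v u"
  by (rule riem[unfolded riemannian_metric_def, THEN conjunct1, THEN bspec, THEN conjunct1, THEN bspec, THEN bspec])

lemma g_lincomb:
  "p \<in> topspace M \<Longrightarrow> u \<in> tsp p \<Longrightarrow> v \<in> tsp p \<Longrightarrow> w \<in> tsp p \<Longrightarrow>
    g p (\<lambda>f. a * u f + b * v f) w = a * g p u w + b * g p v w"
  by (rule riem[unfolded riemannian_metric_def, THEN conjunct1, THEN bspec, THEN conjunct2, THEN conjunct1,
      THEN bspec, THEN bspec, THEN bspec, THEN spec, THEN spec])

lemma g_pos: "p \<in> topspace M \<Longrightarrow> u \<in> tsp p \<Longrightarrow> u \<noteq> (\<lambda>f. 0) \<Longrightarrow> g p u u > 0"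
  by (rule riem[unfolded riemannian_metric_def, THEN conjunct1, THEN bspec, THEN conjunct2, THEN conjunct2,
      THEN bspec, THEN mp])

lemma g_sfun: "openin M W \<Longrightarrow> X \<in> VF W \<Longrightarrow> Y \<in> VF W \<Longrightarrow> sfun W (\<lambda>p. g p (X p) (Y p))"
  by (rule riem[unfolded riemannian_metric_def, THEN conjunct2, THEN spec, THEN mp, THEN bspec, THEN bspec])

text \<open>\<open>u0\<close> witnesses that the tangent space is nonempty; the empty sum is then
  its zero vector.\<close>

lemma tangent_sum_in:
  assumes "finite I" "u0 \<in> tsp p" "\<And>i. i \<in> I \<Longrightarrow> u i \<in> tsp p"
  shows "(\<lambda>f. \<Sum>i\<in>I. a i * u i f) \<in> tsp p"
  using assms(1,3)
proof (induction I rule: finite_induct)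
  case empty
  then show ?case using tangent_lincomb[OF assms(2,2), of 0 0] by simp
next
  case (insert i I)
  then show ?case using tangent_lincomb[of "u i" p "\<lambda>f. \<Sum>i\<in>I. a i * u i f" "a i" 1] by simp
qed

lemma g_sum:
  assumes p: "p \<in> topspace M" and "finite I" and u: "\<And>i. i \<in> I \<Longrightarrow> u i \<in> tsp p" and w: "w \<in> tsp p"
  shows "g p (\<lambda>f. \<Sum>i\<in>I. a i * u i f) w = (\<Sum>i\<in>I. a i * g p (u i) w)"
  using assms(2) u
proof (induction I rule: finite_induct)
  case empty
  then show ?case using g_lincomb[OF p w w w, of 0 0] by simp
next
  case (insert i I)
  have "g p (\<lambda>f. a i * u i f + 1 * (\<Sum>i\<in>I. a i * u i f)) w = a i * g p (u i) w + 1 * g p (\<lambda>f. \<Sum>i\<in>I. a i * u i f) w"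
    using insert by (intro g_lincomb[OF p] tangent_sum_in w) auto
  then show ?case using insert by simp
qed

lemma g_sum2:
  assumes p: "p \<in> topspace M" and "finite I" "finite J" and u: "\<And>i. i \<in> I \<Longrightarrow> u i \<in> tsp p"
    and w: "\<And>j. j \<in> J \<Longrightarrow> w j \<in> tsp p" and z: "z \<in> tsp p"
  shows "g p (\<lambda>f. \<Sum>i\<in>I. a i * u i f) (\<lambda>f. \<Sum>j\<in>J. b j * w j f) = (\<Sum>i\<in>I. \<Sum>j\<in>J. a i * b j * g p (u i) (w j))"
proof -
  have W: "(\<lambda>f. \<Sum>j\<in>J. b j * w j f) \<in> tsp p" by (rule tangent_sum_in[OF assms(3) z w])
  have "g p (u i) (\<lambda>f. \<Sum>j\<in>J. b j * w j f) = (\<Sum>j\<in>J. b j * g p (u i) (w j))" if i: "i \<in> I" for i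
  proof -
    have "g p (u i) (\<lambda>f. \<Sum>j\<in>J. b j * w j f) = (\<Sum>j\<in>J. b j * g p (w j) (u i))"
      using g_sum[OF p assms(3) w u[OF i]] g_sym[OF p u[OF i] W] by simp
    also have "\<dots> = (\<Sum>j\<in>J. b j * g p (u i) (w j))"
      using g_sym[OF p u[OF i] w] by simp
    finally show ?thesis .
  qed
  then show ?thesis
    using g_sum[where a = a and u = u, OF p assms(2) u W] by (simp add: sum_distrib_left mult.assoc)
qed

section \<open>Calculus rules of an affine connection\<close>

lemmas affine = conn[unfolded affine_connection_def, THEN spec, THEN mp]

lemma conn_VF: "openin M W \<Longrightarrow> X \<in> VF W \<Longrightarrow> Y \<in> VF W \<Longrightarrow> D X Y \<in> VF W"
  by (rule affine[THEN conjunct1, THEN bspec, THEN bspec])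

lemma conn_cong:
  assumes "openin M W" "X \<in> VF W" "X' \<in> VF W" "Y \<in> VF W" "Y' \<in> VF W"
    and "\<And>p. p \<in> W \<Longrightarrow> X p = X' p" "\<And>p. p \<in> W \<Longrightarrow> Y p = Y' p" "p \<in> W"
  shows "D X Y p = D X' Y' p"
  by (rule affine[OF assms(1), THEN conjunct2, THEN conjunct1, THEN bspec, THEN bspec, THEN bspec, THEN bspec,
      THEN mp, THEN bspec, OF assms(2-5) _ assms(8)]) (simp add: assms(6,7))

lemma conn_lincomb1:
  assumes "openin M W" "X \<in> VF W" "X' \<in> VF W" "Y \<in> VF W" "sfun W h" "sfun W h'" "p \<in> W"
  shows "D (\<lambda>q f. h q * X q f + h' q * X' q f) Y p = (\<lambda>f. h p * D X Y p f + h' p * D X' Y p f)"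
  by (rule affine[OF assms(1), THEN conjunct2, THEN conjunct2, THEN conjunct1, THEN bspec, THEN bspec, THEN bspec,
      THEN spec, THEN spec, THEN mp, THEN bspec, OF assms(2-4) _ assms(7)]) (simp add: assms(5,6))

lemma conn_add2:
  assumes "openin M W" "X \<in> VF W" "Y \<in> VF W" "Y' \<in> VF W" "p \<in> W"
  shows "D X (\<lambda>q f. Y q f + Y' q f) p = (\<lambda>f. D X Y p f + D X Y' p f)"
  by (rule affine[OF assms(1), THEN conjunct2, THEN conjunct2, THEN conjunct2, THEN conjunct1, THEN bspec,
      THEN bspec, THEN bspec, THEN bspec, OF assms(2-5)])

lemma conn_mult2:
  assumes "openin M W" "X \<in> VF W" "Y \<in> VF W" "sfun W h" "p \<in> W"
  shows "D X (\<lambda>q f. h q * Y q f) p = (\<lambda>f. X p h * Y p f + h p * D X Y p f)"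
  by (rule affine[OF assms(1), THEN conjunct2, THEN conjunct2, THEN conjunct2, THEN conjunct2, THEN bspec,
      THEN bspec, THEN spec, THEN mp, THEN bspec, OF assms(2-5)])

lemmas torsion = tf[unfolded torsion_free_def, THEN spec, THEN mp, THEN bspec, THEN bspec, THEN bspec]

lemma conn_zero1:
  assumes W: "openin M W" and X: "X \<in> VF W" and p: "p \<in> W"
  shows "D (\<lambda>q f. 0) X p f = 0"
  using conn_lincomb1[OF W X X X sfun_const[OF W, of 0] sfun_const[OF W, of 0] p] by simp

lemma conn_sum1:
  assumes W: "openin M W" and Y: "Y \<in> VF W" and "finite I"
    and X: "\<And>i. i \<in> I \<Longrightarrow> X i \<in> VF W" "\<And>i. i \<in> I \<Longrightarrow> sfun W (h i)" and p: "p \<in> W"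
  shows "D (\<lambda>q f. \<Sum>i\<in>I. h i q * X i q f) Y p = (\<lambda>f. \<Sum>i\<in>I. h i p * D (X i) Y p f)"
  using assms(3) X
proof (induction I rule: finite_induct)
  case empty
  then show ?case using conn_zero1[OF W Y p] by auto
next
  case (insert i I)
  have "D (\<lambda>q f. h i q * X i q f + 1 * (\<Sum>i\<in>I. h i q * X i q f)) Y p =
     (\<lambda>f. h i p * D (X i) Y p f + 1 * D (\<lambda>q f. \<Sum>i\<in>I. h i q * X i q f) Y p f)"
    using insert by (intro conn_lincomb1[OF W _ _ Y _ _ p] VF_sum sfun_const W) auto
  then show ?case using insert by simp
qed

lemma conn_sum2:
  assumes W: "openin M W" and X: "X \<in> VF W" and "finite I"
    and Y: "\<And>i. i \<in> I \<Longrightarrow> Y i \<in> VF W" "\<And>i. i \<in> I \<Longrightarrow> sfun W (h i)" and p: "p \<in> W"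
  shows "D X (\<lambda>q f. \<Sum>i\<in>I. h i q * Y i q f) p = (\<lambda>f. \<Sum>i\<in>I. X p (h i) * Y i p f + h i p * D X (Y i) p f)"
  using assms(3) Y
proof (induction I rule: finite_induct)
  case empty
  \<comment> \<open>The zero field is written as 0 times \<open>X\<close>, so that the Leibniz rule
    evaluates it.\<close>
  have "D X (\<lambda>q f. 0 * X q f) p = (\<lambda>f. X p (\<lambda>q. 0) * X p f + 0 * D X X p f)"
    by (rule conn_mult2[OF W X X sfun_const[OF W] p])
  then show ?case using tangent_const[OF VF_tangent[OF X p]] by simp
next
  case (insert i I)
  have "(\<lambda>q f. h i q * Y i q f + 0 * Y i q f) \<in> VF W"
    using insert.prems by (intro VF_lincomb sfun_const W) auto
  then have "D X (\<lambda>q f. h i q * Y i q f + (\<Sum>i\<in>I. h i q * Y i q f)) p =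
     (\<lambda>f. D X (\<lambda>q f. h i q * Y i q f) p f + D X (\<lambda>q f. \<Sum>i\<in>I. h i q * Y i q f) p f)"
    using insert by (intro conn_add2[OF W X _ _ p] VF_sum W) auto
  moreover have "D X (\<lambda>q f. h i q * Y i q f) p = (\<lambda>f. X p (h i) * Y i p f + h i p * D X (Y i) p f)"
    using insert.prems by (intro conn_mult2[OF W X _ _ p]) auto
  ultimately show ?case using insert by simp
qed

section \<open>Christoffel symbols and curvature in coordinates\<close>

context
  fixes c :: "('m, 'd) chart"
  assumes c: "cs c"
begin

lemma cs_open: "openin M (fst c)"
  by (rule is_chart_openin[OF cs_chart[OF c]])

lemma cs_topspace: "q \<in> fst c \<Longrightarrow> q \<in> topspace M"
  using openin_subset[OF cs_open] by blast

lemma cf_VF: "cf c i \<in> VF (fst c)"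
  by (rule VF_coord[OF c order_refl])

lemma christoffel_sfun: "sfun (fst c) (\<Gamma> c i j l)"
  unfolding christoffel_def[abs_def]
  by (rule VF_coord_sfun[OF c order_refl cs_open conn_VF[OF cs_open cf_VF cf_VF]])

lemma gm_sfun: "sfun (fst c) (gm c i j)"
  unfolding metric_coeff_def[abs_def] by (rule g_sfun[OF cs_open cf_VF cf_VF])

lemma gm_sym: "q \<in> fst c \<Longrightarrow> gm c i j q = gm c j i q"
  unfolding metric_coeff_def by (rule g_sym[OF cs_topspace]) (simp_all add: coord_field_tangent[OF c])

lemma conn_cf: "q \<in> fst c \<Longrightarrow> D (cf c i) (cf c j) q f = (\<Sum>l\<in>UNIV. \<Gamma> c i j l q * cf c l q f)"
  unfolding christoffel_def
  by (rule tangent_expand[OF c _ VF_tangent[OF conn_VF[OF cs_open cf_VF cf_VF]]])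

text \<open>The bracket of coordinate fields vanishes because, by torsion-freeness, it is a tangent
  vector, and it vanishes on the coordinate functions.\<close>

lemma lie_bracket_cf:
  assumes q: "q \<in> fst c"
  shows "lie_bracket M A (cf c i) (cf c j) q = (\<lambda>f. 0)"
proof -
  let ?B = "lie_bracket M A (cf c i) (cf c j) q"
  have B: "?B = (\<lambda>f. D (cf c i) (cf c j) q f - D (cf c j) (cf c i) q f)"
    by (rule torsion[OF cs_open cf_VF cf_VF q, symmetric])
  then have "?B = (\<lambda>f. 1 * D (cf c i) (cf c j) q f + (- 1) * D (cf c j) (cf c i) q f)" by simp
  moreover have "\<dots> \<in> tsp q"
    by (rule tangent_lincomb[OF VF_tangent[OF conn_VF[OF cs_open cf_VF cf_VF] q] VF_tangent[OF conn_VF[OF cs_open cf_VF cf_VF] q]])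
  ultimately have Bt: "?B \<in> tsp q" by (simp only:)
  have z: "cf c i q (\<lambda>q'. cf c j q' (\<lambda>q. snd c q $ k)) = 0" for i j k
  proof -
    have "cf c i q (\<lambda>q'. cf c j q' (\<lambda>q. snd c q $ k)) = cf c i q (\<lambda>q'. if k = j then 1 else 0)"
      by (rule tangent_cong[OF coord_field_tangent[OF c q] cs_open q]) (simp add: coord_field_coord[OF c])
    then show ?thesis using tangent_const[OF coord_field_tangent[OF c q]] by simp
  qed
  have "?B (\<lambda>q. snd c q $ k) = 0" for k
    using z smooth_nearI[OF sfun_coord[OF c] q] by (simp add: lie_bracket_def)
  then show ?thesis by (intro ext) (subst tangent_expand[OF c q Bt], simp)
qed

lemma christoffel_sym: "q \<in> fst c \<Longrightarrow> \<Gamma> c i j l q = \<Gamma> c j i l q"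
proof -
  assume q: "q \<in> fst c"
  have "(\<lambda>f. D (cf c i) (cf c j) q f - D (cf c j) (cf c i) q f) = (\<lambda>f. 0)"
    unfolding torsion[OF cs_open cf_VF cf_VF q] by (rule lie_bracket_cf[OF q])
  from fun_cong[OF this] show ?thesis unfolding christoffel_def by (simp only: right_minus_eq)
qed

text \<open>The m-th component of the curvature identity for three coordinate fields, read off by
  applying both sides to the m-th coordinate function. The bracket term contributes nothing since
  coordinate fields commute.\<close>

lemma curvature_cf:
  assumes k: "constant_sectional_curvature M A g D k" and q: "q \<in> fst c"
  shows "cf c i q (\<Gamma> c j a m) - cf c j q (\<Gamma> c i a m)
     + (\<Sum>l\<in>UNIV. \<Gamma> c j a l q * \<Gamma> c i l m q) - (\<Sum>l\<in>UNIV. \<Gamma> c i a l q * \<Gamma> c j l m q)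
     = k * (gm c j a q * (if m = i then 1 else 0) - gm c i a q * (if m = j then 1 else 0))"
proof -
  let ?x = "\<lambda>q. snd c q $ m"
  have DD: "D (cf c i) (D (cf c j) (cf c a)) q ?x = cf c i q (\<Gamma> c j a m) + (\<Sum>l\<in>UNIV. \<Gamma> c j a l q * \<Gamma> c i l m q)"
    for i j
  proof -
    have V: "(\<lambda>q f. \<Sum>l\<in>UNIV. \<Gamma> c j a l q * cf c l q f) \<in> VF (fst c)"
      by (intro VF_sum cs_open cf_VF christoffel_sfun) auto
    have "D (cf c i) (D (cf c j) (cf c a)) q = D (cf c i) (\<lambda>q f. \<Sum>l\<in>UNIV. \<Gamma> c j a l q * cf c l q f) q"
      by (rule conn_cong[OF cs_open cf_VF cf_VF conn_VF[OF cs_open cf_VF cf_VF] V refl _ q])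
        (simp add: conn_cf fun_eq_iff)
    also have "\<dots> = (\<lambda>f. \<Sum>l\<in>UNIV. cf c i q (\<Gamma> c j a l) * cf c l q f + \<Gamma> c j a l q * D (cf c i) (cf c l) q f)"
      by (rule conn_sum2[OF cs_open cf_VF finite cf_VF christoffel_sfun q])
    finally have "D (cf c i) (D (cf c j) (cf c a)) q ?x =
      (\<Sum>l\<in>UNIV. cf c i q (\<Gamma> c j a l) * (if m = l then 1 else 0) + \<Gamma> c j a l q * \<Gamma> c i l m q)"
      by (simp add: coord_field_coord[OF c q] christoffel_def)
    then show ?thesis by (simp only: sum.distrib sum_delta_right)
  qed
  \<comment> \<open>The bracket vanishes pointwise on the chart; before the connection can be
    applied to it, it has to be recognized as a smooth field there.\<close>
  have "D (lie_bracket M A (cf c i) (cf c j)) (cf c a) q ?x = D (\<lambda>q f. 0) (cf c a) q ?x"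
  proof -
    have L: "lie_bracket M A (cf c i) (cf c j) \<in> VF (fst c)"
    proof -
      have 1: "lie_bracket M A (cf c i) (cf c j) q f = 0" if "q \<in> fst c" for q f
        using lie_bracket_cf[OF that] by simp
      have "sfun V (\<lambda>p. lie_bracket M A (cf c i) (cf c j) p f)" if "V \<subseteq> fst c" "sfun V f" for V f
        by (rule sfun_cong[OF _ sfun_const[OF sfun_open[OF that(2)], of 0]]) (use 1 that in auto)
      moreover have "lie_bracket M A (cf c i) (cf c j) q \<in> tsp q" if "q \<in> fst c" for q
        unfolding lie_bracket_cf[OF that] using VF_tangent[OF VF_zero[OF cs_open] that] .
      ultimately show ?thesis by (auto simp: vector_fields_def)
    qed
    have "D (lie_bracket M A (cf c i) (cf c j)) (cf c a) q = D (\<lambda>q f. 0) (cf c a) q"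
      by (rule conn_cong[OF cs_open L VF_zero[OF cs_open] cf_VF cf_VF lie_bracket_cf refl q])
    then show ?thesis by simp
  qed
  then have B: "D (lie_bracket M A (cf c i) (cf c j)) (cf c a) q ?x = 0"
    using conn_zero1[OF cs_open cf_VF q] by simp
  have "curvature M A D (cf c i) (cf c j) (cf c a) q =
      (\<lambda>f. k * (g q (cf c j q) (cf c a q) * cf c i q f - g q (cf c i q) (cf c a q) * cf c j q f))"
    by (rule k[unfolded constant_sectional_curvature_def, THEN spec, THEN mp, THEN bspec, THEN bspec, THEN bspec,
          THEN bspec, OF cs_open cf_VF cf_VF cf_VF q])
  then have "curvature M A D (cf c i) (cf c j) (cf c a) q ?x =
      k * (gm c j a q * (if m = i then 1 else 0) - gm c i a q * (if m = j then 1 else 0))"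
    by (simp add: metric_coeff_def coord_field_coord[OF c q])
  then show ?thesis unfolding curvature_def DD B by simp
qed

end

text \<open>The equation \<open>Hess f = - k f g\<close>, where \<open>Hess\<close> is the second covariant derivative.\<close>

definition hess_eq :: "real \<Rightarrow> 'm set \<Rightarrow> ('m \<Rightarrow> real) \<Rightarrow> bool" where
  "hess_eq k W f \<longleftrightarrow> (\<forall>V X Y p. openin M V \<and> V \<subseteq> W \<and> X \<in> VF V \<and> Y \<in> VF V \<and> p \<in> V \<longrightarrow>
     X p (\<lambda>q. Y q f) = D X Y p f - k * g p (X p) (Y p) * f p)"

lemma hess_eq_cf:
  assumes "hess_eq k W f" "openin M W" and c: "cs c" and q: "q \<in> W" "q \<in> fst c"
  shows "cf c i q (\<lambda>q. cf c j q f) = (\<Sum>l\<in>UNIV. \<Gamma> c i j l q * cf c l q f) - k * gm c i j q * f q"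
proof -
  have "openin M (W \<inter> fst c)" using assms(2) cs_open[OF c] by blast
  then have "cf c i q (\<lambda>q. cf c j q f) = D (cf c i) (cf c j) q f - k * g q (cf c i q) (cf c j q) * f q"
    using assms(1) q VF_coord[OF c, of "W \<inter> fst c"] unfolding hess_eq_def by blast
  then show ?thesis by (simp add: conn_cf[OF c q(2)] metric_coeff_def)
qed

text \<open>X(Yf) - (D_X Y)f is bilinear over functions: the derivatives of the components of
  \<open>Y\<close> occur in both terms and cancel. Hence the equation for all fields follows from
  the one for coordinate fields.\<close>

lemma hess_eqI:
  assumes W: "openin M W" and c: "cs c" "W \<subseteq> fst c" and f: "sfun W f"
    and eq: "\<And>q i j. q \<in> W \<Longrightarrow>
      cf c i q (\<lambda>q. cf c j q f) = (\<Sum>l\<in>UNIV. \<Gamma> c i j l q * cf c l q f) - k * gm c i j q * f q"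
  shows "hess_eq k W f"
  unfolding hess_eq_def
proof (intro allI impI)
  fix V X Y p
  assume H: "openin M V \<and> V \<subseteq> W \<and> X \<in> VF V \<and> Y \<in> VF V \<and> p \<in> V"
  then have V: "openin M V" "V \<subseteq> fst c" "V \<subseteq> W" and X: "X \<in> VF V" and Y: "Y \<in> VF V" and p: "p \<in> V" "p \<in> fst c" "p \<in> W"
    using c by auto
  define x where "x a q = X q (\<lambda>q. snd c q $ a)" for a q
  define y where "y a q = Y q (\<lambda>q. snd c q $ a)" for a q
  have xs: "sfun V (x a)" and ys: "sfun V (y a)" for a
    unfolding x_def[abs_def] y_def[abs_def] using VF_coord_sfun[OF c(1) V(2,1)] X Y by auto
  have fV: "sfun V f" by (rule sfun_subset[OF f V(1,3)])
  have cV: "cf c a \<in> VF V" for a by (rule VF_coord[OF c(1) V(2)])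
  have Xe: "X q = (\<lambda>f. \<Sum>a\<in>UNIV. x a q * cf c a q f)" and Ye: "Y q = (\<lambda>f. \<Sum>a\<in>UNIV. y a q * cf c a q f)"
    if "q \<in> V" for q
    unfolding x_def y_def using VF_expand[OF c(1) V(2) X that] VF_expand[OF c(1) V(2) Y that] .
  have cfs: "sfun V (\<lambda>q. cf c b q f)" for b by (rule VF_sfun[OF cV order_refl fV])
  have "cf c a p (\<lambda>q. Y q f) = (\<Sum>b\<in>UNIV. y b p * cf c a p (\<lambda>q. cf c b q f) + cf c b p f * cf c a p (y b))" for a
  proof -
    note T = coord_field_tangent[OF c(1) p(2), of a]
    have "cf c a p (\<lambda>q. Y q f) = cf c a p (\<lambda>q. \<Sum>b\<in>UNIV. y b q * cf c b q f)"
      by (rule tangent_cong[OF T V(1) p(1)]) (simp add: Ye)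
    also have "\<dots> = (\<Sum>b\<in>UNIV. cf c a p (\<lambda>q. y b q * cf c b q f))"
      by (rule tangent_sum[OF T finite p(1) V(1)]) (intro sfun_mult ys cfs)
    finally show ?thesis
      using tangent_mult[OF T smooth_nearI[OF ys p(1)] smooth_nearI[OF cfs p(1)]] by simp
  qed
  note E = this
  have 1: "X p (\<lambda>q. Y q f) = (\<Sum>a\<in>UNIV. x a p * (\<Sum>b\<in>UNIV. y b p * cf c a p (\<lambda>q. cf c b q f) + cf c b p f * cf c a p (y b)))"
    unfolding Xe[OF p(1)] E by (rule refl)
  have Ys: "(\<lambda>q f. \<Sum>b\<in>UNIV. y b q * cf c b q f) \<in> VF V"
    by (intro VF_sum V(1) cV ys) auto
  have Xs: "(\<lambda>q f. \<Sum>b\<in>UNIV. x b q * cf c b q f) \<in> VF V"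
    by (intro VF_sum V(1) cV xs) auto
  have "D X Y p = D (\<lambda>q f. \<Sum>a\<in>UNIV. x a q * cf c a q f) (\<lambda>q f. \<Sum>b\<in>UNIV. y b q * cf c b q f) p"
    by (rule conn_cong[OF V(1) X Xs Y Ys Xe Ye p(1)])
  also have "\<dots> = (\<lambda>f. \<Sum>a\<in>UNIV. x a p * D (cf c a) (\<lambda>q f. \<Sum>b\<in>UNIV. y b q * cf c b q f) p f)"
    by (rule conn_sum1[OF V(1) Ys finite cV xs p(1)])
  also have "\<dots> = (\<lambda>f. \<Sum>a\<in>UNIV. x a p * (\<Sum>b\<in>UNIV. cf c a p (y b) * cf c b p f + y b p * D (cf c a) (cf c b) p f))"
    by (simp only: conn_sum2[OF V(1) cV finite cV ys p(1)])
  finally have 2: "D X Y p f = (\<Sum>a\<in>UNIV. x a p * (\<Sum>b\<in>UNIV. cf c a p (y b) * cf c b p f + y b p * D (cf c a) (cf c b) p f))"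
    by simp
  have H: "cf c a p (\<lambda>q. cf c b q f) = D (cf c a) (cf c b) p f - k * gm c a b p * f p" for a b
    using eq[OF p(3)] conn_cf[OF c(1) p(2)] by simp
  have "X p (\<lambda>q. Y q f) - D X Y p f = (\<Sum>a\<in>UNIV. \<Sum>b\<in>UNIV. - k * f p * (x a p * y b p * gm c a b p))"
    unfolding 1 2 H sum_distrib_left sum_subtractf[symmetric]
    by (intro sum.cong refl) (simp add: algebra_simps)
  also have "\<dots> = - k * f p * (\<Sum>a\<in>UNIV. \<Sum>b\<in>UNIV. x a p * y b p * gm c a b p)"
    by (simp add: sum_distrib_left)
  also have "(\<Sum>a\<in>UNIV. \<Sum>b\<in>UNIV. x a p * y b p * gm c a b p) = g p (X p) (Y p)"
    unfolding Xe[OF p(1)] Ye[OF p(1)] metric_coeff_def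
    by (rule g_sum2[symmetric, OF cs_topspace[OF c(1) p(2)] finite finite coord_field_tangent[OF c(1) p(2)]
          coord_field_tangent[OF c(1) p(2)] coord_field_tangent[OF c(1) p(2)]])
  finally show "X p (\<lambda>q. Y q f) = D X Y p f - k * g p (X p) (Y p) * f p" by (simp add: algebra_simps)
qed

text \<open>Serves in two ways: together with the symmetry of the dual Christoffel symbols it
  settles the metric column of the jet integrability condition, and it makes the metric block of the
  pairing of dual and primal jets parallel.\<close>

lemma duality_cf:
  assumes dual: "dual_connections M A g D D'" and D': "affine_connection M A D'" "torsion_free M A D'"
    and c: "cs c" and q: "q \<in> fst c"
  shows "cf c m q (gm c i j) = (\<Sum>l\<in>UNIV. \<Gamma> c m i l q * gm c l j q) + (\<Sum>l\<in>UNIV. christoffel M A D' c m j l q * gm c i l q)"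
proof -
  interpret d: rconn M A g D' by unfold_locales (rule riem D')+
  note T = coord_field_tangent[OF c q] and P = cs_topspace[OF c q]
  have "cf c m q (gm c i j) = g q (D (cf c m) (cf c i) q) (cf c j q) + g q (cf c i q) (D' (cf c m) (cf c j) q)"
    unfolding metric_coeff_def[abs_def]
    by (rule dual[unfolded dual_connections_def, THEN spec, THEN mp, THEN bspec, THEN bspec, THEN bspec,
          THEN bspec, OF cs_open[OF c] cf_VF[OF c] cf_VF[OF c] cf_VF[OF c] q])
  moreover have "D (cf c m) (cf c i) q = (\<lambda>f. \<Sum>l\<in>UNIV. \<Gamma> c m i l q * cf c l q f)"
    using conn_cf[OF c q] by blast
  then have "g q (D (cf c m) (cf c i) q) (cf c j q) = (\<Sum>l\<in>UNIV. \<Gamma> c m i l q * gm c l j q)"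
    using g_sum[OF P finite T T] by (simp add: metric_coeff_def)
  moreover have E: "D' (cf c m) (cf c j) q = (\<lambda>f. \<Sum>l\<in>UNIV. christoffel M A D' c m j l q * cf c l q f)"
    using d.conn_cf[OF c q] by blast
  have "g q (cf c i q) (D' (cf c m) (cf c j) q) = g q (D' (cf c m) (cf c j) q) (cf c i q)"
    by (rule g_sym[OF P T VF_tangent[OF d.conn_VF[OF cs_open[OF c] cf_VF[OF c] cf_VF[OF c]] q]])
  then have "g q (cf c i q) (D' (cf c m) (cf c j) q) = (\<Sum>l\<in>UNIV. christoffel M A D' c m j l q * gm c i l q)"
    unfolding E using g_sum[OF P finite T T] gm_sym[OF c q, of i] by (simp add: metric_coeff_def)
  ultimately show ?thesis by simp
qed

end

section \<open>The Hessian equation as a first-order system for jets\<close>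

lemma sum_option:
  fixes f :: "'d::finite option \<Rightarrow> real"
  shows "(\<Sum>l\<in>UNIV. f l) = f None + (\<Sum>l\<in>UNIV. f (Some l))"
  by (simp add: UNIV_option_conv sum.reindex)

lemma pderiv_at_cong:
  assumes "open S" "x \<in> S" "\<And>y. y \<in> S \<Longrightarrow> f y = h y"
  shows "pderiv_at n f x = pderiv_at n h x"
proof -
  have "(f has_derivative F) (at x) \<longleftrightarrow> (h has_derivative F) (at x)" for F
    using has_derivative_transform_within_open[OF _ assms(1,2)] assms(3) by metis
  then show ?thesis by (simp add: pderiv_at_def frechet_derivative_def)
qed

context mfd
begin

lemma pull_sfun:
  assumes c: "cs c" and W: "openin M W" "W \<subseteq> fst c" and F: "smooth_on (snd c ` W) F"
  shows "sfun W (\<lambda>q. F (snd c q))"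
proof (rule sfun_csI[OF c W])
  have op: "open (snd c ` W)" by (rule is_chart_image_open[OF cs_chart[OF c] W])
  have "((\<lambda>q. F (snd c q)) \<circ> param c) y = F y" if "y \<in> snd c ` W" for y
    using that W by (auto simp: param_snd[OF cs_chart[OF c]] subset_iff)
  then show "smooth_on (snd c ` W) ((\<lambda>q. F (snd c q)) \<circ> param c)"
    using smooth_on_cong[OF op, of "(\<lambda>q. F (snd c q)) \<circ> param c" F] F by blast
qed

lemma pull_cf:
  assumes c: "cs c" and W: "openin M W" "W \<subseteq> fst c" and F: "smooth_on (snd c ` W) F" and q: "q \<in> W"
  shows "cf c m q (\<lambda>q. F (snd c q)) = pderiv_at m F (snd c q)"
proof -
  have op: "open (snd c ` W)" by (rule is_chart_image_open[OF cs_chart[OF c] W])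
  have "cf c m q (\<lambda>q. F (snd c q)) = pderiv_at m ((\<lambda>q. F (snd c q)) \<circ> param c) (snd c q)"
    by (rule coord_field_pderiv[OF smooth_nearI[OF pull_sfun[OF c W F] q]])
  also have "\<dots> = pderiv_at m F (snd c q)"
    by (rule pderiv_at_cong[OF op]) (use q W in \<open>auto simp: param_snd[OF cs_chart[OF c]] subset_iff\<close>)
  finally show ?thesis .
qed

lemma cf_sfun: "cs c \<Longrightarrow> W \<subseteq> fst c \<Longrightarrow> sfun W f \<Longrightarrow> sfun W (\<lambda>q. cf c i q f)"
  by (rule VF_sfun[OF VF_coord order_refl])

end

context rconn
begin

text \<open>The matrix of the first-order linear system for the jet \<open>(f, \<partial>f)\<close> that is equivalent to the
  second-order equation \<open>hess_eq k\<close>; the index \<open>None\<close> stands for \<open>f\<close> and \<open>Some i\<close> for \<open>\<partial>\<^sub>i f\<close>.\<close>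

definition jet_coeff :: "('m, 'd) chart \<Rightarrow> real \<Rightarrow> 'd \<Rightarrow> 'd option \<Rightarrow> 'd option \<Rightarrow> 'm \<Rightarrow> real" where
  "jet_coeff c k m i j = (case i of
     None \<Rightarrow> (case j of None \<Rightarrow> (\<lambda>q. 0) | Some l \<Rightarrow> (\<lambda>q. if l = m then 1 else 0))
   | Some i' \<Rightarrow> (case j of None \<Rightarrow> (\<lambda>q. - k * gm c m i' q) | Some l \<Rightarrow> \<Gamma> c m i' l))"

definition jet :: "('m, 'd) chart \<Rightarrow> ('m \<Rightarrow> real) \<Rightarrow> 'd option \<Rightarrow> 'm \<Rightarrow> real" where
  "jet c f i = (case i of None \<Rightarrow> f | Some i' \<Rightarrow> (\<lambda>q. cf c i' q f))"

lemma jet_coeff_simps [simp]: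
  "jet_coeff c k m None None = (\<lambda>q. 0)"
  "jet_coeff c k m None (Some l) = (\<lambda>q. if l = m then 1 else 0)"
  "jet_coeff c k m (Some i) None = (\<lambda>q. - k * gm c m i q)"
  "jet_coeff c k m (Some i) (Some l) = \<Gamma> c m i l"
  "jet c f None = f" "jet c f (Some i) = (\<lambda>q. cf c i q f)"
  by (simp_all add: jet_coeff_def jet_def)

lemma jet_coeff_sfun: "cs c \<Longrightarrow> sfun (fst c) (jet_coeff c k m i j)"
  by (cases i; cases j)
    (auto intro!: sfun_mult[of _ "\<lambda>q. - k", simplified] sfun_const cs_open gm_sfun christoffel_sfun split: if_split)

lemma jet_sfun: "cs c \<Longrightarrow> W \<subseteq> fst c \<Longrightarrow> sfun W f \<Longrightarrow> sfun W (jet c f i)"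
  by (cases i) (simp_all add: cf_sfun)

lemma jet_derivative:
  assumes c: "cs c" "W \<subseteq> fst c" and W: "openin M W" and f: "hess_eq k W f" and q: "q \<in> W"
  shows "cf c m q (jet c f i) = (\<Sum>j\<in>UNIV. jet_coeff c k m i j q * jet c f j q)"
proof (cases i)
  case None
  then show ?thesis by (simp add: sum_option sum_delta_left)
next
  case (Some i)
  then show ?thesis using hess_eq_cf[OF f W c(1) q] c(2) q by (auto simp: sum_option)
qed

text \<open>The row \<open>None\<close> needs the symmetry of the metric and of the Christoffel
  symbols. In the block (\<open>Some\<close>, \<open>None\<close>) duality rewrites the derivative
  of the metric: its dual Christoffel term is symmetric in \<open>m\<close> and \<open>n\<close>,
  while its primal term and the product term are exchanged when \<open>m\<close> and
  \<open>n\<close> are. In the block (\<open>Some\<close>, \<open>Some\<close>) the identity is the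
  curvature condition, the product through the index \<open>None\<close> supplying the terms with k
  g.\<close>

lemma jet_coeff_flat:
  assumes dual: "dual_connections M A g D D'" and D': "affine_connection M A D'" "torsion_free M A D'"
    and k: "constant_sectional_curvature M A g D k" and c: "cs c" and q: "q \<in> fst c"
  shows "cf c n q (jet_coeff c k m i j) + (\<Sum>l\<in>UNIV. jet_coeff c k m i l q * jet_coeff c k n l j q) =
    cf c m q (jet_coeff c k n i j) + (\<Sum>l\<in>UNIV. jet_coeff c k n i l q * jet_coeff c k m l j q)"
proof -
  interpret d: rconn M A g D' by unfold_locales (rule riem D')+
  note const = tangent_const[OF coord_field_tangent[OF c q]]
  show ?thesis
  proof (cases i)
    case None
    show ?thesis
      by (cases j) (simp_all add: None const sum_option sum_delta_left sum_negf gm_sym[OF c q, of m n] christoffel_sym[OF c q, of m n])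
  next
    case (Some s)
    show ?thesis
    proof (cases j)
      case None
      have E: "cf c n q (jet_coeff c k m (Some s) None) = - k * ((\<Sum>l\<in>UNIV. \<Gamma> c n s l q * gm c l m q) + (\<Sum>l\<in>UNIV. christoffel M A D' c n m l q * gm c s l q))"
        for n m
      proof -
        have "cf c n q (\<lambda>q. - k * gm c m s q) = - k * cf c n q (gm c m s) + gm c m s q * cf c n q (\<lambda>q. - k)"
          by (rule tangent_mult[OF coord_field_tangent[OF c q]])
            (rule smooth_nearI[OF sfun_const[OF cs_open[OF c]] q] smooth_nearI[OF gm_sfun[OF c] q])+
        moreover have "cf c n q (gm c m s) = cf c n q (gm c s m)"
          by (rule tangent_cong[OF coord_field_tangent[OF c q] cs_open[OF c] q gm_sym[OF c]])
        ultimately show ?thesis using duality_cf[OF dual D' c q, of n s m] const by simp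
      qed
      show ?thesis
        unfolding Some None E
        by (simp add: sum_option d.christoffel_sym[OF c q, of m n] gm_sym[OF c q, of m] gm_sym[OF c q, of n]
            sum_negf sum_distrib_left algebra_simps)
    next
      case (Some t)
      have "cf c n q (\<Gamma> c m s t) - cf c m q (\<Gamma> c n s t)
         + (\<Sum>l\<in>UNIV. \<Gamma> c m s l q * \<Gamma> c n l t q) - (\<Sum>l\<in>UNIV. \<Gamma> c n s l q * \<Gamma> c m l t q)
         = k * (gm c m s q * (if t = n then 1 else 0) - gm c n s q * (if t = m then 1 else 0))"
        by (rule curvature_cf[OF c k q])
      then show ?thesis
        unfolding \<open>i = Some s\<close> Some by (simp add: sum_option algebra_simps)
    qed
  qed
qed

text \<open>The curvature condition for \<open>D\<close> and the symmetry of \<open>\<nabla>g\<close>, which comes from the torsion-freeness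
  of both connections, are together the integrability condition of \<open>hess_eq k\<close>.\<close>

lemma hess_solutions:
  assumes dual: "dual_connections M A g D D'" and D': "affine_connection M A D'" "torsion_free M A D'"
    and k: "constant_sectional_curvature M A g D k" and c: "cs c" and p: "p \<in> fst c"
  shows "\<exists>W. openin M W \<and> p \<in> W \<and> W \<subseteq> fst c \<and>
    (\<forall>a b. \<exists>f. sfun W f \<and> f p = a \<and> (\<forall>i. cf c i p f = b i) \<and> hess_eq k W f)"
proof -
  note cc = cs_chart[OF c]
  define \<Omega> where "\<Omega> = snd c ` fst c"
  define B where "B m i j = jet_coeff c k m i j \<circ> param c" for m i j
  have \<Omega>: "open \<Omega>" "snd c p \<in> \<Omega>" using is_chart_open_image[OF cc] p by (auto simp: \<Omega>_def)
  have Bs: "smooth_on \<Omega> (B m i j)" for m i j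
    unfolding B_def \<Omega>_def using sfun_cs[OF jet_coeff_sfun[OF c, of k m i j] c] by (simp only: Int_absorb)
  have Bp: "pderiv_at n (B m i j) x = cf c n (param c x) (jet_coeff c k m i j)" if x: "x \<in> \<Omega>" for n m i j x
  proof -
    have "cf c n (param c x) (jet_coeff c k m i j) =
        pderiv_at n (jet_coeff c k m i j \<circ> param c) (snd c (param c x))"
      by (rule coord_field_pderiv[OF smooth_nearI[OF jet_coeff_sfun[OF c] param_in[OF x[unfolded \<Omega>_def]]]])
    then show ?thesis by (simp only: B_def snd_param[OF x[unfolded \<Omega>_def]])
  qed
  have flat: "pderiv_at n (B m i j) x + (\<Sum>l\<in>UNIV. B m i l x * B n l j x) =
      pderiv_at m (B n i j) x + (\<Sum>l\<in>UNIV. B n i l x * B m l j x)" if x: "x \<in> \<Omega>" for x m n i j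
    unfolding Bp[OF x] using jet_coeff_flat[OF dual D' k c param_in[OF x[unfolded \<Omega>_def]], of n m i j]
    by (simp only: B_def comp_def)
  obtain r where r: "r > 0" "ball (snd c p) r \<subseteq> \<Omega>"
    and sol: "\<And>e. \<exists>F::real^'d \<Rightarrow> real^('d option). F (snd c p) = e \<and> smooth_on (ball (snd c p) r) F \<and>
     (\<forall>x\<in>ball (snd c p) r. \<forall>m i. pderiv_at m (\<lambda>x. F x $ i) x = (\<Sum>j\<in>UNIV. B m i j x * F x $ j))"
    using frobenius_linear[OF \<Omega> Bs flat] by blast
  define W where "W = param c ` ball (snd c p) r"
  have W: "openin M W" unfolding W_def by (rule is_chart_param_open[OF cc open_ball r(2)[unfolded \<Omega>_def]])
  have mem: "x \<in> snd c ` fst c" if "x \<in> ball (snd c p) r" for x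
    using r(2) that by (auto simp: \<Omega>_def)
  have Wc: "W \<subseteq> fst c" unfolding W_def using param_in[OF mem] by blast
  have "snd c ` W = (\<lambda>x. x) ` ball (snd c p) r"
    unfolding W_def image_image by (rule image_cong[OF refl snd_param[OF mem]])
  then have img: "snd c ` W = ball (snd c p) r" by simp
  have "param c (snd c p) \<in> W" unfolding W_def using r(1) by (intro imageI) simp
  then have pW: "p \<in> W" using param_snd[OF cc p] by simp
  have "\<exists>f. sfun W f \<and> f p = a \<and> (\<forall>i. cf c i p f = b i) \<and> hess_eq k W f" for a and b :: "'d \<Rightarrow> real"
  proof -
    obtain F :: "real^'d \<Rightarrow> real^('d option)" where F0: "F (snd c p) = (\<chi> i. case i of None \<Rightarrow> a | Some i \<Rightarrow> b i)"
      and Fs: "smooth_on (ball (snd c p) r) F"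
      and dF: "\<And>x m i. x \<in> ball (snd c p) r \<Longrightarrow> pderiv_at m (\<lambda>x. F x $ i) x = (\<Sum>j\<in>UNIV. B m i j x * F x $ j)"
      using sol by blast
    define f where "f q = F (snd c q) $ None" for q
    have Fs': "smooth_on (snd c ` W) (\<lambda>x. F x $ i)" for i
      unfolding img by (rule smooth_on_nth[OF open_ball Fs])
    have dJ: "cf c m q (\<lambda>q. F (snd c q) $ i) = (\<Sum>j\<in>UNIV. jet_coeff c k m i j q * F (snd c q) $ j)" if q: "q \<in> W" for m q i
    proof -
      have "snd c q \<in> ball (snd c p) r" using q img by blast
      then show ?thesis unfolding pull_cf[OF c W Wc Fs' q]
        using dF[of "snd c q" m i] param_snd[OF cc, of q] q Wc by (auto simp: B_def)
    qed
    \<comment> \<open>The row \<open>None\<close> of the system says that the components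
      \<open>Some m\<close> are the partial derivatives of the component \<open>None\<close>. So
      \<open>F\<close> is the jet of \<open>f\<close>, and the other rows become the Hessian
      equation.\<close>
    have df: "cf c m q f = F (snd c q) $ Some m" if q: "q \<in> W" for m q
      unfolding f_def[abs_def] dJ[OF q] by (simp add: sum_option sum_delta_left)
    have fs: "sfun W f" unfolding f_def[abs_def] by (rule pull_sfun[OF c W Wc Fs'])
    have "hess_eq k W f"
    proof (rule hess_eqI[OF W c Wc fs])
      fix q i j assume q: "q \<in> W"
      have "cf c i q (\<lambda>q. cf c j q f) = cf c i q (\<lambda>q. F (snd c q) $ Some j)"
        by (rule tangent_cong[OF coord_field_tangent[OF c] W q df]) (use q Wc in auto)
      also have "\<dots> = (\<Sum>l\<in>UNIV. \<Gamma> c i j l q * cf c l q f) - k * gm c i j q * f q"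
        unfolding dJ[OF q] by (simp add: sum_option df[OF q] f_def)
      finally show "cf c i q (\<lambda>q. cf c j q f) = (\<Sum>l\<in>UNIV. \<Gamma> c i j l q * cf c l q f) - k * gm c i j q * f q" .
    qed
    moreover have "f p = a" "\<And>i. cf c i p f = b i" using F0 df[OF pW] by (simp_all add: f_def)
    ultimately show ?thesis using fs by blast
  qed
  then show ?thesis using W pW Wc by blast
qed

text \<open>The bilinear form \<open>\<Sum>\<^sub>b C\<^sub>b h\<^sub>b \<otimes> f\<^sub>b\<close> of jets satisfies the same linear system as the constant \<open>1/k\<close>
  together with the metric.\<close>

lemma hess_pairing:
  fixes f h :: "'d option \<Rightarrow> 'm \<Rightarrow> real"
  assumes dual: "dual_connections M A g D D'" and D': "affine_connection M A D'" "torsion_free M A D'"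
    and k: "k \<noteq> 0" and c: "cs c" "W \<subseteq> fst c" and W: "openin M W" and p: "p \<in> W"
    and f: "\<And>b. sfun W (f b)" "\<And>b. hess_eq k W (f b)"
    and h: "\<And>b. sfun W (h b)" "\<And>b. rconn.hess_eq M A g D' k W (h b)"
    and i1: "(\<Sum>b\<in>UNIV. C b * h b p * f b p) = 1 / k"
    and i2: "\<And>j. (\<Sum>b\<in>UNIV. C b * h b p * cf c j p (f b)) = 0"
    and i3: "\<And>i. (\<Sum>b\<in>UNIV. C b * cf c i p (h b) * f b p) = 0"
    and i4: "\<And>i j. (\<Sum>b\<in>UNIV. C b * cf c i p (h b) * cf c j p (f b)) = gm c i j p"
  shows "\<exists>W'. openin M W' \<and> p \<in> W' \<and> W' \<subseteq> W \<and> (\<forall>q\<in>W'. (\<Sum>b\<in>UNIV. C b * h b q * f b q) = 1 / k)"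
proof -
  interpret d: rconn M A g D' by unfold_locales (rule riem D')+
  note cc = cs_chart[OF c(1)]
  define N where "N a e = (case a of
      None \<Rightarrow> (case e of None \<Rightarrow> (\<lambda>q. 1 / k) | Some j \<Rightarrow> (\<lambda>q. 0))
    | Some i \<Rightarrow> (case e of None \<Rightarrow> (\<lambda>q. 0) | Some j \<Rightarrow> gm c i j))" for a e
  have N: "N None None = (\<lambda>q. 1 / k)" "N None (Some j) = (\<lambda>q. 0)" "N (Some i) None = (\<lambda>q. 0)"
    "N (Some i) (Some j) = gm c i j" for i j by (simp_all add: N_def)
  define B where "B = jet_coeff c k"
  define B' where "B' = d.jet_coeff c k"
  \<comment> \<open>The products of dual and primal jets minus \<open>N\<close>. Both parts satisfy
    the same linear system, so \<open>T\<close> does as well, and \<open>i1\<close> to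
    \<open>i4\<close> say that it vanishes at \<open>p\<close>.\<close>
  define T where "T a e q = (\<Sum>b\<in>UNIV. C b * (d.jet c (h b) a q * jet c (f b) e q)) + (- 1) * N a e q" for a e q
  have Ns: "sfun W (N a e)" for a e
    by (cases a; cases e) (auto simp: N intro!: sfun_const W sfun_subset[OF gm_sfun[OF c(1)] W c(2)])
  have Js: "sfun W (jet c (f b) e)" "sfun W (d.jet c (h b) a)" for a b e
    by (rule jet_sfun[OF c f(1)], rule d.jet_sfun[OF c h(1)])
  have Ts: "sfun W (T a e)" for a e
    unfolding T_def[abs_def] by (intro sfun_add sfun_sum sfun_mult sfun_const W Js Ns)
  \<comment> \<open>\<open>N\<close> is parallel for the dual jet system in its first index and the
    primal one in its second. In the block (\<open>Some i\<close>, \<open>None\<close>) this reads -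
    k g_mi (1/k) + g_im = 0, which fixes the constant 1/k, and likewise in the transposed block; in
    the metric block it is duality.\<close>
  have dN: "cf c m q (N a e) = (\<Sum>s\<in>UNIV. B' m a s q * N s e q) + (\<Sum>s\<in>UNIV. B m e s q * N a s q)"
    if q: "q \<in> W" for m a e q
  proof -
    have qc: "q \<in> fst c" using q c by blast
    note const = tangent_const[OF coord_field_tangent[OF c(1) qc]]
    have "cf c m q (gm c i j) = (\<Sum>s\<in>UNIV. christoffel M A D' c m i s q * gm c s j q) + (\<Sum>s\<in>UNIV. \<Gamma> c m j s q * gm c i s q)" for i j
    proof -
      have "cf c m q (gm c i j) = cf c m q (gm c j i)"
        by (rule tangent_cong[OF coord_field_tangent[OF c(1) qc] cs_open[OF c(1)] qc gm_sym[OF c(1)]])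
      then show ?thesis using duality_cf[OF dual D' c(1) qc, of m j i]
        by (simp add: gm_sym[OF c(1) qc, of i] gm_sym[OF c(1) qc, of j])
    qed
    then show ?thesis
      by (cases a; cases e) (simp_all add: N B_def B'_def sum_option sum_delta_left const k gm_sym[OF c(1) qc, of m])
  qed
  have dT: "cf c m q (T a e) = (\<Sum>s\<in>UNIV. B' m a s q * T s e q) + (\<Sum>s\<in>UNIV. B m e s q * T a s q)"
    if q: "q \<in> W" for m a e q
  proof -
    have qc: "q \<in> fst c" using q c by blast
    note t = coord_field_tangent[OF c(1) qc, of m]
    note sn = smooth_nearI[OF _ q]
    have dJ: "cf c m q (jet c (f b) e) = (\<Sum>s\<in>UNIV. B m e s q * jet c (f b) s q)" for b e
      unfolding B_def by (rule jet_derivative[OF c W f(2) q])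
    have dK: "cf c m q (d.jet c (h b) a) = (\<Sum>s\<in>UNIV. B' m a s q * d.jet c (h b) s q)" for b a
      unfolding B'_def by (rule d.jet_derivative[OF c W h(2) q])
    have X0: "cf c m q (T a e) = (\<Sum>b\<in>UNIV. cf c m q (\<lambda>q. C b * (d.jet c (h b) a q * jet c (f b) e q))) + cf c m q (\<lambda>q. - 1 * N a e q)"
      unfolding T_def[abs_def]
      by (subst tangent_add[OF t sn sn], (intro sfun_sum sfun_mult sfun_const W Js Ns)+)
        (subst tangent_sum[OF t finite q W], (intro sfun_mult sfun_const W Js Ns refl)+)
    have X1: "cf c m q (\<lambda>q. - 1 * N a e q) = - 1 * cf c m q (N a e) + N a e q * cf c m q (\<lambda>q. - 1)"
      by (rule tangent_mult[OF t sn[OF sfun_const[OF W]] sn[OF Ns]])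
    have X2: "cf c m q (\<lambda>q. C b * (d.jet c (h b) a q * jet c (f b) e q)) =
        C b * (\<Sum>s\<in>UNIV. B m e s q * (d.jet c (h b) a q * jet c (f b) s q)) + C b * (\<Sum>s\<in>UNIV. B' m a s q * (d.jet c (h b) s q * jet c (f b) e q))" for b
    proof -
      have "cf c m q (\<lambda>q. C b * (d.jet c (h b) a q * jet c (f b) e q)) = C b * cf c m q (\<lambda>q. d.jet c (h b) a q * jet c (f b) e q)
          + (d.jet c (h b) a q * jet c (f b) e q) * cf c m q (\<lambda>q. C b)"
        by (rule tangent_mult[OF t sn[OF sfun_const[OF W]] sn[OF sfun_mult[OF Js(2,1)]]])
      moreover have "cf c m q (\<lambda>q. d.jet c (h b) a q * jet c (f b) e q) = d.jet c (h b) a q * cf c m q (jet c (f b) e) + jet c (f b) e q * cf c m q (d.jet c (h b) a)"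
        by (rule tangent_mult[OF t sn[OF Js(2)] sn[OF Js(1)]])
      ultimately show ?thesis
        unfolding dJ dK tangent_const[OF t] by (simp add: sum_distrib_left distrib_left ac_simps)
    qed
    have 1: "cf c m q (T a e) = (\<Sum>b\<in>UNIV. C b * (\<Sum>s\<in>UNIV. B m e s q * (d.jet c (h b) a q * jet c (f b) s q))
        + C b * (\<Sum>s\<in>UNIV. B' m a s q * (d.jet c (h b) s q * jet c (f b) e q))) - cf c m q (N a e)"
      unfolding X0 X1 X2 tangent_const[OF t] by simp
    have swap: "(\<Sum>s\<in>UNIV. x s * ((\<Sum>b\<in>UNIV. C b * z b s) + - 1 * y s)) = (\<Sum>b\<in>UNIV. C b * (\<Sum>s\<in>UNIV. x s * z b s)) - (\<Sum>s\<in>UNIV. x s * y s)"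
      for x y :: "'d option \<Rightarrow> real" and z
    proof -
      have "(\<Sum>s\<in>UNIV. x s * ((\<Sum>b\<in>UNIV. C b * z b s) + - 1 * y s)) = (\<Sum>s\<in>UNIV. \<Sum>b\<in>UNIV. C b * (x s * z b s)) - (\<Sum>s\<in>UNIV. x s * y s)"
        by (simp add: sum_distrib_left algebra_simps sum_subtractf)
      also have "(\<Sum>s\<in>UNIV. \<Sum>b\<in>UNIV. C b * (x s * z b s)) = (\<Sum>b\<in>UNIV. C b * (\<Sum>s\<in>UNIV. x s * z b s))"
        unfolding sum_distrib_left by (rule sum.swap)
      finally show ?thesis .
    qed
    show ?thesis unfolding 1 dN[OF q] sum.distrib unfolding T_def swap by simp
  qed
  define \<Omega> where "\<Omega> = snd c ` W"
  have \<Omega>: "open \<Omega>" "snd c p \<in> \<Omega>" using is_chart_image_open[OF cc W c(2)] p by (auto simp: \<Omega>_def)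
  \<comment> \<open>The sum of the moduli of all coefficients is continuous and dominates each of
    them, so near \<open>p\<close> the single constant \<open>K\<close> bounds every
    coefficient.\<close>
  define \<beta> where "\<beta> x = (\<Sum>m\<in>UNIV. \<Sum>a\<in>UNIV. \<Sum>e\<in>UNIV. \<bar>B m a e (param c x)\<bar> + \<bar>B' m a e (param c x)\<bar>)" for x
  have "continuous_on \<Omega> (\<lambda>x. B m a e (param c x))" "continuous_on \<Omega> (\<lambda>x. B' m a e (param c x))" for m a e
  proof -
    have "sfun W (B m a e)" "sfun W (B' m a e)"
      unfolding B_def B'_def
      by (rule sfun_subset[OF jet_coeff_sfun[OF c(1)] W c(2)], rule sfun_subset[OF d.jet_coeff_sfun[OF c(1)] W c(2)])
    note sm = this[THEN sfun_cs, OF c(1), unfolded Int_absorb2[OF c(2)] comp_def, THEN smooth_on_continuous]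
    show "continuous_on \<Omega> (\<lambda>x. B m a e (param c x))" unfolding \<Omega>_def by (rule sm(1))
    show "continuous_on \<Omega> (\<lambda>x. B' m a e (param c x))" unfolding \<Omega>_def by (rule sm(2))
  qed
  then have "continuous_on \<Omega> \<beta>" unfolding \<beta>_def[abs_def] by (intro continuous_intros)
  then have "isCont \<beta> (snd c p)" using \<Omega> by (simp add: continuous_on_eq_continuous_at)
  then obtain r1 where r1: "r1 > 0" "\<And>x. dist x (snd c p) < r1 \<Longrightarrow> dist (\<beta> x) (\<beta> (snd c p)) < 1"
    unfolding continuous_at_eps_delta by (metis zero_less_one)
  obtain r2 where r2: "r2 > 0" "ball (snd c p) r2 \<subseteq> \<Omega>" using \<Omega> open_contains_ball by blast
  define r where "r = min r1 r2"
  define K where "K = \<beta> (snd c p) + 1"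
  have K: "\<beta> x \<le> K" if "x \<in> ball (snd c p) r" for x
    using r1(2)[of x] that by (auto simp: K_def r_def dist_commute dist_real_def)
  have sub: "ball (snd c p) r \<subseteq> \<Omega>" using r2 by (auto simp: r_def)
  have r: "r > 0" using r1 r2 by (simp add: r_def)
  have Bb: "\<bar>B m a e (param c x)\<bar> \<le> \<beta> x" "\<bar>B' m a e (param c x)\<bar> \<le> \<beta> x" for m a e x
  proof -
    have "\<bar>B m a e (param c x)\<bar> + \<bar>B' m a e (param c x)\<bar> \<le> (\<Sum>e\<in>UNIV. \<bar>B m a e (param c x)\<bar> + \<bar>B' m a e (param c x)\<bar>)"
      by (rule member_le_sum) auto
    also have "\<dots> \<le> (\<Sum>a\<in>UNIV. \<Sum>e\<in>UNIV. \<bar>B m a e (param c x)\<bar> + \<bar>B' m a e (param c x)\<bar>)"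
      by (rule member_le_sum[where f = "\<lambda>a. \<Sum>e\<in>UNIV. \<bar>B m a e (param c x)\<bar> + \<bar>B' m a e (param c x)\<bar>"])
        (auto intro!: sum_nonneg)
    also have "\<dots> \<le> \<beta> x"
      unfolding \<beta>_def
      by (rule member_le_sum[where f = "\<lambda>m. \<Sum>a\<in>UNIV. \<Sum>e\<in>UNIV. \<bar>B m a e (param c x)\<bar> + \<bar>B' m a e (param c x)\<bar>"])
        (auto intro!: sum_nonneg)
    finally show "\<bar>B m a e (param c x)\<bar> \<le> \<beta> x" "\<bar>B' m a e (param c x)\<bar> \<le> \<beta> x" by auto
  qed
  have K0: "K \<ge> 0" using order_trans[OF abs_ge_zero Bb(1), of "snd c p"] by (simp add: K_def)
  define y where "y = (\<lambda>(a, e) x. T a e (param c x))"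
  define y' where "y' = (\<lambda>(a, e) x v. \<Sum>m\<in>UNIV. v $ m * cf c m (param c x) (T a e))"
  have xW: "param c x \<in> W" "snd c (param c x) = x" if "x \<in> \<Omega>" for x
    using that param_snd[OF cc] c(2) by (auto simp: \<Omega>_def subset_iff)
  have "\<exists>s>0. s \<le> r \<and> (\<forall>x\<in>ball (snd c p) s. \<forall>i\<in>UNIV. y i x = 0)"
  \<comment> \<open>Each partial derivative of a component of \<open>T\<close> is a sum of two
    matrix products, both at most \<open>K\<close> times the sum of all moduli; adding up the
    directions gives the factor \<open>CARD('d)\<close>.\<close>
  proof (rule linear_system_unique[where C = "real CARD('d) * (2 * K)" and y' = y', OF finite r])
    show "0 \<le> real CARD('d) * (2 * K)" using K0 by simp
  next
    fix i :: "'d option \<times> 'd option" and x assume x: "x \<in> ball (snd c p) r"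
    obtain a e where i: "i = (a, e)" by (cases i)
    note q = xW(1)[OF subsetD[OF sub x]]
    have sn: "smooth_near M A (param c x) (T a e)" by (rule smooth_nearI[OF Ts q])
    have "(T a e \<circ> param c) differentiable (at x)"
      using smooth_near_differentiable[OF sn c(1)] q c(2) xW(2)[OF subsetD[OF sub x]] by auto
    from has_derivative_pderiv[OF this] show "(y i has_derivative y' i x) (at x)"
      using coord_field_pderiv[OF sn, of c] xW(2)[OF subsetD[OF sub x]] by (simp add: y_def y'_def i comp_def)
    fix v :: "real^'d"
    define Y where "Y = (\<Sum>j\<in>UNIV. \<bar>y j x\<bar>)"
    have Y: "Y = (\<Sum>a\<in>UNIV. \<Sum>e\<in>UNIV. \<bar>T a e (param c x)\<bar>)"
      unfolding Y_def y_def by (simp add: sum.cartesian_product UNIV_Times_UNIV[symmetric] case_prod_beta del: UNIV_Times_UNIV)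
    have Y1: "(\<Sum>s\<in>UNIV. \<bar>T a s (param c x)\<bar>) \<le> Y" for a
      unfolding Y by (rule member_le_sum[where f = "\<lambda>a. \<Sum>s\<in>UNIV. \<bar>T a s (param c x)\<bar>"]) (auto intro!: sum_nonneg)
    have Y2: "(\<Sum>s\<in>UNIV. \<bar>T s e (param c x)\<bar>) \<le> Y" for e
      unfolding Y by (intro sum_mono member_le_sum) auto
    have 1: "\<bar>cf c m (param c x) (T a e)\<bar> \<le> 2 * K * Y" for m
    proof -
      have "\<bar>\<Sum>s\<in>UNIV. B' m a s (param c x) * T s e (param c x)\<bar> \<le> (\<Sum>s\<in>UNIV. K * \<bar>T s e (param c x)\<bar>)"
        by (intro order_trans[OF sum_abs] sum_mono) (auto simp: abs_mult intro!: mult_right_mono order_trans[OF Bb(2) K[OF x]])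
      also have "\<dots> \<le> K * Y" unfolding sum_distrib_left[symmetric] by (intro mult_left_mono Y2 K0)
      finally have A1: "\<bar>\<Sum>s\<in>UNIV. B' m a s (param c x) * T s e (param c x)\<bar> \<le> K * Y" .
      have "\<bar>\<Sum>s\<in>UNIV. B m e s (param c x) * T a s (param c x)\<bar> \<le> (\<Sum>s\<in>UNIV. K * \<bar>T a s (param c x)\<bar>)"
        by (intro order_trans[OF sum_abs] sum_mono) (auto simp: abs_mult intro!: mult_right_mono order_trans[OF Bb(1) K[OF x]])
      also have "\<dots> \<le> K * Y" unfolding sum_distrib_left[symmetric] by (intro mult_left_mono Y1 K0)
      finally show ?thesis using A1 unfolding dT[OF q] by linarith
    qed
    have "\<bar>y' i x v\<bar> \<le> (\<Sum>m\<in>(UNIV::'d set). norm v * (2 * K * Y))"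
      unfolding i y'_def prod.case
      by (intro order_trans[OF sum_abs] sum_mono) (auto simp: abs_mult intro!: mult_mono component_le_norm_cart 1)
    then show "\<bar>y' i x v\<bar> \<le> real CARD('d) * (2 * K) * norm v * (\<Sum>j\<in>UNIV. \<bar>y j x\<bar>)"
      unfolding Y_def[symmetric] by (simp add: ac_simps)
  next
    fix i :: "'d option \<times> 'd option"
    obtain a e where i: "i = (a, e)" by (cases i)
    have pp: "param c (snd c p) = p" using param_snd[OF cc] p c(2) by blast
    show "y i (snd c p) = 0"
      unfolding i y_def prod.case pp T_def
      using i1 i2 i3 i4 by (cases a; cases e) (simp_all add: N mult.assoc)
  qed
  then obtain s where s: "s > 0" "s \<le> r" "\<And>x. x \<in> ball (snd c p) s \<Longrightarrow> y (None, None) x = 0" by blast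
  define W' where "W' = param c ` ball (snd c p) s"
  have subs: "ball (snd c p) s \<subseteq> \<Omega>" using sub s(2) by auto
  have "openin M W'" unfolding W'_def
    by (rule is_chart_param_open[OF cc open_ball]) (use subs c(2) in \<open>auto simp: \<Omega>_def\<close>)
  moreover have "p \<in> W'" unfolding W'_def using s(1) param_snd[OF cc] p c(2)
    by (auto intro!: image_eqI[of _ _ "snd c p"])
  moreover have "W' \<subseteq> W" unfolding W'_def using xW subs by blast
  moreover have "(\<Sum>b\<in>UNIV. C b * h b q * f b q) = 1 / k" if q: "q \<in> W'" for q
  proof -
    obtain x where x: "x \<in> ball (snd c p) s" "q = param c x" using q unfolding W'_def by blast
    then show ?thesis using s(3)[OF x(1)] by (simp add: y_def T_def N mult.assoc)
  qed
  ultimately show ?thesis by blast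
qed

end

section \<open>Curves, convexity and the inverse function theorem\<close>

text \<open>The antiderivative is the integral from a fixed base point. The fundamental theorem is
  applied on a compact subinterval of \<open>I\<close> that contains the base point and has the
  given point in its interior.\<close>

lemma open_interval_antiderivative:
  fixes f :: "real \<Rightarrow> real"
  assumes I: "open I" "is_interval I" and f: "continuous_on I f"
  shows "\<exists>F. \<forall>x\<in>I. (F has_real_derivative f x) (at x)"
proof (cases "I = {}")
  case False
  then obtain c where c: "c \<in> I" by blast
  have "((\<lambda>u. LBINT y=c..u. f y) has_real_derivative f x) (at x)" if x: "x \<in> I" for x
  proof -
    obtain e where e: "e > 0" "cball c e \<subseteq> I" using I(1) c open_contains_cball by blast
    obtain d where d: "d > 0" "cball x d \<subseteq> I" using I(1) x open_contains_cball by blast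
    define a where "a = min (c - e) (x - d)"
    define b where "b = max (c + e) (x + d)"
    have "c - e \<in> I" "x - d \<in> I" "c + e \<in> I" "x + d \<in> I" using e d by (auto simp: dist_real_def subset_iff)
    then have ab: "a \<in> I" "b \<in> I" by (simp_all add: a_def b_def min_def max_def)
    have "{a..b} \<subseteq> I" using I(2) ab by (meson atLeastAtMost_iff mem_is_interval_1_I subsetI)
    then have "((\<lambda>u. LBINT y=c..u. f y) has_vector_derivative f x) (at x within {a..b})"
      using e d by (intro interval_integral_FTC2 continuous_on_subset[OF f]) (auto simp: a_def b_def)
    moreover have "at x within {a..b} = at x"
      using e d by (intro at_within_interior) (auto simp: a_def b_def)
    ultimately show ?thesis by (simp add: has_real_derivative_iff_has_vector_derivative)
  qed
  then show ?thesis by blast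
qed simp

text \<open>The solution is the inverse of a primitive of \<open>\<beta>\<close>.\<close>

lemma autonomous_ode_solution:
  fixes \<beta> :: "real \<Rightarrow> real"
  assumes J: "open J" "is_interval J" and \<beta>: "smooth_on J \<beta>" and pos: "\<And>r. r \<in> J \<Longrightarrow> \<beta> r > 0"
  shows "\<exists>I s. open I \<and> is_interval I \<and> s ` I = J \<and> smooth_on I s \<and>
    (\<forall>t\<in>I. (s has_real_derivative inverse (\<beta> (s t))) (at t))"
proof -
  obtain T where T: "\<And>x. x \<in> J \<Longrightarrow> (T has_real_derivative \<beta> x) (at x)"
    using open_interval_antiderivative[OF J smooth_on_continuous[OF \<beta>]] by blast
  have mono: "T x < T y" if "x \<in> J" "y \<in> J" "x < y" for x y
  proof (rule DERIV_pos_imp_increasing[OF that(3)])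
    fix z assume "x \<le> z" "z \<le> y"
    then have "z \<in> J" using J(2) that by (meson mem_is_interval_1_I)
    then show "\<exists>D. (T has_real_derivative D) (at z) \<and> D > 0" using T pos by blast
  qed
  have inj: "inj_on T J" using mono by (metis inj_onI less_irrefl linorder_less_linear)
  have cT: "continuous_on J T" using T by (meson DERIV_isCont continuous_at_imp_continuous_on)
  define I where "I = T ` J"
  define s where "s = inv_into J T"
  have I: "open I" unfolding I_def by (rule invariance_of_domain[OF cT J(1) inj])
  have "connected I" unfolding I_def using J(2) cT by (simp add: connected_continuous_image is_interval_connected_1)
  then have int: "is_interval I" by (simp add: is_interval_connected_1)
  have sJ: "s t \<in> J" "T (s t) = t" if "t \<in> I" for t
    using that unfolding s_def I_def by (auto simp: inv_into_into f_inv_into_f)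
  have sT: "s (T r) = r" if "r \<in> J" for r using that inj by (simp add: s_def)
  have img: "s ` I = J" using sT unfolding I_def by (auto simp: image_image)
  have ds: "(s has_real_derivative inverse (\<beta> (s t))) (at t)" if t: "t \<in> I" for t
  proof -
    have b: "\<beta> (s t) \<noteq> 0" using pos sJ(1)[OF t] by (simp add: less_imp_neq[THEN not_sym])
    have "(s has_derivative (\<lambda>h. inverse (\<beta> (s t)) * h)) (at (T (s t)))"
    proof (rule has_derivative_inverse_strong[OF J(1) sJ(1)[OF t] cT sT])
      show "(T has_derivative (\<lambda>h. \<beta> (s t) * h)) (at (s t))"
        using T[OF sJ(1)[OF t]] by (simp add: has_field_derivative_def)
      show "(\<lambda>h. \<beta> (s t) * h) \<circ> (\<lambda>h. inverse (\<beta> (s t)) * h) = id" using b by (auto simp: fun_eq_iff)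
    qed
    then show ?thesis by (simp add: sJ(2)[OF t] has_field_derivative_def)
  qed
  have "smooth_on I s"
  proof (rule smooth_on_bootstrap[OF I])
    show "(s has_derivative (\<lambda>h. inverse (\<beta> (s t)) * h)) (at t)" if "t \<in> I" for t
      using ds[OF that] by (simp add: has_field_derivative_def)
    fix n v assume n: "C_on n s I"
    have "C_on n (\<lambda>t. \<beta> (s t)) I"
      by (rule C_on_compose[OF I sJ(1) _ n]) (use \<beta> in \<open>simp_all add: smooth_on_def\<close>)
    moreover have "\<beta> (s t) \<noteq> 0" if "t \<in> I" for t using pos[OF sJ(1)[OF that]] by simp
    ultimately show "C_on n (\<lambda>t. inverse (\<beta> (s t)) * v) I"
      by (intro C_on_mult[OF I] C_on_inverse[OF I] C_on_const)
  qed
  then show ?thesis using I int img ds by blast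
qed

section \<open>Differentiation along curves, convexity and inverse functions\<close>

lemma smooth_curve_component:
  fixes x :: "real \<Rightarrow> real^'d"
  assumes S: "open S" and x: "smooth_on S x"
  shows "t \<in> S \<Longrightarrow> ((\<lambda>s. x s $ i) has_real_derivative deriv (\<lambda>s. x s $ i) t) (at t)"
    and "smooth_on S (deriv (\<lambda>s. x s $ i))"
proof -
  have sm: "smooth_on S (\<lambda>s. x s $ i)" by (rule smooth_on_nth[OF S x])
  have D: "((\<lambda>s. x s $ i) has_real_derivative frechet_derivative (\<lambda>s. x s $ i) (at t) 1) (at t)" if "t \<in> S" for t
  proof -
    have d: "((\<lambda>s. x s $ i) has_derivative frechet_derivative (\<lambda>s. x s $ i) (at t)) (at t)"
      by (rule smooth_on_has_derivative[OF sm that])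
    then interpret linear "frechet_derivative (\<lambda>s. x s $ i) (at t)" by (rule has_derivative_linear)
    have "frechet_derivative (\<lambda>s. x s $ i) (at t) = (*) (frechet_derivative (\<lambda>s. x s $ i) (at t) 1)"
    proof (rule ext)
      fix h :: real
      have "frechet_derivative (\<lambda>s. x s $ i) (at t) (h *\<^sub>R 1) = h *\<^sub>R frechet_derivative (\<lambda>s. x s $ i) (at t) 1"
        by (rule scaleR)
      then have "frechet_derivative (\<lambda>s. x s $ i) (at t) h = h * frechet_derivative (\<lambda>s. x s $ i) (at t) 1"
        by (simp only: real_scaleR_def mult_1_right)
      then show "frechet_derivative (\<lambda>s. x s $ i) (at t) h = frechet_derivative (\<lambda>s. x s $ i) (at t) 1 * h"
        by (rule trans[OF _ mult.commute])
    qed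
    then show ?thesis unfolding has_field_derivative_def using d by metis
  qed
  have eq: "deriv (\<lambda>s. x s $ i) t = frechet_derivative (\<lambda>s. x s $ i) (at t) 1" if "t \<in> S" for t
    by (rule DERIV_imp_deriv[OF D[OF that]])
  show "((\<lambda>s. x s $ i) has_real_derivative deriv (\<lambda>s. x s $ i) t) (at t)" if "t \<in> S"
    using D[OF that] eq[OF that] by simp
  show "smooth_on S (deriv (\<lambda>s. x s $ i))"
    using smooth_on_frechet[OF sm, of 1] eq
      smooth_on_cong[OF S, of "deriv (\<lambda>s. x s $ i)" "\<lambda>t. frechet_derivative (\<lambda>s. x s $ i) (at t) 1"] by blast
qed

lemma smooth_on_real_derivative:
  fixes f :: "real \<Rightarrow> real"
  assumes S: "open S" and f: "smooth_on S f"
  shows "t \<in> S \<Longrightarrow> (f has_real_derivative deriv f t) (at t)" and "smooth_on S (deriv f)"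
proof -
  \<comment> \<open>A real function is regarded as a curve with one component.\<close>
  have x: "smooth_on S (\<lambda>t. (\<chi> i::unit. f t))" by (rule smooth_on_vec[OF S]) (simp add: f)
  show "t \<in> S \<Longrightarrow> (f has_real_derivative deriv f t) (at t)" "smooth_on S (deriv f)"
    using smooth_curve_component(1)[OF S x, of _ "()"] smooth_curve_component(2)[OF S x, of "()"] by simp_all
qed

lemma has_real_derivative_along_curve:
  fixes F :: "real^'d \<Rightarrow> real" and x :: "real \<Rightarrow> real^'d"
  assumes F: "F differentiable (at (x t))" and x: "\<And>i. ((\<lambda>s. x s $ i) has_real_derivative x' i) (at t)"
  shows "((\<lambda>s. F (x s)) has_real_derivative (\<Sum>i\<in>UNIV. x' i * pderiv_at i F (x t))) (at t)"
proof -
  have "(x has_derivative (\<lambda>h. \<chi> i. x' i * h)) (at t)"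
    using x by (subst has_derivative_componentwise_within)
      (auto simp: Basis_vec_def inner_axis has_field_derivative_def)
  from has_derivative_compose[OF this has_derivative_pderiv[OF F]]
  have "((\<lambda>s. F (x s)) has_derivative (\<lambda>h. \<Sum>n\<in>UNIV. (\<chi> i. x' i * h) $ n * pderiv_at n F (x t))) (at t)" .
  moreover have "(\<lambda>h. \<Sum>n\<in>UNIV. (\<chi> i. x' i * h) $ n * pderiv_at n F (x t)) =
      (*) (\<Sum>i\<in>UNIV. x' i * pderiv_at i F (x t))"
    by (rule ext) (simp add: sum_distrib_right sum_distrib_left ac_simps)
  ultimately show ?thesis by (simp only: has_field_derivative_def)
qed

text \<open>Convexity is a statement about segments: along a + s v the second derivative of
  \<open>u\<close> is the Hessian form at v, which is nonnegative.\<close>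

lemma convex_on_hessian:
  fixes u :: "real^'d \<Rightarrow> real"
  assumes N: "open N" "convex N" and u: "smooth_on N u"
    and pos: "\<And>x v. x \<in> N \<Longrightarrow> (\<Sum>i\<in>UNIV. \<Sum>j\<in>UNIV. v $ i * v $ j * pderiv_at i (pderiv_at j u) x) \<ge> 0"
  shows "convex_on N u"
proof (rule convex_onI[OF _ N(2)])
  fix t :: real and a b assume t: "0 < t" "t < 1" and ab: "a \<in> N" "b \<in> N"
  define v where "v = b - a"
  define x where "x s = a + s *\<^sub>R v" for s
  define C where "C = x -` N"
  have dx: "((\<lambda>s. x s $ i) has_real_derivative v $ i) (at s)" for s i
    unfolding x_def by (auto intro!: derivative_eq_intros)
  have C: "convex C"
  proof (rule convexI)
    fix r s and p q :: real assume H: "r \<in> C" "s \<in> C" "0 \<le> p" "0 \<le> q" "p + q = 1"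
    have "x (p *\<^sub>R r + q *\<^sub>R s) = (p + q) *\<^sub>R a + (p * r + q * s) *\<^sub>R v" using H(5) by (simp add: x_def)
    also have "\<dots> = p *\<^sub>R x r + q *\<^sub>R x s" by (simp add: x_def algebra_simps)
    also have "\<dots> \<in> N" using H N(2) by (auto simp: C_def intro: convexD)
    finally show "p *\<^sub>R r + q *\<^sub>R s \<in> C" by (simp add: C_def)
  qed
  have "convex_on C (\<lambda>s. u (x s))"
  proof (rule f''_ge0_imp_convex[OF C])
    fix s assume s: "s \<in> C"
    then have xs: "x s \<in> N" by (simp add: C_def)
    show "((\<lambda>s. u (x s)) has_real_derivative (\<Sum>j\<in>UNIV. v $ j * pderiv_at j u (x s))) (at s)"
      by (rule has_real_derivative_along_curve[OF smooth_on_differentiable[OF u xs] dx])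
    have "((\<lambda>s. \<Sum>j\<in>UNIV. v $ j * pderiv_at j u (x s)) has_real_derivative
        (\<Sum>j\<in>UNIV. v $ j * (\<Sum>i\<in>UNIV. v $ i * pderiv_at i (pderiv_at j u) (x s)))) (at s)"
      by (intro DERIV_sum DERIV_cmult has_real_derivative_along_curve dx
          smooth_on_differentiable[OF smooth_on_pderiv[OF u] xs])
    also have "(\<Sum>j\<in>UNIV. v $ j * (\<Sum>i\<in>UNIV. v $ i * pderiv_at i (pderiv_at j u) (x s))) =
        (\<Sum>i\<in>UNIV. \<Sum>j\<in>UNIV. v $ i * v $ j * pderiv_at i (pderiv_at j u) (x s))"
      unfolding sum_distrib_left by (subst sum.swap) (simp add: ac_simps)
    finally show "((\<lambda>s. \<Sum>j\<in>UNIV. v $ j * pderiv_at j u (x s)) has_real_derivative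
        (\<Sum>i\<in>UNIV. \<Sum>j\<in>UNIV. v $ i * v $ j * pderiv_at i (pderiv_at j u) (x s))) (at s)" .
    show "(\<Sum>i\<in>UNIV. \<Sum>j\<in>UNIV. v $ i * v $ j * pderiv_at i (pderiv_at j u) (x s)) \<ge> 0" by (rule pos[OF xs])
  qed
  moreover have "0 \<in> C" "1 \<in> C" using ab by (simp_all add: C_def x_def v_def)
  ultimately have "u (x ((1 - t) *\<^sub>R 0 + t *\<^sub>R 1)) \<le> (1 - t) * u (x 0) + t * u (x 1)"
    using t by (intro convex_onD) auto
  moreover have "x ((1 - t) *\<^sub>R 0 + t *\<^sub>R 1) = (1 - t) *\<^sub>R a + t *\<^sub>R b" by (simp add: x_def v_def algebra_simps)
  ultimately show "u ((1 - t) *\<^sub>R a + t *\<^sub>R b) \<le> (1 - t) * u a + t * u b" by (simp add: x_def v_def)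
qed

text \<open>The inverse function theorem gives a differentiable local inverse; differentiability is
  all that \<open>smooth_on_local_inverse\<close> needs to make it smooth.\<close>

lemma smooth_inverse_function:
  fixes f :: "real^'d \<Rightarrow> real^'d"
  assumes \<Omega>: "open \<Omega>" "x0 \<in> \<Omega>" and f: "smooth_on \<Omega> f"
    and det: "det (\<chi> l i. pderiv_at i (\<lambda>x. f x $ l) x0) \<noteq> 0"
  shows "\<exists>U V g. open U \<and> U \<subseteq> \<Omega> \<and> x0 \<in> U \<and> open V \<and> homeomorphism U V f g \<and> smooth_on V g"
proof -
  define J where "J = (\<chi> l i. pderiv_at i (\<lambda>x. f x $ l) x0)"
  have fd: "(f has_derivative frechet_derivative f (at x)) (at x)" if "x \<in> \<Omega>" for x
    by (rule smooth_on_has_derivative[OF f that])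
  define f' where "f' x = Blinfun (frechet_derivative f (at x))" for x
  have f': "blinfun_apply (f' x) = frechet_derivative f (at x)" if "x \<in> \<Omega>" for x
    unfolding f'_def by (rule bounded_linear_Blinfun_apply[OF has_derivative_bounded_linear[OF fd[OF that]]])
  have cf': "continuous_on \<Omega> f'"
  proof (rule continuous_on_blinfun_componentwise)
    fix i
    show "continuous_on \<Omega> (\<lambda>x. blinfun_apply (f' x) i)"
      using smooth_on_continuous[OF smooth_on_frechet[OF f]]
      by (rule continuous_on_eq) (simp add: f')
  qed
  have Jf: "J *v v = frechet_derivative f (at x0) v" for v
  proof -
    have "frechet_derivative f (at x0) v $ l = (\<Sum>i\<in>UNIV. v $ i * pderiv_at i (\<lambda>x. f x $ l) x0)" for l
    proof -
      have sm: "smooth_on \<Omega> (\<lambda>x. f x $ l)" by (rule smooth_on_nth[OF \<Omega>(1) f])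
      have "((\<lambda>x. f x $ l) has_derivative (\<lambda>v. frechet_derivative f (at x0) v $ l)) (at x0)"
        by (rule bounded_linear.has_derivative[OF bounded_linear_vec_nth fd[OF \<Omega>(2)]])
      from frechet_derivative_at[OF this]
      have "frechet_derivative f (at x0) v $ l = frechet_derivative (\<lambda>x. f x $ l) (at x0) v" by metis
      then show ?thesis using frechet_pderiv[OF smooth_on_differentiable[OF sm \<Omega>(2)]] by metis
    qed
    then show ?thesis by (simp add: vec_eq_iff matrix_vector_mult_def J_def mult.commute)
  qed
  obtain K where K: "K ** J = mat 1" using det invertible_det_nz unfolding J_def invertible_def by blast
  define invf where "invf = Blinfun (\<lambda>v. K *v v)"
  have "bounded_linear (\<lambda>v. K *v v)" by (simp add: linear_linear matrix_vector_mul_linear)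
  then have invf: "blinfun_apply invf v = K *v v" for v by (simp add: invf_def bounded_linear_Blinfun_apply)
  have inv: "invf o\<^sub>L f' x0 = id_blinfun"
    by (rule blinfun_eqI) (simp add: invf f'[OF \<Omega>(2)] Jf[symmetric] matrix_vector_mul_assoc K)
  have d': "(f has_derivative blinfun_apply (f' x)) (at x)" if "x \<in> \<Omega>" for x
    using fd[OF that] by (simp add: f'[OF that])
  obtain U V g g' where U: "open U" "U \<subseteq> \<Omega>" "x0 \<in> U" and V: "open V" and "f x0 \<in> V" and h: "homeomorphism U V f g"
    and dg: "\<And>y. y \<in> V \<Longrightarrow> (g has_derivative g' y) (at y)"
    and "\<And>y. y \<in> V \<Longrightarrow> g' y = inv (blinfun_apply (f' (g y)))"
    and "\<And>y. y \<in> V \<Longrightarrow> bij (blinfun_apply (f' (g y)))"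
    by (rule inverse_function_theorem[OF \<Omega>(1) d' cf' \<Omega>(2) inv]) (assumption, rule that)
  have "smooth_on V g"
  proof (rule smooth_on_local_inverse[OF \<Omega>(1) V f])
    fix y assume y: "y \<in> V"
    show "g y \<in> \<Omega>" "f (g y) = y" using y h U(2) unfolding homeomorphism_def by blast+
    show "g differentiable (at y)" using dg[OF y] unfolding differentiable_def by blast
  qed
  then show ?thesis using U V h by blast
qed

context mfd
begin

text \<open>Functions with independent differentials at \<open>p\<close> become coordinates near
  \<open>p\<close> by the inverse function theorem. The conclusion covers every open
  \<open>U\<close> inside \<open>U1\<close>, because two systems built in this way must later be cut
  down to a common domain.\<close>

lemma chart_from_functions:
  assumes c: "cs c" and W: "openin M W" "W \<subseteq> fst c" and p: "p \<in> W"
    and \<xi>: "\<And>l. sfun W (\<lambda>q. \<xi> q $ l)" and det: "det (\<chi> l i. cf c i p (\<lambda>q. \<xi> q $ l)) \<noteq> 0"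
  shows "\<exists>U1. openin M U1 \<and> p \<in> U1 \<and> U1 \<subseteq> W \<and> (\<forall>U. openin M U \<and> U \<subseteq> U1 \<longrightarrow> cs (U, \<xi>))"
proof -
  note cc = cs_chart[OF c]
  define \<Omega> where "\<Omega> = snd c ` W"
  define f where "f = \<xi> \<circ> param c"
  have \<Omega>: "open \<Omega>" "snd c p \<in> \<Omega>" using is_chart_image_open[OF cc W] p by (auto simp: \<Omega>_def)
  have fl: "(\<lambda>x. f x $ l) = (\<lambda>q. \<xi> q $ l) \<circ> param c" for l by (auto simp: f_def)
  have f: "smooth_on \<Omega> f"
    using sfun_cs[OF \<xi> c] W(2) by (intro smooth_on_vec[OF \<Omega>(1)]) (simp add: fl \<Omega>_def Int_absorb2)
  have "pderiv_at i (\<lambda>x. f x $ l) (snd c p) = cf c i p (\<lambda>q. \<xi> q $ l)" for i l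
    unfolding fl by (rule coord_field_pderiv[OF smooth_nearI[OF \<xi> p], symmetric])
  then have "det (\<chi> l i. pderiv_at i (\<lambda>x. f x $ l) (snd c p)) \<noteq> 0" using det by simp
  from smooth_inverse_function[OF \<Omega> f this]
  obtain U' V g where U': "open U'" "U' \<subseteq> \<Omega>" "snd c p \<in> U'" and V: "open V"
    and h: "homeomorphism U' V f g" and g: "smooth_on V g" by blast
  have h1: "f x \<in> V" "g (f x) = x" if "x \<in> U'" for x using h that by (auto simp: homeomorphism_def)
  have h2: "g y \<in> U'" "f (g y) = y" if "y \<in> V" for y using h that by (auto simp: homeomorphism_def)
  define U1 where "U1 = param c ` U'"
  have sub: "U' \<subseteq> snd c ` fst c" using U'(2) W(2) by (auto simp: \<Omega>_def)
  have U1o: "openin M U1" unfolding U1_def by (rule is_chart_param_open[OF cc U'(1) sub])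
  have "param c (snd c p) \<in> U1" unfolding U1_def using U'(3) by (rule imageI)
  then have pU1: "p \<in> U1" using param_snd[OF cc] p W(2) by auto
  have U1W: "U1 \<subseteq> W"
  proof
    fix q assume "q \<in> U1"
    then obtain x where "x \<in> snd c ` W" "q = param c x" using U'(2) unfolding U1_def \<Omega>_def by blast
    then show "q \<in> W" using param_in'[OF cc W(2)] by simp
  qed
  have "cs (U, \<xi>)" if U: "openin M U" "U \<subseteq> U1" for U
  proof -
    define X where "X = snd c ` U"
    have Uc: "U \<subseteq> fst c" using U U1W W(2) by blast
    have X: "open X" unfolding X_def by (rule is_chart_image_open[OF cc U(1) Uc])
    have XU': "X \<subseteq> U'"
    proof
      fix x assume "x \<in> X"
      then obtain q where q: "q \<in> U" "x = snd c q" unfolding X_def by blast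
      then obtain x' where "x' \<in> U'" "q = param c x'" using U(2) unfolding U1_def by blast
      then show "x \<in> U'" using snd_param[of x' c] sub q(2) by auto
    qed
    have fs: "f (snd c q) = \<xi> q" if "q \<in> U" for q
      using param_snd[OF cc] that Uc by (auto simp: f_def)
    have img: "\<xi> ` U = f ` X" unfolding X_def image_image by (rule image_cong[OF refl fs[symmetric]])
    \<comment> \<open>Openness of the image is continuity of the inverse.\<close>
    have "f ` X = V \<inter> g -` X"
    proof (intro equalityI subsetI)
      fix y assume "y \<in> f ` X" then show "y \<in> V \<inter> g -` X" using h1 XU' by auto
    next
      fix y assume "y \<in> V \<inter> g -` X"
      then have "g y \<in> X" "f (g y) = y" using h2 by auto
      then show "y \<in> f ` X" by (metis imageI)
    qed
    then have fX: "open (f ` X)"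
      using continuous_open_preimage[OF smooth_on_continuous[OF g] V X] by simp
    have ts: "topspace (subtopology M (fst c)) = fst c"
      using openin_subset[OF is_chart_openin[OF cc]] by auto
    have "homeomorphic_map (subtopology (subtopology M (fst c)) U) (subtopology (top_of_set (snd c ` fst c)) X) (snd c)"
    proof (rule homeomorphic_map_subtopologies)
      show "homeomorphic_map (subtopology M (fst c)) (top_of_set (snd c ` fst c)) (snd c)"
        using cc by (simp add: is_chart_def)
      show "snd c ` (topspace (subtopology M (fst c)) \<inter> U) = topspace (top_of_set (snd c ` fst c)) \<inter> X"
        unfolding ts X_def using Uc by auto
    qed
    moreover have "fst c \<inter> U = U" "snd c ` fst c \<inter> X = X" using Uc by (auto simp: X_def)
    ultimately have hm1: "homeomorphic_map (subtopology M U) (top_of_set X) (snd c)"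
      by (simp add: subtopology_subtopology)
    have "homeomorphic_maps (top_of_set X) (top_of_set (f ` X)) f g"
      unfolding homeomorphic_maps_def
    proof (intro conjI ballI)
      have "continuous_on X f" using h XU' unfolding homeomorphism_def by (blast intro: continuous_on_subset)
      then show "continuous_map (top_of_set X) (top_of_set (f ` X)) f" by (simp add: image_subset_iff_funcset[symmetric])
      have "f ` X \<subseteq> V" using h1 XU' by blast
      then have "continuous_on (f ` X) g" by (rule continuous_on_subset[OF smooth_on_continuous[OF g]])
      moreover have "g ` f ` X \<subseteq> X" using h1(2) XU' by auto
      ultimately show "continuous_map (top_of_set (f ` X)) (top_of_set X) g" by (simp add: image_subset_iff_funcset[symmetric])
    qed (use h1(2) XU' in auto)
    then have "homeomorphic_map (top_of_set X) (top_of_set (f ` X)) f"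
      using homeomorphic_map_maps by blast
    from homeomorphic_map_compose[OF hm1 this]
    have "homeomorphic_map (subtopology M U) (top_of_set (f ` X)) \<xi>"
      by (rule homeomorphic_map_eq) (simp add: fs)
    then have ch: "is_chart M (U, \<xi>)"
      unfolding is_chart_def fst_conv snd_conv img using U(1) fX by blast
    have par: "param (U, \<xi>) y = param c (g y)" if y: "y \<in> \<xi> ` U" for y
    proof -
      obtain q where q: "q \<in> U" "y = \<xi> q" using y by blast
      have "param (U, \<xi>) (snd (U, \<xi>) q) = q" by (rule param_snd[OF ch]) (simp add: q)
      moreover have "g y = snd c q" using h1(2)[of "snd c q"] fs[OF q(1)] q XU' by (auto simp: X_def)
      ultimately show ?thesis using param_snd[OF cc, of q] q Uc by auto
    qed
    have "compatible a (U, \<xi>)" if a: "a \<in> A" for a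
      unfolding compatible_def fst_conv snd_conv
    proof
      note ca = cs_chart[OF atlas_cs[OF a]]
      have o1: "openin M (fst a \<inter> U)" using U(1) is_chart_openin[OF ca] by blast
      have o2: "open (snd a ` (fst a \<inter> U))" by (rule is_chart_image_open[OF ca o1]) auto
      show "smooth_on (snd a ` (fst a \<inter> U)) (\<xi> \<circ> param a)"
      proof (rule smooth_on_vec[OF o2])
        fix l
        have "smooth_on (snd a ` (W \<inter> fst a)) ((\<lambda>q. \<xi> q $ l) \<circ> param a)" by (rule sfun_cs[OF \<xi> atlas_cs[OF a]])
        then show "smooth_on (snd a ` (fst a \<inter> U)) (\<lambda>x. (\<xi> \<circ> param a) x $ l)"
          unfolding comp_def by (rule smooth_on_subset) (use U U1W in auto)
      qed
      have o3: "open (\<xi> ` (U \<inter> fst a))"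
        using is_chart_image_open[OF ch, of "U \<inter> fst a"] o1 unfolding fst_conv snd_conv Int_commute[of "fst a"] by blast
      have "f ` X \<subseteq> V" using h1(1) XU' by blast
      then have sV: "\<xi> ` (U \<inter> fst a) \<subseteq> V" unfolding img[symmetric] by blast
      have mem: "g y \<in> snd c ` (fst c \<inter> fst a)" if y: "y \<in> \<xi> ` (U \<inter> fst a)" for y
      proof -
        obtain q where q: "q \<in> U" "q \<in> fst a" "y = \<xi> q" using y by blast
        have "g y = snd c q" using h1(2)[of "snd c q"] fs[OF q(1)] q XU' by (auto simp: X_def)
        then show ?thesis using q Uc by blast
      qed
      have "smooth_on (\<xi> ` (U \<inter> fst a)) (\<lambda>y. (snd a \<circ> param c) (g y))"
        by (rule smooth_on_compose[where f = "snd a \<circ> param c" and g = g, OF o3 mem transition_smooth(1)[OF c a] smooth_on_subset[OF g sV]])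
      moreover have "(snd a \<circ> param c) (g y) = (snd a \<circ> param (U, \<xi>)) y" if "y \<in> \<xi> ` (U \<inter> fst a)" for y
        using par[OF subsetD[OF image_mono[OF Int_lower1] that]] by (simp only: comp_apply)
      ultimately have "smooth_on (\<xi> ` (U \<inter> fst a)) (snd a \<circ> param (U, \<xi>))"
        using smooth_on_cong[OF o3, of "\<lambda>y. (snd a \<circ> param c) (g y)" "snd a \<circ> param (U, \<xi>)"] by blast
      then show "smooth_on (\<xi> ` (fst a \<inter> U)) (snd a \<circ> param (U, \<xi>))" by (subst Int_commute)
    qed
    then show "cs (U, \<xi>)" unfolding coordinate_system_def using ch by blast
  qed
  then show ?thesis using U1o pU1 U1W by blast
qed

end

context rconn
begin

text \<open>Along a curve the second derivative of f is df(a) - k g(\<gamma>', \<gamma>') f, where a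
  is the covariant acceleration, whose components are the factors in front of
  \<open>cf a l (\<gamma> t) f\<close>. The curve is arbitrary: for geodesics a = 0 is inserted, for
  straight lines a = 0 is to be deduced.\<close>

lemma curve_hess:
  assumes a: "cs a" and S: "open S" and x: "smooth_on S (\<lambda>t. snd a (\<gamma> t))" and W: "openin M W" "W \<subseteq> fst a"
    and \<gamma>: "\<And>t. t \<in> S \<Longrightarrow> \<gamma> t \<in> W" and f: "sfun W f" "hess_eq k W f" and t: "t \<in> S"
  defines "x' \<equiv> \<lambda>i. deriv (\<lambda>s. snd a (\<gamma> s) $ i)"
  shows "((\<lambda>s. f (\<gamma> s)) has_real_derivative (\<Sum>i\<in>UNIV. x' i t * cf a i (\<gamma> t) f)) (at t)"
    and "((\<lambda>s. \<Sum>i\<in>UNIV. x' i s * cf a i (\<gamma> s) f) has_real_derivative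
       (\<Sum>l\<in>UNIV. (deriv (x' l) t + (\<Sum>i\<in>UNIV. \<Sum>j\<in>UNIV. \<Gamma> a i j l (\<gamma> t) * x' i t * x' j t)) * cf a l (\<gamma> t) f)
       - k * (\<Sum>i\<in>UNIV. \<Sum>j\<in>UNIV. gm a i j (\<gamma> t) * x' i t * x' j t) * f (\<gamma> t)) (at t)"
proof -
  note ca = cs_chart[OF a]
  have along: "((\<lambda>s. h (\<gamma> s)) has_real_derivative (\<Sum>i\<in>UNIV. x' i t * cf a i (\<gamma> t) h)) (at t)"
    if h: "sfun W h" and t: "t \<in> S" for h t
  proof -
    have ta: "\<gamma> t \<in> fst a" using \<gamma>[OF t] W(2) by blast
    have d: "(h \<circ> param a) differentiable (at (snd a (\<gamma> t)))"
      by (rule smooth_near_differentiable[OF smooth_nearI[OF h \<gamma>[OF t]] a ta])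
    have "((\<lambda>s. (h \<circ> param a) (snd a (\<gamma> s))) has_real_derivative
        (\<Sum>i\<in>UNIV. x' i t * pderiv_at i (h \<circ> param a) (snd a (\<gamma> t)))) (at t)"
      by (rule has_real_derivative_along_curve[where x = "\<lambda>s. snd a (\<gamma> s)" and t = t, OF d])
        (use smooth_curve_component(1)[OF S x t] in \<open>simp add: x'_def\<close>)
    then have "((\<lambda>s. (h \<circ> param a) (snd a (\<gamma> s))) has_real_derivative (\<Sum>i\<in>UNIV. x' i t * cf a i (\<gamma> t) h)) (at t)"
      using coord_field_pderiv[OF smooth_nearI[OF h \<gamma>[OF t]], where c = a] by simp
    then show ?thesis
    proof (rule DERIV_cong_ev[THEN iffD1, OF refl _ refl, rotated])
      show "\<forall>\<^sub>F s in nhds t. (h \<circ> param a) (snd a (\<gamma> s)) = h (\<gamma> s)"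
        using eventually_nhds_in_open[OF S t]
        by eventually_elim (simp add: param_snd[OF ca subsetD[OF W(2) \<gamma>]])
    qed
  qed
  show "((\<lambda>s. f (\<gamma> s)) has_real_derivative (\<Sum>i\<in>UNIV. x' i t * cf a i (\<gamma> t) f)) (at t)"
    by (rule along[OF f(1) t])
  have x'': "(x' i has_real_derivative deriv (x' i) t) (at t)" for i
    unfolding x'_def
    by (rule smooth_on_real_derivative(1)[OF S smooth_curve_component(2)[OF S x] t])
  have "((\<lambda>s. \<Sum>i\<in>UNIV. x' i s * cf a i (\<gamma> s) f) has_real_derivative
      (\<Sum>j\<in>UNIV. deriv (x' j) t * cf a j (\<gamma> t) f + (\<Sum>i\<in>UNIV. x' i t * cf a i (\<gamma> t) (\<lambda>q. cf a j q f)) * x' j t)) (at t)"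
    by (intro DERIV_sum DERIV_mult x'' along cf_sfun a W f t)
  also have "(\<Sum>j\<in>UNIV. deriv (x' j) t * cf a j (\<gamma> t) f + (\<Sum>i\<in>UNIV. x' i t * cf a i (\<gamma> t) (\<lambda>q. cf a j q f)) * x' j t)
    = (\<Sum>l\<in>UNIV. (deriv (x' l) t + (\<Sum>i\<in>UNIV. \<Sum>j\<in>UNIV. \<Gamma> a i j l (\<gamma> t) * x' i t * x' j t)) * cf a l (\<gamma> t) f)
       - k * (\<Sum>i\<in>UNIV. \<Sum>j\<in>UNIV. gm a i j (\<gamma> t) * x' i t * x' j t) * f (\<gamma> t)"
  proof -
    have H: "cf a i (\<gamma> t) (\<lambda>q. cf a j q f) = (\<Sum>l\<in>UNIV. \<Gamma> a i j l (\<gamma> t) * cf a l (\<gamma> t) f) - k * gm a i j (\<gamma> t) * f (\<gamma> t)" for i j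
      using hess_eq_cf[OF f(2) W(1) a \<gamma>[OF t]] \<gamma>[OF t] W(2) by blast
    have "(\<Sum>j\<in>UNIV. (\<Sum>i\<in>UNIV. x' i t * cf a i (\<gamma> t) (\<lambda>q. cf a j q f)) * x' j t) =
       (\<Sum>j\<in>UNIV. \<Sum>i\<in>UNIV. (\<Sum>l\<in>UNIV. \<Gamma> a i j l (\<gamma> t) * x' i t * x' j t * cf a l (\<gamma> t) f) - k * f (\<gamma> t) * (gm a i j (\<gamma> t) * x' i t * x' j t))"
      unfolding H by (simp add: sum_distrib_left sum_distrib_right algebra_simps)
    also have "\<dots> = (\<Sum>i\<in>UNIV. \<Sum>j\<in>UNIV. (\<Sum>l\<in>UNIV. \<Gamma> a i j l (\<gamma> t) * x' i t * x' j t * cf a l (\<gamma> t) f) - k * f (\<gamma> t) * (gm a i j (\<gamma> t) * x' i t * x' j t))"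
      by (rule sum.swap)
    also have "\<dots> = (\<Sum>i\<in>UNIV. \<Sum>j\<in>UNIV. \<Sum>l\<in>UNIV. \<Gamma> a i j l (\<gamma> t) * x' i t * x' j t * cf a l (\<gamma> t) f)
        - k * f (\<gamma> t) * (\<Sum>i\<in>UNIV. \<Sum>j\<in>UNIV. gm a i j (\<gamma> t) * x' i t * x' j t)"
      by (simp add: sum_subtractf sum_distrib_left)
    also have "(\<Sum>i\<in>UNIV. \<Sum>j\<in>UNIV. \<Sum>l\<in>UNIV. \<Gamma> a i j l (\<gamma> t) * x' i t * x' j t * cf a l (\<gamma> t) f) =
       (\<Sum>i\<in>UNIV. \<Sum>l\<in>UNIV. \<Sum>j\<in>UNIV. \<Gamma> a i j l (\<gamma> t) * x' i t * x' j t * cf a l (\<gamma> t) f)"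
      by (intro sum.cong refl sum.swap)
    also have "\<dots> = (\<Sum>l\<in>UNIV. \<Sum>i\<in>UNIV. \<Sum>j\<in>UNIV. \<Gamma> a i j l (\<gamma> t) * x' i t * x' j t * cf a l (\<gamma> t) f)"
      by (rule sum.swap)
    also have "\<dots> = (\<Sum>l\<in>UNIV. (\<Sum>i\<in>UNIV. \<Sum>j\<in>UNIV. \<Gamma> a i j l (\<gamma> t) * x' i t * x' j t) * cf a l (\<gamma> t) f)"
      by (simp add: sum_distrib_right)
    finally have E: "(\<Sum>j\<in>UNIV. (\<Sum>i\<in>UNIV. x' i t * cf a i (\<gamma> t) (\<lambda>q. cf a j q f)) * x' j t) =
      (\<Sum>l\<in>UNIV. (\<Sum>i\<in>UNIV. \<Sum>j\<in>UNIV. \<Gamma> a i j l (\<gamma> t) * x' i t * x' j t) * cf a l (\<gamma> t) f)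
        - k * f (\<gamma> t) * (\<Sum>i\<in>UNIV. \<Sum>j\<in>UNIV. gm a i j (\<gamma> t) * x' i t * x' j t)" .
    show ?thesis unfolding sum.distrib E distrib_right by (simp only: mult_ac add_diff_eq)
  qed
  finally show "((\<lambda>s. \<Sum>i\<in>UNIV. x' i s * cf a i (\<gamma> s) f) has_real_derivative
       (\<Sum>l\<in>UNIV. (deriv (x' l) t + (\<Sum>i\<in>UNIV. \<Sum>j\<in>UNIV. \<Gamma> a i j l (\<gamma> t) * x' i t * x' j t)) * cf a l (\<gamma> t) f)
       - k * (\<Sum>i\<in>UNIV. \<Sum>j\<in>UNIV. gm a i j (\<gamma> t) * x' i t * x' j t) * f (\<gamma> t)) (at t)" .
qed

end

section \<open>Projective coordinates\<close>

text \<open>The left-hand side is the metric expression for - (1/\<alpha>) log e, where pi, pj, pij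
  are partial derivatives of a function e, in the shape that the differentiation rules deliver. The
  factor e pij - 2 pi pj is - e^3 times the Hessian of 1/e.\<close>

lemma log_hessian_algebra:
  fixes e pi pj pij \<alpha> :: real
  assumes "e \<noteq> 0" "\<alpha> \<noteq> 0"
  shows "- (1 / \<alpha>) * (pj * - (inverse e * pi * inverse e) + pij * inverse e)
      + \<alpha> * (- (1 / \<alpha>) * (pi * inverse e)) * (- (1 / \<alpha>) * (pj * inverse e))
    = - (1 / \<alpha>) * (e * pij - 2 * pi * pj) * (inverse e)\<^sup>2"
  using assms by (simp add: field_simps power2_eq_square)

text \<open>The Hessian of s/e for constant \<open>s\<close>, as the product rule leaves it; the
  same factor appears as for the logarithm.\<close>

lemma inverse_hessian_algebra:
  fixes e pi pj pij s :: real
  assumes "e \<noteq> 0"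
  shows "s * - ((inverse e * pj) * - (inverse e * pi * inverse e)
      + (inverse e * pij + - (inverse e * pi * inverse e) * pj) * inverse e)
    = - s * (inverse e)^3 * (e * pij - 2 * pi * pj)"
  using assms by (simp add: field_simps power3_eq_cube)

context rconn
begin

lemma gm_nonneg:
  assumes c: "cs c" and q: "q \<in> fst c"
  shows "(\<Sum>i\<in>UNIV. \<Sum>j\<in>UNIV. v $ i * v $ j * gm c i j q) \<ge> 0"
proof -
  note T = coord_field_tangent[OF c q] and P = cs_topspace[OF c q]
  define w where "w = (\<lambda>f. \<Sum>i\<in>UNIV. v $ i * cf c i q f)"
  have w: "w \<in> tsp q" unfolding w_def by (rule tangent_sum_in[OF finite T T])
  have "g q w w = (\<Sum>i\<in>UNIV. \<Sum>j\<in>UNIV. v $ i * v $ j * gm c i j q)"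
    unfolding w_def metric_coeff_def by (rule g_sum2[OF P finite finite T T T])
  moreover have "g q w w \<ge> 0"
  proof (cases "w = (\<lambda>f. 0)")
    case True
    then show ?thesis using g_lincomb[OF P w w w, of 0 0] by simp
  next
    case False
    then show ?thesis using g_pos[OF P w] by simp
  qed
  ultimately show ?thesis by simp
qed

section \<open>Coordinates given by ratios of solutions\<close>

context
  fixes c :: "('m, 'd) chart" and f0 :: "'m \<Rightarrow> real" and f :: "'d \<Rightarrow> 'm \<Rightarrow> real" and k :: real
  assumes c: "cs c" and f0: "sfun (fst c) f0" "hess_eq k (fst c) f0" and f: "\<And>l. sfun (fst c) (f l)" "\<And>l. hess_eq k (fst c) (f l)"
    and pos: "\<And>q. q \<in> fst c \<Longrightarrow> f0 q > 0" and ratio: "\<And>q l. q \<in> fst c \<Longrightarrow> f l q = snd c q $ l * f0 q"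
begin

text \<open>In the coordinates \<open>f\<^sub>l / f\<^sub>0\<close> the Christoffel symbols are those of a connection projectively
  equivalent to the flat one: \<open>f\<^sub>0 \<Gamma>\<^sub>i\<^sub>j\<^sup>l = \<delta>\<^sub>i\<^sup>l \<partial>\<^sub>j f\<^sub>0 + \<delta>\<^sub>j\<^sup>l \<partial>\<^sub>i f\<^sub>0\<close>.\<close>

lemma christoffel_projective:
  assumes q: "q \<in> fst c"
  shows "f0 q * \<Gamma> c i j l q = cf c j q f0 * (if l = i then 1 else 0) + cf c i q f0 * (if l = j then 1 else 0)"
proof -
  let ?x = "\<lambda>q. snd c q $ l"
  note sn = smooth_nearI[OF _ q]
  have T: "cf c m q' \<in> tsp q'" if "q' \<in> fst c" for m q' by (rule coord_field_tangent[OF c that])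
  have 1: "cf c m q' (f l) = ?x q' * cf c m q' f0 + f0 q' * (if l = m then 1 else 0)" if q': "q' \<in> fst c" for q' m
  proof -
    have "cf c m q' (f l) = cf c m q' (\<lambda>q. ?x q * f0 q)"
      by (rule tangent_cong[OF T[OF q'] cs_open[OF c] q' ratio])
    also have "\<dots> = ?x q' * cf c m q' f0 + f0 q' * cf c m q' ?x"
      by (rule tangent_mult[OF T[OF q'] smooth_nearI[OF sfun_coord[OF c] q'] smooth_nearI[OF f0(1) q']])
    finally show ?thesis by (simp only: coord_field_coord[OF c q'])
  qed
  have s0: "sfun (fst c) (\<lambda>q. cf c j q f0)" by (rule cf_sfun[OF c order_refl f0(1)])
  \<comment> \<open>The second derivative of f_l = x_l f_0 is computed twice, by the product rule
    and by the Hessian equation. The second derivatives of f_0, and with them the metric terms,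
    cancel since both functions solve the same equation.\<close>
  have "cf c i q (\<lambda>q. cf c j q (f l)) = cf c i q (\<lambda>q. ?x q * cf c j q f0 + f0 q * (if l = j then 1 else 0))"
    by (rule tangent_cong[OF T[OF q] cs_open[OF c] q 1])
  also have "\<dots> = cf c i q (\<lambda>q. ?x q * cf c j q f0) + cf c i q (\<lambda>q. f0 q * (if l = j then 1 else 0))"
    by (intro tangent_add[OF T[OF q]] sn sfun_mult sfun_coord[OF c] s0 f0(1) sfun_const[OF cs_open[OF c]])
  also have "cf c i q (\<lambda>q. ?x q * cf c j q f0) = ?x q * cf c i q (\<lambda>q. cf c j q f0) + cf c j q f0 * cf c i q ?x"
    by (rule tangent_mult[OF T[OF q] sn[OF sfun_coord[OF c]] sn[OF s0]])
  also have "cf c i q (\<lambda>q. f0 q * (if l = j then 1 else 0)) = f0 q * cf c i q (\<lambda>q. if l = j then 1 else 0) + (if l = j then 1 else 0) * cf c i q f0"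
    by (rule tangent_mult[OF T[OF q] sn[OF f0(1)] sn[OF sfun_const[OF cs_open[OF c]]]])
  finally have L: "cf c i q (\<lambda>q. cf c j q (f l)) = ?x q * cf c i q (\<lambda>q. cf c j q f0)
      + cf c j q f0 * (if l = i then 1 else 0) + cf c i q f0 * (if l = j then 1 else 0)"
    unfolding tangent_const[OF T[OF q]] coord_field_coord[OF c q] by simp
  have d: "(\<Sum>m\<in>UNIV. \<Gamma> c i j m q * (f0 q * (if l = m then 1 else 0))) = \<Gamma> c i j l q * f0 q"
    using sum_delta_right[of "\<lambda>m. \<Gamma> c i j m q * f0 q" l] by (simp only: mult.assoc)
  have "cf c i q (\<lambda>q. cf c j q (f l)) = (\<Sum>m\<in>UNIV. \<Gamma> c i j m q * cf c m q (f l)) - k * gm c i j q * f l q"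
    by (rule hess_eq_cf[OF f(2) cs_open[OF c] c q q])
  also have "\<dots> = ?x q * (\<Sum>m\<in>UNIV. \<Gamma> c i j m q * cf c m q f0) + \<Gamma> c i j l q * f0 q - k * gm c i j q * (?x q * f0 q)"
    unfolding 1[OF q] ratio[OF q] distrib_left sum.distrib d by (simp add: sum_distrib_left ac_simps)
  also have "\<dots> = ?x q * cf c i q (\<lambda>q. cf c j q f0) + \<Gamma> c i j l q * f0 q"
    unfolding hess_eq_cf[OF f0(2) cs_open[OF c] c q q] by (simp add: algebra_simps)
  finally show ?thesis using L by (simp add: mult.commute)
qed

text \<open>Multiplication by \<open>f0\<close> lets \<open>christoffel_projective\<close> remove
  the Christoffel symbols from the Hessian equation of \<open>f0\<close>; only ordinary derivatives
  and the metric remain.\<close>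

lemma hess_f0:
  assumes q: "q \<in> fst c"
  shows "f0 q * cf c i q (\<lambda>q. cf c j q f0) = 2 * cf c i q f0 * cf c j q f0 - k * gm c i j q * (f0 q)\<^sup>2"
proof -
  have "(\<Sum>l\<in>UNIV. f0 q * \<Gamma> c i j l q * cf c l q f0) =
      (\<Sum>l\<in>UNIV. (if l = i then cf c j q f0 * cf c l q f0 else 0) + (if l = j then cf c i q f0 * cf c l q f0 else 0))"
    unfolding christoffel_projective[OF q] by (intro sum.cong) auto
  also have "\<dots> = 2 * cf c i q f0 * cf c j q f0" by (simp add: sum.distrib)
  finally have "f0 q * (\<Sum>l\<in>UNIV. \<Gamma> c i j l q * cf c l q f0) = 2 * cf c i q f0 * cf c j q f0"
    by (simp add: sum_distrib_left mult.assoc)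
  then show ?thesis
    unfolding hess_eq_cf[OF f0(2) cs_open[OF c] c q q] right_diff_distrib by (simp add: power2_eq_square)
qed

definition coord_repr :: "real^'d \<Rightarrow> real" where "coord_repr = f0 \<circ> param c"

lemma coord_repr_smooth: "smooth_on (snd c ` fst c) coord_repr"
  unfolding coord_repr_def using sfun_cs[OF f0(1) c] by simp

lemma image_open: "open (snd c ` fst c)"
  by (rule is_chart_open_image[OF cs_chart[OF c]])

lemma coord_repr_pos: "y \<in> snd c ` fst c \<Longrightarrow> coord_repr y > 0"
  unfolding coord_repr_def using pos[OF param_in] by simp

lemma coord_repr_at: "q \<in> fst c \<Longrightarrow> coord_repr (snd c q) = f0 q"
  by (simp add: coord_repr_def param_snd[OF cs_chart[OF c]])

lemma coord_repr_pderiv: "q \<in> fst c \<Longrightarrow> pderiv_at j coord_repr (snd c q) = cf c j q f0"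
  unfolding coord_repr_def by (rule coord_field_pderiv[OF smooth_nearI[OF f0(1)], symmetric])

lemma coord_repr_pderiv2:
  assumes q: "q \<in> fst c"
  shows "pderiv_at i (pderiv_at j coord_repr) (snd c q) = cf c i q (\<lambda>q. cf c j q f0)"
proof -
  have "pderiv_at i (pderiv_at j coord_repr) (snd c q) = pderiv_at i ((\<lambda>q. cf c j q f0) \<circ> param c) (snd c q)"
    by (rule pderiv_at_cong[OF image_open])
      (use q in \<open>auto simp: coord_repr_pderiv param_snd[OF cs_chart[OF c]]\<close>)
  also have "\<dots> = cf c i q (\<lambda>q. cf c j q f0)"
    by (rule coord_field_pderiv[OF smooth_nearI[OF cf_sfun[OF c order_refl f0(1)] q], symmetric])
  finally show ?thesis .
qed

lemma coord_repr_hess: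
  assumes q: "q \<in> fst c"
  shows "coord_repr (snd c q) * pderiv_at i (pderiv_at j coord_repr) (snd c q) =
    2 * pderiv_at i coord_repr (snd c q) * pderiv_at j coord_repr (snd c q) - k * gm c i j q * (coord_repr (snd c q))\<^sup>2"
  unfolding coord_repr_pderiv2[OF q] coord_repr_pderiv[OF q] coord_repr_at[OF q] by (rule hess_f0[OF q])

lemma coord_repr_der: "y \<in> snd c ` fst c \<Longrightarrow> (coord_repr has_derivative frechet_derivative coord_repr (at y)) (at y)"
  by (rule smooth_on_has_derivative[OF coord_repr_smooth])

lemma coord_repr_der2: "y \<in> snd c ` fst c \<Longrightarrow>
    (pderiv_at j coord_repr has_derivative frechet_derivative (pderiv_at j coord_repr) (at y)) (at y)"
  by (rule smooth_on_has_derivative[OF smooth_on_pderiv[OF coord_repr_smooth]])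

text \<open>For E = e^(\<alpha>\<phi>) the left-hand side is E_ij / (\<alpha> E). Here E is the
  reciprocal of \<open>coord_repr\<close>, so its Hessian, and hence the metric, appears up to a
  constant factor.\<close>

lemma log_metric:
  assumes \<alpha>: "\<alpha> \<noteq> 0" and q: "q \<in> fst c"
  defines "\<phi> \<equiv> \<lambda>y. - (1 / \<alpha>) * ln (coord_repr y)"
  shows "pderiv_at i (pderiv_at j \<phi>) (snd c q) + \<alpha> * pderiv_at i \<phi> (snd c q) * pderiv_at j \<phi> (snd c q)
    = k / \<alpha> * gm c i j q"
proof -
  have 1: "pderiv_at j \<phi> y = - (1 / \<alpha>) * (pderiv_at j coord_repr y * inverse (coord_repr y))" if y: "y \<in> snd c ` fst c" for j y
  proof -
    have "(\<phi> has_derivative (\<lambda>v. - (1 / \<alpha>) * (frechet_derivative coord_repr (at y) v * inverse (coord_repr y)))) (at y)"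
      unfolding \<phi>_def using has_derivative_ln[OF coord_repr_pos[OF y] coord_repr_der[OF y]]
      by (intro has_derivative_mult_right) (simp add: divide_inverse)
    from pderiv_atI[OF this] show ?thesis by (simp add: pderiv_at_def)
  qed
  let ?y = "snd c q"
  have y: "?y \<in> snd c ` fst c" using q by blast
  have nz: "coord_repr ?y \<noteq> 0" using coord_repr_pos[OF y] by simp
  have "pderiv_at i (pderiv_at j \<phi>) ?y = pderiv_at i (\<lambda>y. - (1 / \<alpha>) * (pderiv_at j coord_repr y * inverse (coord_repr y))) ?y"
    by (rule pderiv_at_cong[OF image_open y 1])
  also have "\<dots> = - (1 / \<alpha>) * (pderiv_at j coord_repr ?y * - (inverse (coord_repr ?y) * pderiv_at i coord_repr ?y * inverse (coord_repr ?y))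
      + pderiv_at i (pderiv_at j coord_repr) ?y * inverse (coord_repr ?y))"
    using pderiv_atI[OF has_derivative_mult_right[OF has_derivative_mult[OF coord_repr_der2[OF y] Deriv.has_derivative_inverse[where f = coord_repr, OF nz coord_repr_der[OF y]]]]]
    unfolding pderiv_at_def by blast
  finally have 2: "pderiv_at i (pderiv_at j \<phi>) ?y = - (1 / \<alpha>) * (pderiv_at j coord_repr ?y * - (inverse (coord_repr ?y) * pderiv_at i coord_repr ?y * inverse (coord_repr ?y))
      + pderiv_at i (pderiv_at j coord_repr) ?y * inverse (coord_repr ?y))" .
  have "- (1 / \<alpha>) * - (k * G * e\<^sup>2) * (inverse e)\<^sup>2 = k / \<alpha> * G" if "e \<noteq> 0" for e G :: real
    using that by (simp add: field_simps power2_eq_square)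
  from this[OF nz, of "gm c i j q"] show ?thesis
    unfolding 2 1[OF y] log_hessian_algebra[OF nz \<alpha>] unfolding coord_repr_hess[OF q] by simp
qed

text \<open>The Hessian of s / f_0 is (s k / f_0) g, which is semidefinite because g is. The factor
  \<open>s\<close>, of the sign of \<open>k\<close>, treats the convex and the concave case at
  once.\<close>

lemma convex_inverse_coord_repr:
  assumes N: "open N" "convex N" "N \<subseteq> snd c ` fst c" and s: "s * k \<ge> 0"
  shows "convex_on N (\<lambda>y. s * inverse (coord_repr y))"
proof (rule convex_on_hessian[OF N(1,2)])
  have nz: "coord_repr y \<noteq> 0" if "y \<in> snd c ` fst c" for y using coord_repr_pos[OF that] by simp
  show "smooth_on N (\<lambda>y. s * inverse (coord_repr y))"
    by (rule smooth_on_subset[OF _ N(3)]) (intro smooth_on_mult image_open smooth_on_const smooth_on_inverse coord_repr_smooth nz)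
  fix x v assume x: "x \<in> N"
  then have xi: "x \<in> snd c ` fst c" using N(3) by blast
  then obtain q where q: "q \<in> fst c" "x = snd c q" by blast
  have 1: "pderiv_at j (\<lambda>y. s * inverse (coord_repr y)) y = s * - (inverse (coord_repr y) * pderiv_at j coord_repr y * inverse (coord_repr y))"
    if y: "y \<in> snd c ` fst c" for j y
    using pderiv_atI[OF has_derivative_mult_right[OF Deriv.has_derivative_inverse[where f = coord_repr, OF nz[OF y] coord_repr_der[OF y]]]]
    unfolding pderiv_at_def by blast
  have 2: "pderiv_at i (pderiv_at j (\<lambda>y. s * inverse (coord_repr y))) x = s * k * inverse (coord_repr x) * gm c i j q" for i j
  proof -
    have "pderiv_at i (pderiv_at j (\<lambda>y. s * inverse (coord_repr y))) x
        = pderiv_at i (\<lambda>y. s * - (inverse (coord_repr y) * pderiv_at j coord_repr y * inverse (coord_repr y))) x"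
      by (rule pderiv_at_cong[OF image_open xi 1])
    also have "\<dots> = s * - ((inverse (coord_repr x) * pderiv_at j coord_repr x) * - (inverse (coord_repr x) * pderiv_at i coord_repr x * inverse (coord_repr x))
      + (inverse (coord_repr x) * pderiv_at i (pderiv_at j coord_repr) x + - (inverse (coord_repr x) * pderiv_at i coord_repr x * inverse (coord_repr x)) * pderiv_at j coord_repr x) * inverse (coord_repr x))"
    proof -
      note I = Deriv.has_derivative_inverse[where f = coord_repr, OF nz[OF xi] coord_repr_der[OF xi]]
      from pderiv_atI[OF has_derivative_mult_right[OF has_derivative_minus[OF has_derivative_mult[OF has_derivative_mult[OF I coord_repr_der2[OF xi]] I]]]]
      show ?thesis unfolding pderiv_at_def by blast
    qed
    also have "\<dots> = - s * (inverse (coord_repr x))^3 * (coord_repr x * pderiv_at i (pderiv_at j coord_repr) x - 2 * pderiv_at i coord_repr x * pderiv_at j coord_repr x)"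
      by (rule inverse_hessian_algebra[OF nz[OF xi]])
    also have "\<dots> = s * k * inverse (coord_repr x) * gm c i j q"
    proof -
      have "- s * (inverse e)^3 * (2 * a * b - k * G * e\<^sup>2 - 2 * a * b) = s * k * inverse e * G" if "e \<noteq> 0" for e G a b :: real
        using that by (simp add: field_simps power3_eq_cube power2_eq_square)
      then show ?thesis unfolding q(2) coord_repr_hess[OF q(1)] using nz[OF xi] unfolding q(2) by blast
    qed
    finally show ?thesis .
  qed
  have "(\<Sum>i\<in>UNIV. \<Sum>j\<in>UNIV. v $ i * v $ j * pderiv_at i (pderiv_at j (\<lambda>y. s * inverse (coord_repr y))) x) =
      s * k * inverse (coord_repr x) * (\<Sum>i\<in>UNIV. \<Sum>j\<in>UNIV. v $ i * v $ j * gm c i j q)"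
    unfolding 2 by (simp add: sum_distrib_left ac_simps)
  also have "\<dots> \<ge> 0"
    using coord_repr_pos[OF xi] by (intro mult_nonneg_nonneg[OF mult_nonneg_nonneg[OF s] gm_nonneg[OF c q(1)]]) simp
  finally show "(\<Sum>i\<in>UNIV. \<Sum>j\<in>UNIV. v $ i * v $ j * pderiv_at i (pderiv_at j (\<lambda>y. s * inverse (coord_repr y))) x) \<ge> 0" .
qed

text \<open>The geodesic equation is stated in atlas charts; as the domain of \<open>c\<close> lies
  in a single one, \<open>a\<close>, all derivatives along the curve are taken in
  \<open>a\<close>.\<close>

lemma geodesic_imp_straight:
  assumes a: "a \<in> A" "fst c \<subseteq> fst a" and geo: "geodesic M A D I \<gamma>" and sub: "\<gamma> ` I \<subseteq> fst c"
  shows "\<exists>b v s. smooth_on I s \<and> (\<forall>t\<in>I. deriv s t > 0) \<and> (\<forall>t\<in>I. snd c (\<gamma> t) = b + s t *\<^sub>R v)"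
proof -
  note ca = atlas_cs[OF a(1)]
  have I: "open I" "is_interval I" using geo by (simp_all add: geodesic_def)
  have Ia: "{t \<in> I. \<gamma> t \<in> fst a} = I" using sub a(2) by auto
  note G = geo[unfolded geodesic_def, THEN conjunct2, THEN conjunct2, THEN conjunct2, THEN bspec, OF a(1)]
  have x: "smooth_on I (\<lambda>t. snd a (\<gamma> t))" using G[THEN conjunct1] unfolding Ia .
  define x' where "x' i = deriv (\<lambda>s. snd a (\<gamma> s) $ i)" for i
  have Z: "deriv (x' l) t + (\<Sum>i\<in>UNIV. \<Sum>j\<in>UNIV. \<Gamma> a i j l (\<gamma> t) * x' i t * x' j t) = 0" if t: "t \<in> I" for t l
  proof -
    have "\<gamma> t \<in> fst a" using t Ia by blast
    from G[THEN conjunct2, THEN bspec, OF t, THEN mp, OF this, THEN spec, of l] show ?thesis unfolding x'_def .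
  qed
  have \<gamma>: "\<gamma> t \<in> fst c" if "t \<in> I" for t using sub that by blast
  define Q where "Q t = (\<Sum>i\<in>UNIV. \<Sum>j\<in>UNIV. gm a i j (\<gamma> t) * x' i t * x' j t)" for t
  define y' where "y' h t = (\<Sum>i\<in>UNIV. x' i t * cf a i (\<gamma> t) h)" for h t
  have y: "((\<lambda>s. h (\<gamma> s)) has_real_derivative y' h t) (at t)" "(y' h has_real_derivative - k * Q t * h (\<gamma> t)) (at t)"
    if h: "sfun (fst c) h" "hess_eq k (fst c) h" and t: "t \<in> I" for h t
    using curve_hess[OF ca I(1) x cs_open[OF c] a(2) \<gamma> h t] unfolding x'_def[symmetric] Z[OF t]
    unfolding y'_def[symmetric] Q_def[symmetric] by simp_all
  note y0 = y[OF f0] and yl = y[OF f]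
  have p0: "f0 (\<gamma> t) > 0" if "t \<in> I" for t using pos[OF \<gamma>[OF that]] .
  have "continuous_on I (\<lambda>t. inverse ((f0 (\<gamma> t))\<^sup>2))"
    using y0(1) p0 by (intro continuous_intros continuous_at_imp_continuous_on ballI) (auto intro: DERIV_isCont dest: p0)
  \<comment> \<open>The new parameter is a primitive of 1 / f_0^2, the factor by which the
    derivative of f_l / f_0 differs from the constant Wronskian. It is strictly increasing even for
    a constant geodesic, where the direction \<open>w\<close> vanishes.\<close>
  then obtain s where s: "\<And>t. t \<in> I \<Longrightarrow> (s has_real_derivative inverse ((f0 (\<gamma> t))\<^sup>2)) (at t)"
    using open_interval_antiderivative[OF I] by blast
  have conv: "convex I" using I(2) is_interval_convex by blast
  have "\<exists>w. \<forall>t\<in>I. f0 (\<gamma> t) * y' (f l) t - f l (\<gamma> t) * y' f0 t = w" for l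
  proof (rule has_field_derivative_zero_constant[OF conv])
    fix t assume t: "t \<in> I"
    have "((\<lambda>t. f0 (\<gamma> t) * y' (f l) t - f l (\<gamma> t) * y' f0 t) has_real_derivative
        (y' f0 t * y' (f l) t + (- k * Q t * f l (\<gamma> t)) * f0 (\<gamma> t)) - (y' (f l) t * y' f0 t + (- k * Q t * f0 (\<gamma> t)) * f l (\<gamma> t))) (at t)"
      by (intro DERIV_diff DERIV_mult y0 yl t)
    then show "((\<lambda>t. f0 (\<gamma> t) * y' (f l) t - f l (\<gamma> t) * y' f0 t) has_real_derivative 0) (at t within I)"
      by (simp add: algebra_simps has_field_derivative_at_within)
  qed
  then obtain w where w: "\<And>l t. t \<in> I \<Longrightarrow> f0 (\<gamma> t) * y' (f l) t - f l (\<gamma> t) * y' f0 t = w l" by metis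
  have "\<exists>b. \<forall>t\<in>I. f l (\<gamma> t) / f0 (\<gamma> t) - s t * w l = b" for l
  proof (rule has_field_derivative_zero_constant[OF conv])
    fix t assume t: "t \<in> I"
    have nz: "f0 (\<gamma> t) \<noteq> 0" using p0[OF t] by simp
    have "((\<lambda>t. f l (\<gamma> t) / f0 (\<gamma> t) - s t * w l) has_real_derivative
        (y' (f l) t * f0 (\<gamma> t) - f l (\<gamma> t) * y' f0 t) / (f0 (\<gamma> t) * f0 (\<gamma> t)) - inverse ((f0 (\<gamma> t))\<^sup>2) * w l) (at t)"
      by (intro DERIV_diff DERIV_divide DERIV_cmult_right y0 yl s t nz)
    then show "((\<lambda>t. f l (\<gamma> t) / f0 (\<gamma> t) - s t * w l) has_real_derivative 0) (at t within I)"
      using w[OF t, of l] nz by (simp add: mult.commute divide_inverse power2_eq_square has_field_derivative_at_within)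
  qed
  then obtain b where b: "\<And>l t. t \<in> I \<Longrightarrow> f l (\<gamma> t) / f0 (\<gamma> t) - s t * w l = b l" by metis
  have line: "snd c (\<gamma> t) = (\<chi> l. b l) + s t *\<^sub>R (\<chi> l. w l)" if t: "t \<in> I" for t
  proof -
    have "snd c (\<gamma> t) $ l = b l + s t * w l" for l
      using b[OF t, of l] ratio[OF \<gamma>[OF t], of l] p0[OF t] by simp
    then show ?thesis by (simp add: vec_eq_iff)
  qed
  have ds: "deriv s t > 0" if "t \<in> I" for t
    using DERIV_imp_deriv[OF s[OF that]] p0[OF that] by simp
  have "smooth_on I (\<lambda>t. f0 (\<gamma> t))"
  proof -
    have "smooth_on I (\<lambda>t. (f0 \<circ> param a) (snd a (\<gamma> t)))"
    proof (rule smooth_on_compose[OF I(1) _ _ x])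
      show "smooth_on (snd a ` (fst c \<inter> fst a)) (f0 \<circ> param a)" by (rule sfun_cs[OF f0(1) ca])
      show "snd a (\<gamma> t) \<in> snd a ` (fst c \<inter> fst a)" if "t \<in> I" for t using \<gamma>[OF that] a(2) by blast
    qed
    moreover have "(f0 \<circ> param a) (snd a (\<gamma> t)) = f0 (\<gamma> t)" if "t \<in> I" for t
      using param_snd[OF cs_chart[OF ca] subsetD[OF a(2) \<gamma>[OF that]]] by simp
    ultimately show ?thesis
      using smooth_on_cong[OF I(1), of "\<lambda>t. (f0 \<circ> param a) (snd a (\<gamma> t))" "\<lambda>t. f0 (\<gamma> t)"] by blast
  qed
  then have sm: "smooth_on I (\<lambda>t. inverse (f0 (\<gamma> t) * f0 (\<gamma> t)))"
    using p0 by (intro smooth_on_inverse smooth_on_mult I(1)) (auto dest: p0)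
  have "smooth_on I s"
  proof (rule smooth_on_bootstrap[OF I(1)])
    show "(s has_derivative (\<lambda>h. inverse (f0 (\<gamma> t) * f0 (\<gamma> t)) * h)) (at t)" if "t \<in> I" for t
      using s[OF that] by (simp add: has_field_derivative_def power2_eq_square)
    fix n v
    have "smooth_on I (\<lambda>t. inverse (f0 (\<gamma> t) * f0 (\<gamma> t)) * v)"
      by (rule smooth_on_mult[OF I(1) sm smooth_on_const])
    then show "C_on n (\<lambda>t. inverse (f0 (\<gamma> t) * f0 (\<gamma> t)) * v) I" by (simp add: smooth_on_def)
  qed
  then show ?thesis using ds line by blast
qed

text \<open>The parameter change solves s' = 1 / f_0^2 along the line, which makes the Wronskians of
  f_l and f_0 constant. Comparing second derivatives then shows that the covariant acceleration
  annihilates every coordinate function, hence is zero.\<close>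

lemma straight_imp_geodesic:
  assumes J: "open J" "is_interval J" and line: "\<And>r. r \<in> J \<Longrightarrow> b + r *\<^sub>R v \<in> snd c ` fst c"
  shows "\<exists>I s. smooth_on I s \<and> (\<forall>t\<in>I. deriv s t > 0) \<and> s ` I = J \<and> geodesic M A D I (\<lambda>t. param c (b + s t *\<^sub>R v))"
proof -
  note cc = cs_chart[OF c]
  have lin: "smooth_on J (\<lambda>r. b + r *\<^sub>R v)"
    by (intro smooth_on_add smooth_on_scaleR smooth_on_const smooth_on_ident J)
  have Es: "smooth_on J (\<lambda>r. coord_repr (b + r *\<^sub>R v))"
    by (rule smooth_on_compose[OF J(1) line coord_repr_smooth lin])
  have "smooth_on J (\<lambda>r. coord_repr (b + r *\<^sub>R v) * coord_repr (b + r *\<^sub>R v))" by (rule smooth_on_mult[OF J(1) Es Es])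
  moreover have "coord_repr (b + r *\<^sub>R v) * coord_repr (b + r *\<^sub>R v) > 0" if "r \<in> J" for r using coord_repr_pos[OF line[OF that]] by simp
  ultimately obtain I s where I: "open I" "is_interval I" and img: "s ` I = J" and s: "smooth_on I s"
    and ds: "\<And>t. t \<in> I \<Longrightarrow> (s has_real_derivative inverse (coord_repr (b + s t *\<^sub>R v) * coord_repr (b + s t *\<^sub>R v))) (at t)"
    using autonomous_ode_solution[OF J, of "\<lambda>r. coord_repr (b + r *\<^sub>R v) * coord_repr (b + r *\<^sub>R v)"] by blast
  have sJ: "s t \<in> J" if "t \<in> I" for t using img that by blast
  define X where "X t = b + s t *\<^sub>R v" for t
  define \<gamma> where "\<gamma> t = param c (X t)" for t
  have X: "X t \<in> snd c ` fst c" if "t \<in> I" for t unfolding X_def by (rule line[OF sJ[OF that]])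
  have \<gamma>: "\<gamma> t \<in> fst c" "snd c (\<gamma> t) = X t" if "t \<in> I" for t
    unfolding \<gamma>_def using param_in[OF X[OF that]] snd_param[OF X[OF that]] by simp_all
  have Xs: "smooth_on I X" unfolding X_def[abs_def]
    by (intro smooth_on_add smooth_on_scaleR smooth_on_const s I)
  have cm: "continuous_map (top_of_set I) M \<gamma>"
  proof -
    have "continuous_map (top_of_set I) (top_of_set (snd c ` fst c)) X"
      using smooth_on_continuous[OF Xs] X by (simp add: image_subset_iff_funcset[symmetric] image_subset_iff)
    from continuous_map_compose[OF this continuous_map_param[OF cc]]
    show ?thesis unfolding \<gamma>_def[abs_def] comp_def .
  qed
  have "geodesic M A D I \<gamma>"
    unfolding geodesic_def
  proof (intro conjI ballI I cm impI allI)
    fix a assume a: "a \<in> A"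
    note ca = atlas_cs[OF a]
    define W where "W = fst c \<inter> fst a"
    have W: "openin M W" "W \<subseteq> fst a" "W \<subseteq> fst c"
      unfolding W_def using is_chart_openin[OF cc] is_chart_openin[OF cs_chart[OF ca]] by auto
    \<comment> \<open>The geodesic equation is required in every atlas chart, at the times when the
      curve lies in it.\<close>
    define S where "S = {t \<in> I. \<gamma> t \<in> fst a}"
    have "S = I \<inter> X -` (snd c ` W)"
    proof (intro equalityI subsetI)
      fix t assume "t \<in> S"
      then have t: "t \<in> I" "\<gamma> t \<in> W" using \<gamma>(1) by (auto simp: S_def W_def)
      have "snd c (\<gamma> t) \<in> snd c ` W" by (rule imageI[OF t(2)])
      then show "t \<in> I \<inter> X -` (snd c ` W)" using t(1) \<gamma>(2)[OF t(1)] by simp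
    next
      fix t assume t: "t \<in> I \<inter> X -` (snd c ` W)"
      then have "\<gamma> t \<in> W" unfolding \<gamma>_def using param_in'[OF cc W(3)] by blast
      then show "t \<in> S" using t by (simp add: S_def W_def)
    qed
    moreover have "open (snd c ` W)" by (rule is_chart_image_open[OF cc W(1,3)])
    ultimately have S: "open S"
      using continuous_open_preimage[OF smooth_on_continuous[OF Xs] I(1)] by simp
    have SI: "S \<subseteq> I" by (auto simp: S_def)
    have \<gamma>W: "\<gamma> t \<in> W" if "t \<in> S" for t using that \<gamma>(1) by (auto simp: S_def W_def)
    have x: "smooth_on S (\<lambda>t. snd a (\<gamma> t))"
    proof -
      have "smooth_on S (\<lambda>t. (snd a \<circ> param c) (X t))"
      proof (rule smooth_on_compose[OF S _ transition_smooth(1)[OF c a] smooth_on_subset[OF Xs SI]])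
        fix t assume t: "t \<in> S"
        have "snd c (\<gamma> t) \<in> snd c ` W" by (rule imageI[OF \<gamma>W[OF t]])
        then show "X t \<in> snd c ` (fst c \<inter> fst a)" using \<gamma>(2) SI t by (auto simp: W_def)
      qed
      then show ?thesis by (simp add: \<gamma>_def)
    qed
    then show "smooth_on {t \<in> I. \<gamma> t \<in> fst a} (\<lambda>t. snd a (\<gamma> t))" unfolding S_def .
    define x' where "x' i = deriv (\<lambda>s. snd a (\<gamma> s) $ i)" for i
    define Z where "Z l t = deriv (x' l) t + (\<Sum>i\<in>UNIV. \<Sum>j\<in>UNIV. \<Gamma> a i j l (\<gamma> t) * x' i t * x' j t)" for l t
    define Q where "Q t = (\<Sum>i\<in>UNIV. \<Sum>j\<in>UNIV. gm a i j (\<gamma> t) * x' i t * x' j t)" for t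
    define y' where "y' h t = (\<Sum>i\<in>UNIV. x' i t * cf a i (\<gamma> t) h)" for h t
    define u where "u t h = (\<Sum>l\<in>UNIV. Z l t * cf a l (\<gamma> t) h)" for t h
    have y: "((\<lambda>s. h (\<gamma> s)) has_real_derivative y' h t) (at t)"
       "(y' h has_real_derivative u t h - k * Q t * h (\<gamma> t)) (at t)"
      if h: "sfun (fst c) h" "hess_eq k (fst c) h" and t: "t \<in> S" for h t
    proof -
      have h': "sfun W h" "hess_eq k W h"
        using sfun_subset[OF h(1) W(1,3)] h(2) W(3) unfolding hess_eq_def by blast+
      show "((\<lambda>s. h (\<gamma> s)) has_real_derivative y' h t) (at t)"
       "(y' h has_real_derivative u t h - k * Q t * h (\<gamma> t)) (at t)"
        using curve_hess[OF ca S x W(1,2) \<gamma>W h' t] unfolding x'_def[symmetric]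
        unfolding y'_def[symmetric] Q_def[symmetric] Z_def[symmetric] u_def[symmetric] by simp_all
    qed
    note y0 = y[OF f0] and yl = y[OF f]
    fix t l0 assume tI: "t \<in> I" and ta: "\<gamma> t \<in> fst a"
    then have t: "t \<in> S" by (simp add: S_def)
    have E0: "coord_repr (X t) = f0 (\<gamma> t)" for t by (simp add: coord_repr_def \<gamma>_def)
    \<comment> \<open>f_l = X_l f_0 is differentiated twice along the curve; \<open>u t\<close> is
      the covariant acceleration as a tangent vector. The first-order terms cancel because X_l' =
      v_l / f_0^2, and the metric terms cancel because both functions solve the same
      equation.\<close>
    have key: "u t (f l) = X t $ l * u t f0" for l
    proof -
      have fX: "f l (\<gamma> t) = X t $ l * f0 (\<gamma> t)" if "t \<in> I" for t
        using ratio[OF \<gamma>(1)[OF that], of l] \<gamma>(2)[OF that] by simp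
      have p0: "f0 (\<gamma> t) \<noteq> 0" if "t \<in> I" for t using pos[OF \<gamma>(1)[OF that]] by simp
      have dX: "((\<lambda>t. X t $ l) has_real_derivative inverse (f0 (\<gamma> t) * f0 (\<gamma> t)) * v $ l) (at t)" if "t \<in> S" for t
      proof -
        have "(s has_real_derivative inverse (f0 (\<gamma> t) * f0 (\<gamma> t))) (at t)"
          using ds[of t] that SI E0[of t] by (auto simp: X_def)
        then have "((\<lambda>t. b $ l + s t * v $ l) has_real_derivative 0 + inverse (f0 (\<gamma> t) * f0 (\<gamma> t)) * v $ l) (at t)"
          by (intro DERIV_add DERIV_const DERIV_cmult_right)
        then show ?thesis by (simp add: X_def)
      qed
      have ev: "\<forall>\<^sub>F t in nhds t. t \<in> S" by (rule eventually_nhds_in_open[OF S t])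
      have y'l: "y' (f l) t = y' f0 t * X t $ l + v $ l * inverse (f0 (\<gamma> t))" if "t \<in> S" for t
      proof (rule DERIV_unique[OF yl(1)[OF that]])
        have d: "((\<lambda>t. X t $ l * f0 (\<gamma> t)) has_real_derivative inverse (f0 (\<gamma> t) * f0 (\<gamma> t)) * v $ l * f0 (\<gamma> t) + y' f0 t * X t $ l) (at t)"
          by (rule DERIV_mult[OF dX[OF that] y0(1)[OF that]])
        have eq: "inverse (f0 (\<gamma> t) * f0 (\<gamma> t)) * v $ l * f0 (\<gamma> t) + y' f0 t * X t $ l
            = y' f0 t * X t $ l + v $ l * inverse (f0 (\<gamma> t))"
          using p0[OF subsetD[OF SI that]] by (simp add: field_simps)
        have e: "\<forall>\<^sub>F t in nhds t. X t $ l * f0 (\<gamma> t) = f l (\<gamma> t)"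
          using eventually_nhds_in_open[OF S that] by eventually_elim (rule fX[OF subsetD[OF SI], symmetric])
        show "((\<lambda>s. f l (\<gamma> s)) has_real_derivative y' f0 t * X t $ l + v $ l * inverse (f0 (\<gamma> t))) (at t)"
          by (rule DERIV_cong_ev[OF refl e eq, THEN iffD1, OF d])
      qed
      have "u t (f l) - k * Q t * f l (\<gamma> t) = (u t f0 - k * Q t * f0 (\<gamma> t)) * X t $ l"
      proof (rule DERIV_unique[OF yl(2)[OF t]])
        have d: "((\<lambda>t. y' f0 t * X t $ l + v $ l * inverse (f0 (\<gamma> t))) has_real_derivative
           ((u t f0 - k * Q t * f0 (\<gamma> t)) * X t $ l + (inverse (f0 (\<gamma> t) * f0 (\<gamma> t)) * v $ l) * y' f0 t)
           + v $ l * - (inverse (f0 (\<gamma> t)) * y' f0 t * inverse (f0 (\<gamma> t)))) (at t)"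
          by (intro DERIV_add DERIV_mult DERIV_cmult DERIV_inverse' y0 dX t p0 tI)
        have eq: "((u t f0 - k * Q t * f0 (\<gamma> t)) * X t $ l + (inverse (f0 (\<gamma> t) * f0 (\<gamma> t)) * v $ l) * y' f0 t)
           + v $ l * - (inverse (f0 (\<gamma> t)) * y' f0 t * inverse (f0 (\<gamma> t))) = (u t f0 - k * Q t * f0 (\<gamma> t)) * X t $ l"
          by simp
        have e: "\<forall>\<^sub>F t in nhds t. y' f0 t * X t $ l + v $ l * inverse (f0 (\<gamma> t)) = y' (f l) t"
          using ev by eventually_elim (rule y'l[symmetric])
        show "(y' (f l) has_real_derivative (u t f0 - k * Q t * f0 (\<gamma> t)) * X t $ l) (at t)"
          by (rule DERIV_cong_ev[OF refl e eq, THEN iffD1, OF d])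
      qed
      then show ?thesis unfolding fX[OF tI] by (simp add: algebra_simps)
    qed
    have utan: "u t \<in> tsp (\<gamma> t)"
      unfolding u_def by (rule tangent_sum_in[OF finite coord_field_tangent[OF ca ta] coord_field_tangent[OF ca ta]])
    have "u t (\<lambda>q. snd c q $ l) = 0" for l
    proof -
      \<comment> \<open>The product rule for the tangent vector \<open>u t\<close> on f_l = x_l f_0
        differs from \<open>key\<close> by the term f_0 u(x_l) alone, which therefore
        vanishes.\<close>
      have "u t (f l) = u t (\<lambda>q. snd c q $ l * f0 q)"
        by (rule tangent_cong[OF utan cs_open[OF c] \<gamma>(1)[OF tI] ratio])
      also have "\<dots> = snd c (\<gamma> t) $ l * u t f0 + f0 (\<gamma> t) * u t (\<lambda>q. snd c q $ l)"
        by (rule tangent_mult[OF utan smooth_nearI[OF sfun_coord[OF c] \<gamma>(1)[OF tI]] smooth_nearI[OF f0(1) \<gamma>(1)[OF tI]]])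
      finally have "f0 (\<gamma> t) * u t (\<lambda>q. snd c q $ l) = 0" using key[of l] \<gamma>(2)[OF tI] by simp
      then show ?thesis using pos[OF \<gamma>(1)[OF tI]] by simp
    qed
    then have "u t h = 0" for h by (subst tangent_expand[OF c \<gamma>(1)[OF tI] utan]) simp
    moreover have "u t (\<lambda>q. snd a q $ l0) = Z l0 t"
      unfolding u_def coord_field_coord[OF ca ta] by (rule sum_delta_right)
    ultimately show "deriv (deriv (\<lambda>s. snd a (\<gamma> s) $ l0)) t + (\<Sum>i\<in>UNIV. \<Sum>j\<in>UNIV. \<Gamma> a i j l0 (\<gamma> t) *
        deriv (\<lambda>s. snd a (\<gamma> s) $ i) t * deriv (\<lambda>s. snd a (\<gamma> s) $ j) t) = 0"
      unfolding Z_def x'_def by simp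
  qed
  moreover have "deriv s t > 0" if "t \<in> I" for t
    using DERIV_imp_deriv[OF ds[OF that]] coord_repr_pos[OF line[OF sJ[OF that]]] by simp
  ultimately show ?thesis using s img unfolding \<gamma>_def[abs_def] X_def
    by (intro exI[of _ I] exI[of _ s] conjI ballI)
qed

lemma geodesics_straightI: "a \<in> A \<Longrightarrow> fst c \<subseteq> fst a \<Longrightarrow> geodesics_straight M A D c"
  unfolding geodesics_straight_def
  by (intro conjI allI impI; elim conjE; (rule geodesic_imp_straight | rule straight_imp_geodesic); (assumption | erule bspec))

end

end

section \<open>The dual pair of coordinate systems\<close>

text \<open>The parameter \<open>\<sigma>\<close> is the sign of the curvature.\<close>

definition projective_potential ::
    "'m topology \<Rightarrow> ('m, 'd::finite) chart set \<Rightarrow> ('m \<Rightarrow> 'm tvec \<Rightarrow> 'm tvec \<Rightarrow> real) \<Rightarrow> 'm conn \<Rightarrow>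
     real \<Rightarrow> real \<Rightarrow> ('m, 'd) chart \<Rightarrow> (real^'d \<Rightarrow> real) \<Rightarrow> bool" where
  "projective_potential M A g D \<sigma> \<alpha> c \<phi> \<longleftrightarrow>
     coordinate_system M A c \<and> geodesics_straight M A D c \<and> smooth_on (snd c ` fst c) \<phi> \<and>
     (\<forall>N. open N \<and> convex N \<and> N \<subseteq> snd c ` fst c \<longrightarrow> convex_on N (\<lambda>y. \<sigma> * exp (\<alpha> * \<phi> y))) \<and>
     (\<forall>q\<in>fst c. \<forall>i j. metric_coeff M A g c i j q = \<sigma> * (pderiv_at i (pderiv_at j \<phi>) (snd c q)
        + \<alpha> * pderiv_at i \<phi> (snd c q) * pderiv_at j \<phi> (snd c q)))"

context mfd
begin

lemma sfun_inverse:
  assumes "sfun W f" "\<And>q. q \<in> W \<Longrightarrow> f q \<noteq> 0"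
  shows "sfun W (\<lambda>q. inverse (f q))"
  unfolding smooth_fun_def
proof (intro conjI ballI sfun_open[OF assms(1)])
  fix a assume a: "a \<in> A"
  have "(f \<circ> param a) x \<noteq> 0" if "x \<in> snd a ` (W \<inter> fst a)" for x
    using that param_snd[OF cs_chart[OF atlas_cs[OF a]]] assms(2) by auto
  then have "smooth_on (snd a ` (W \<inter> fst a)) (\<lambda>x. inverse ((f \<circ> param a) x))"
    by (rule smooth_on_inverse[where f = "f \<circ> param a", OF sfun_image_open[OF sfun_open[OF assms(1)] a] _
          sfun_cs[OF assms(1) atlas_cs[OF a]]])
  then show "smooth_on (snd a ` (W \<inter> fst a)) ((\<lambda>q. inverse (f q)) \<circ> param a)" by (simp add: comp_def)
qed

lemma open_positive:
  assumes c: "cs c" and W: "W \<subseteq> fst c" and f: "sfun W f"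
  shows "openin M {q \<in> W. f q > (0::real)}"
proof -
  note cc = cs_chart[OF c]
  have op: "open (snd c ` W)" by (rule is_chart_image_open[OF cc sfun_open[OF f] W])
  have sm: "smooth_on (snd c ` W) (f \<circ> param c)" using sfun_cs[OF f c] W by (simp add: Int_absorb2)
  have V: "open (snd c ` W \<inter> (f \<circ> param c) -` {0<..})"
    by (rule continuous_open_preimage[OF smooth_on_continuous[OF sm] op open_greaterThan])
  have "openin M (param c ` (snd c ` W \<inter> (f \<circ> param c) -` {0<..}))"
    by (rule is_chart_param_open[OF cc V]) (use W in auto)
  moreover have "param c ` (snd c ` W \<inter> (f \<circ> param c) -` {0<..}) = {q \<in> W. f q > 0}"
  proof (intro equalityI subsetI)
    fix q assume "q \<in> param c ` (snd c ` W \<inter> (f \<circ> param c) -` {0<..})"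
    then obtain y where y: "y \<in> snd c ` W" "y \<in> (f \<circ> param c) -` {0<..}" "q = param c y" by blast
    then show "q \<in> {q \<in> W. f q > 0}" using param_in'[OF cc W y(1)] by simp
  next
    fix q assume q: "q \<in> {q \<in> W. f q > 0}"
    then have "param c (snd c q) = q" using param_snd[OF cc] W by auto
    then show "q \<in> param c ` (snd c ` W \<inter> (f \<circ> param c) -` {0<..})"
      using q by (intro image_eqI[of _ _ "snd c q"]) auto
  qed
  ultimately show ?thesis by simp
qed

text \<open>At \<open>p\<close> the quotient rule reduces to the differential of the numerator,
  because there the denominator is 1 and the numerators are 0; so the Jacobian of the quotients is
  that of the numerators.\<close>

lemma quotient_chart:
  assumes c: "cs c" and W: "W \<subseteq> fst c" and p: "p \<in> W" and f0: "sfun W f0" "f0 p = 1"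
    and f: "\<And>l. sfun W (f l)" "\<And>l. f l p = 0" and det: "det (\<chi> l i. cf c i p (f l)) \<noteq> 0"
  shows "\<exists>U1. openin M U1 \<and> p \<in> U1 \<and> U1 \<subseteq> W \<and> (\<forall>q\<in>U1. f0 q > 0) \<and>
    (\<forall>U. openin M U \<and> U \<subseteq> U1 \<longrightarrow> cs (U, \<lambda>q. \<chi> l. f l q * inverse (f0 q)))"
proof -
  define W0 where "W0 = {q \<in> W. f0 q > 0}"
  have W0: "openin M W0" "W0 \<subseteq> W" "W0 \<subseteq> fst c" "p \<in> W0"
    using open_positive[OF c W f0(1)] W p f0(2) by (auto simp: W0_def)
  have p0: "f0 q \<noteq> 0" if "q \<in> W0" for q using that by (simp add: W0_def)
  have s0: "sfun W0 (\<lambda>q. inverse (f0 q))" by (rule sfun_inverse[OF sfun_subset[OF f0(1) W0(1,2)] p0])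
  have sl: "sfun W0 (f l)" for l by (rule sfun_subset[OF f(1) W0(1,2)])
  have s: "sfun W0 (\<lambda>q. f l q * inverse (f0 q))" for l by (rule sfun_mult[OF sl s0])
  have T: "cf c i p \<in> tsp p" for i by (rule coord_field_tangent[OF c]) (use W0 in auto)
  have "cf c i p (\<lambda>q. f l q * inverse (f0 q)) = cf c i p (f l)" for i l
    using tangent_mult[OF T smooth_nearI[OF sl W0(4)] smooth_nearI[OF s0 W0(4)], of i l] f0(2) f(2)[of l] by simp
  then have "det (\<chi> l i. cf c i p (\<lambda>q. (\<chi> l. f l q * inverse (f0 q)) $ l)) \<noteq> 0" using det by simp
  from chart_from_functions[OF c W0(1,3,4) _ this]
  obtain U1 where U1: "openin M U1" "p \<in> U1" "U1 \<subseteq> W0"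
    "\<And>U. openin M U \<Longrightarrow> U \<subseteq> U1 \<Longrightarrow> cs (U, \<lambda>q. \<chi> l. f l q * inverse (f0 q))"
    using s by auto
  have "\<forall>q\<in>U1. f0 q > 0" using U1(3) by (auto simp: W0_def)
  then show ?thesis using U1 W0(2) by blast
qed

end

context rconn
begin

text \<open>A kernel vector of the matrix is the component vector of a tangent vector of length
  zero. For \<sigma> the sign of the curvature, the matrix is the Jacobian at \<open>p\<close> of
  the dual solutions from which \<eta> is built.\<close>

lemma gm_invertible:
  assumes c: "cs c" and p: "p \<in> fst c" and \<sigma>: "\<sigma> \<noteq> 0"
  shows "det (\<chi> l i. \<sigma> * gm c i l p) \<noteq> 0"
proof -
  note T = coord_field_tangent[OF c p] and P = cs_topspace[OF c p]
  have "v = 0" if v: "(\<chi> l i. \<sigma> * gm c i l p) *v v = 0" for v :: "real^'d"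
  proof -
    define w where "w = (\<lambda>f. \<Sum>i\<in>UNIV. v $ i * cf c i p f)"
    have w: "w \<in> tsp p" unfolding w_def by (rule tangent_sum_in[OF finite T T])
    have "(\<Sum>i\<in>UNIV. \<sigma> * gm c i l p * v $ i) = 0" for l
      using arg_cong[OF v, of "\<lambda>x. x $ l"] by (simp add: matrix_vector_mult_def)
    then have "\<sigma> * (\<Sum>i\<in>UNIV. gm c i l p * v $ i) = 0" for l by (simp add: sum_distrib_left mult.assoc)
    then have z: "(\<Sum>i\<in>UNIV. gm c i l p * v $ i) = 0" for l using \<sigma> by simp
    have "g p w w = (\<Sum>i\<in>UNIV. \<Sum>j\<in>UNIV. v $ i * v $ j * gm c i j p)"
      unfolding w_def metric_coeff_def by (rule g_sum2[OF P finite finite T T T])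
    also have "\<dots> = (\<Sum>j\<in>UNIV. v $ j * (\<Sum>i\<in>UNIV. gm c i j p * v $ i))"
      by (subst sum.swap) (simp add: sum_distrib_left ac_simps)
    finally have "g p w w = 0" by (simp add: z)
    then have w0: "w = (\<lambda>f. 0)" using g_pos[OF P w] by fastforce
    have "w (\<lambda>q. snd c q $ l) = v $ l" for l
      unfolding w_def coord_field_coord[OF c p] by (rule sum_delta_right)
    then show "v = 0" by (simp add: vec_eq_iff w0)
  qed
  then show ?thesis
    using matrix_left_invertible_ker invertible_left_inverse invertible_det_nz by blast
qed

text \<open>Follows from the symmetry of the metric. It gives the dual connection access to the
  existence result for the Hessian equation, whose proof involves both connections.\<close>

lemma dual_connections_swap:
  assumes dual: "dual_connections M A g D D'" and D': "affine_connection M A D'" "torsion_free M A D'"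
  shows "dual_connections M A g D' D"
  unfolding dual_connections_def
proof (intro allI impI ballI)
  interpret d: rconn M A g D' by unfold_locales (rule riem D')+
  fix W X Y Z p assume W: "openin M W" and X: "X \<in> VF W" and Y: "Y \<in> VF W" and Z: "Z \<in> VF W" and p: "p \<in> W"
  have top: "q \<in> topspace M" if "q \<in> W" for q using openin_subset[OF W] that by blast
  have "Z p (\<lambda>q. g q (X q) (Y q)) = Z p (\<lambda>q. g q (Y q) (X q))"
    by (rule tangent_cong[OF VF_tangent[OF Z p] W p g_sym[OF top VF_tangent[OF X] VF_tangent[OF Y]]])
  also have "\<dots> = g p (D Z Y p) (X p) + g p (Y p) (D' Z X p)"
    by (rule dual[unfolded dual_connections_def, THEN spec, THEN mp, THEN bspec, THEN bspec, THEN bspec,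
          THEN bspec, OF W Y X Z p])
  also have "g p (D Z Y p) (X p) = g p (X p) (D Z Y p)"
    by (rule g_sym[OF top[OF p] VF_tangent[OF conn_VF[OF W Z Y] p] VF_tangent[OF X p]])
  also have "g p (Y p) (D' Z X p) = g p (D' Z X p) (Y p)"
    by (rule g_sym[OF top[OF p] VF_tangent[OF Y p] VF_tangent[OF d.conn_VF[OF W Z X] p]])
  finally show "Z p (\<lambda>q. g q (X q) (Y q)) = g p (D' Z X p) (Y p) + g p (X p) (D Z Y p)" by simp
qed

text \<open>The potential is - (1/\<alpha>) log f_0 in the new coordinates. Since k = \<sigma>
  \<alpha> with \<sigma>^2 = 1, multiplication by \<sigma> turns the factor k / \<alpha> of the
  metric formula into 1 and makes \<sigma> k = \<alpha> positive, as the convexity result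
  requires.\<close>

lemma ex_projective_potential:
  assumes a: "a \<in> A" "U \<subseteq> fst a" and U: "openin M U" "U \<subseteq> W"
    and f0: "sfun W f0" "hess_eq (\<sigma> * \<alpha>) W f0" and f: "\<And>l. sfun W (f l)" "\<And>l. hess_eq (\<sigma> * \<alpha>) W (f l)"
    and pos: "\<And>q. q \<in> U \<Longrightarrow> f0 q > 0" and c: "cs (U, \<xi>)" and \<xi>: "\<xi> = (\<lambda>q. \<chi> l. f l q * inverse (f0 q))"
    and \<alpha>: "\<alpha> > 0" and \<sigma>: "\<sigma> * \<sigma> = 1"
  shows "\<exists>\<phi>. projective_potential M A g D \<sigma> \<alpha> (U, \<xi>) \<phi> \<and> (\<forall>q\<in>U. \<phi> (\<xi> q) = - (1 / \<alpha>) * ln (f0 q))"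
proof -
  let ?c = "(U, \<xi>)"
  have h: "hess_eq k U h" if "hess_eq k W h" for k h using that U(2) unfolding hess_eq_def by blast
  have f0': "sfun (fst ?c) f0" "hess_eq (\<sigma> * \<alpha>) (fst ?c) f0"
    using sfun_subset[OF f0(1) U] h[OF f0(2)] by simp_all
  have f': "sfun (fst ?c) (f l)" "hess_eq (\<sigma> * \<alpha>) (fst ?c) (f l)" for l
    using sfun_subset[OF f(1) U] h[OF f(2)] by simp_all
  have pos': "f0 q > 0" if "q \<in> fst ?c" for q using pos that by simp
  have ratio: "f l q = snd ?c q $ l * f0 q" if "q \<in> fst ?c" for q l
    using pos'[OF that] by (simp add: \<xi>)
  note hyps = c f0' f' pos' ratio
  have geo: "geodesics_straight M A D ?c"
    by (rule geodesics_straightI[OF hyps a(1)]) (use a(2) in simp_all)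
  let ?E = "coord_repr ?c f0"
  define \<phi> where "\<phi> y = - (1 / \<alpha>) * ln (?E y)" for y
  have sE: "smooth_on (\<xi> ` U) ?E" using coord_repr_smooth[OF hyps] by simp
  have op: "open (\<xi> ` U)" using is_chart_open_image[OF cs_chart[OF c]] by simp
  have pE: "?E y > 0" if "y \<in> \<xi> ` U" for y using coord_repr_pos[OF hyps] that by simp
  have aE: "?E (\<xi> q) = f0 q" if "q \<in> U" for q using coord_repr_at[OF hyps] that by simp
  have "smooth_on (\<xi> ` U) \<phi>"
    unfolding \<phi>_def[abs_def] by (intro smooth_on_mult op smooth_on_const smooth_on_ln sE pE)
  moreover have "\<forall>q\<in>U. \<phi> (\<xi> q) = - (1 / \<alpha>) * ln (f0 q)" by (simp add: \<phi>_def aE)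
  moreover have "convex_on N (\<lambda>y. \<sigma> * exp (\<alpha> * \<phi> y))" if N: "open N" "convex N" "N \<subseteq> \<xi> ` U" for N
  proof -
    have "\<sigma> * (\<sigma> * \<alpha>) \<ge> 0" using \<sigma> \<alpha> by (simp add: mult.assoc[symmetric])
    then have "convex_on N (\<lambda>y. \<sigma> * inverse (?E y))"
      using convex_inverse_coord_repr[OF hyps N(1,2)] N(3) by simp
    moreover have "exp (\<alpha> * \<phi> y) = inverse (?E y)" if "y \<in> N" for y
      using pE[of y] that N(3) \<alpha> by (auto simp: \<phi>_def exp_minus)
    ultimately show ?thesis unfolding convex_on_def using N(2) by (simp add: convexD)
  qed
  moreover have "gm ?c i j q = \<sigma> * (pderiv_at i (pderiv_at j \<phi>) (\<xi> q)
        + \<alpha> * pderiv_at i \<phi> (\<xi> q) * pderiv_at j \<phi> (\<xi> q))" if "q \<in> U" for q i j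
  proof -
    have "pderiv_at i (pderiv_at j \<phi>) (\<xi> q) + \<alpha> * pderiv_at i \<phi> (\<xi> q) * pderiv_at j \<phi> (\<xi> q)
        = \<sigma> * \<alpha> / \<alpha> * gm ?c i j q"
      using log_metric[OF hyps, of \<alpha> q i j] \<alpha> that unfolding \<phi>_def[abs_def] by simp
    then show ?thesis using \<alpha> \<sigma> by (simp add: mult.assoc[symmetric])
  qed
  ultimately show ?thesis using geo c unfolding projective_potential_def fst_conv snd_conv by blast
qed

end

section \<open>Pairing primal and dual solutions\<close>

lemma dual_projective_coordinates:
  fixes M :: "'m topology" and A :: "('m, 'd::finite) chart set"
  assumes stat: "statistical_manifold M A g D D'" and \<alpha>: "\<alpha> > 0" and \<sigma>: "\<sigma> * \<sigma> = 1"
    and k: "constant_sectional_curvature M A g D (\<sigma> * \<alpha>)" and k': "constant_sectional_curvature M A g D' (\<sigma> * \<alpha>)"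
    and p: "p \<in> topspace M"
  shows "\<exists>U \<xi> \<eta> \<phi> \<psi>. p \<in> U \<and>
    projective_potential M A g D \<sigma> \<alpha> (U, \<xi>) \<phi> \<and> projective_potential M A g D' \<sigma> \<alpha> (U, \<eta>) \<psi> \<and>
    (\<forall>q\<in>U. 1 + \<alpha> * (\<Sum>l\<in>UNIV. \<xi> q $ l * \<eta> q $ l) > 0) \<and>
    (\<forall>q\<in>U. \<phi> (\<xi> q) + \<psi> (\<eta> q) = 1 / \<alpha> * ln (1 + \<alpha> * (\<xi> q \<bullet> \<eta> q)))"
proof -
  have D: "affine_connection M A D" "torsion_free M A D" and D': "affine_connection M A D'" "torsion_free M A D'"
    and dual: "dual_connections M A g D D'" and riem: "riemannian_metric M A g" and sm: "smooth_manifold M A"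
    using stat by (simp_all add: statistical_manifold_def)
  interpret r: rconn M A g D by unfold_locales (rule sm riem D)+
  interpret d: rconn M A g D' by unfold_locales (rule riem D')+
  have dual': "dual_connections M A g D' D" by (rule r.dual_connections_swap[OF dual D'])
  have \<sigma>0: "\<sigma> \<noteq> 0" using \<sigma> by auto
  obtain a where a: "a \<in> A" and pa: "p \<in> fst a" using r.atlas_cover[OF p] by blast
  note ca = r.atlas_cs[OF a]
  obtain W1 where W1: "openin M W1" "p \<in> W1" "W1 \<subseteq> fst a"
    and sol1: "\<And>x b. \<exists>f. smooth_fun M A W1 f \<and> f p = x \<and> (\<forall>i. coord_field M A a i p f = b i) \<and> r.hess_eq (\<sigma> * \<alpha>) W1 f"
    using r.hess_solutions[OF dual D' k ca pa] by metis
  obtain W2 where W2: "openin M W2" "p \<in> W2" "W2 \<subseteq> fst a"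
    and sol2: "\<And>x b. \<exists>f. smooth_fun M A W2 f \<and> f p = x \<and> (\<forall>i. coord_field M A a i p f = b i) \<and> d.hess_eq (\<sigma> * \<alpha>) W2 f"
    using d.hess_solutions[OF dual' D k' ca pa] by metis
  obtain f0 where f0: "smooth_fun M A W1 f0" "f0 p = 1" "\<And>i. coord_field M A a i p f0 = 0" "r.hess_eq (\<sigma> * \<alpha>) W1 f0"
    using sol1[of 1 "\<lambda>i. 0"] by blast
  obtain h0 where h0: "smooth_fun M A W2 h0" "h0 p = 1" "\<And>i. coord_field M A a i p h0 = 0" "d.hess_eq (\<sigma> * \<alpha>) W2 h0"
    using sol2[of 1 "\<lambda>i. 0"] by blast
  have "\<forall>l. \<exists>f. smooth_fun M A W1 f \<and> f p = 0 \<and> (\<forall>i. coord_field M A a i p f = (if i = l then 1 else 0)) \<and> r.hess_eq (\<sigma> * \<alpha>) W1 f"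
    by (rule allI, rule sol1[of 0 "\<lambda>i. if i = l then 1 else 0" for l])
  then obtain f where f: "\<And>l. smooth_fun M A W1 (f l)" "\<And>l. f l p = 0"
    "\<And>l i. coord_field M A a i p (f l) = (if i = l then 1 else 0)" "\<And>l. r.hess_eq (\<sigma> * \<alpha>) W1 (f l)"
    by metis
  \<comment> \<open>The differentials of the primal solutions at \<open>p\<close> are the coordinate
    covectors; with \<sigma> g(\<partial>_l, .) for the dual ones and weight \<sigma>, the sum of
    the products is \<sigma>^2 g = g there.\<close>
  have "\<forall>l. \<exists>f. smooth_fun M A W2 f \<and> f p = 0 \<and> (\<forall>i. coord_field M A a i p f = \<sigma> * r.gm a i l p) \<and> d.hess_eq (\<sigma> * \<alpha>) W2 f"
    by (rule allI, rule sol2[of 0 "\<lambda>i. \<sigma> * r.gm a i l p" for l])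
  then obtain h where h: "\<And>l. smooth_fun M A W2 (h l)" "\<And>l. h l p = 0"
    "\<And>l i. coord_field M A a i p (h l) = \<sigma> * r.gm a i l p" "\<And>l. d.hess_eq (\<sigma> * \<alpha>) W2 (h l)"
    by metis
  define \<xi> where "\<xi> = (\<lambda>q. \<chi> l. f l q * inverse (f0 q))"
  define \<eta> where "\<eta> = (\<lambda>q. \<chi> l. h l q * inverse (h0 q))"
  have "det (\<chi> l i. coord_field M A a i p (f l)) = det (mat 1 :: real^'d^'d)"
    by (rule arg_cong[of _ _ det]) (simp add: f(3) vec_eq_iff mat_def eq_commute)
  then have "det (\<chi> l i. coord_field M A a i p (f l)) \<noteq> 0" by simp
  from r.quotient_chart[OF ca W1(3,2) f0(1,2) f(1,2) this]
  obtain U1 where U1: "openin M U1" "p \<in> U1" "U1 \<subseteq> W1" "\<And>q. q \<in> U1 \<Longrightarrow> f0 q > 0"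
    "\<And>U. openin M U \<Longrightarrow> U \<subseteq> U1 \<Longrightarrow> coordinate_system M A (U, \<xi>)" unfolding \<xi>_def by blast
  have "det (\<chi> l i. coord_field M A a i p (h l)) \<noteq> 0"
    unfolding h(3) by (rule r.gm_invertible[OF ca pa \<sigma>0])
  from r.quotient_chart[OF ca W2(3,2) h0(1,2) h(1,2) this]
  obtain U2 where U2: "openin M U2" "p \<in> U2" "U2 \<subseteq> W2" "\<And>q. q \<in> U2 \<Longrightarrow> h0 q > 0"
    "\<And>U. openin M U \<Longrightarrow> U \<subseteq> U2 \<Longrightarrow> coordinate_system M A (U, \<eta>)" unfolding \<eta>_def by blast
  define W where "W = U1 \<inter> U2"
  have W: "openin M W" "W \<subseteq> fst a" "p \<in> W" "W \<subseteq> W1" "W \<subseteq> W2"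
    using U1 U2 W1(3) by (auto simp: W_def)
  define F where "F = case_option f0 f"
  define H where "H = case_option h0 h"
  \<comment> \<open>The weight 1/k at \<open>None\<close> matches the constant of the pairing; the
    weight \<sigma> of the other indices becomes k \<sigma> = \<alpha> after multiplication by
    k.\<close>
  define C where "C = case_option (1 / (\<sigma> * \<alpha>)) (\<lambda>l::'d. \<sigma>)"
  have hr: "r.hess_eq x W u" if "r.hess_eq x W1 u" for x u using that W(4) unfolding r.hess_eq_def by blast
  have hd: "d.hess_eq x W u" if "d.hess_eq x W2 u" for x u using that W(5) unfolding d.hess_eq_def by blast
  have "smooth_fun M A W (F b)" "r.hess_eq (\<sigma> * \<alpha>) W (F b)" for b
    unfolding F_def using r.sfun_subset[OF f0(1) W(1,4)] r.sfun_subset[OF f(1) W(1,4)] hr[OF f0(4)] hr[OF f(4)]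
    by (cases b; simp)+
  note F = this
  have "smooth_fun M A W (H b)" "d.hess_eq (\<sigma> * \<alpha>) W (H b)" for b
    unfolding H_def using r.sfun_subset[OF h0(1) W(1,5)] r.sfun_subset[OF h(1) W(1,5)] hd[OF h0(4)] hd[OF h(4)]
    by (cases b; simp)+
  note H = this
  have kn: "\<sigma> * \<alpha> \<noteq> 0" using \<sigma>0 \<alpha> by simp
  have i4: "(\<Sum>b\<in>UNIV. C b * coord_field M A a i p (H b) * coord_field M A a j p (F b)) = r.gm a i j p" for i j
    using \<sigma> sum_delta_right[of "\<lambda>l. \<sigma> * (\<sigma> * r.gm a i l p)" j]
    by (simp add: sum_option C_def F_def H_def f0 f h0 h)
  have "(\<Sum>b\<in>UNIV. C b * H b p * F b p) = 1 / (\<sigma> * \<alpha>)"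
    "\<And>j. (\<Sum>b\<in>UNIV. C b * H b p * coord_field M A a j p (F b)) = 0"
    "\<And>i. (\<Sum>b\<in>UNIV. C b * coord_field M A a i p (H b) * F b p) = 0"
    by (simp_all add: sum_option C_def F_def H_def f0 f h0 h)
  from r.hess_pairing[OF dual D' kn ca W(2,1,3) F H this i4]
  obtain U where U: "openin M U" "p \<in> U" "U \<subseteq> W" and pair: "\<And>q. q \<in> U \<Longrightarrow> (\<Sum>b\<in>UNIV. C b * H b q * F b q) = 1 / (\<sigma> * \<alpha>)"
    by blast
  have pos: "f0 q > 0" "h0 q > 0" if "q \<in> U" for q using U1(4) U2(4) U(3) that by (auto simp: W_def)
  have cx: "coordinate_system M A (U, \<xi>)" and ce: "coordinate_system M A (U, \<eta>)"
    using U1(5) U2(5) U by (auto simp: W_def)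
  have Ua: "U \<subseteq> fst a" and UW1: "U \<subseteq> W1" and UW2: "U \<subseteq> W2" using U(3) W by auto
  \<comment> \<open>The reciprocal form also yields the positivity of 1 + \<alpha> \<xi> \<cdot>
    \<eta>, since both \<open>f0\<close> and \<open>h0\<close> are positive on
    \<open>U\<close>.\<close>
  have ip: "1 + \<alpha> * (\<xi> q \<bullet> \<eta> q) = inverse (f0 q * h0 q)" if q: "q \<in> U" for q
  proof -
    define s where "s = (\<Sum>l\<in>UNIV. h l q * f l q)"
    have "1 / (\<sigma> * \<alpha>) * h0 q * f0 q + \<sigma> * s = 1 / (\<sigma> * \<alpha>)"
      using pair[OF q] by (simp add: sum_option C_def F_def H_def s_def sum_distrib_left mult.assoc)
    then have "(\<sigma> * \<alpha>) * (1 / (\<sigma> * \<alpha>) * h0 q * f0 q + \<sigma> * s) = 1" using kn by simp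
    moreover have "(\<sigma> * \<alpha>) * (1 / (\<sigma> * \<alpha>) * h0 q * f0 q + \<sigma> * s) = h0 q * f0 q + (\<sigma> * \<sigma>) * \<alpha> * s"
      using kn by (simp add: distrib_left)
    ultimately have 1: "h0 q * f0 q + \<alpha> * s = 1" using \<sigma> by simp
    have "\<xi> q \<bullet> \<eta> q = s * inverse (f0 q * h0 q)"
      by (simp add: inner_vec_def \<xi>_def \<eta>_def s_def sum_distrib_left sum_distrib_right ac_simps)
    then have "1 + \<alpha> * (\<xi> q \<bullet> \<eta> q) = (h0 q * f0 q + \<alpha> * s) * inverse (f0 q * h0 q)"
      using pos[OF q] by (simp add: field_simps)
    then show ?thesis by (simp only: 1 mult_1_left)
  qed
  obtain \<phi> where \<phi>: "projective_potential M A g D \<sigma> \<alpha> (U, \<xi>) \<phi>" "\<And>q. q \<in> U \<Longrightarrow> \<phi> (\<xi> q) = - (1 / \<alpha>) * ln (f0 q)"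
    using r.ex_projective_potential[OF a Ua U(1) UW1 f0(1,4) f(1,4) pos(1) cx \<xi>_def \<alpha> \<sigma>] by blast
  obtain \<psi> where \<psi>: "projective_potential M A g D' \<sigma> \<alpha> (U, \<eta>) \<psi>" "\<And>q. q \<in> U \<Longrightarrow> \<psi> (\<eta> q) = - (1 / \<alpha>) * ln (h0 q)"
    using d.ex_projective_potential[OF a Ua U(1) UW2 h0(1,4) h(1,4) pos(2) ce \<eta>_def \<alpha> \<sigma>] by blast
  have fenchel: "\<forall>q\<in>U. \<phi> (\<xi> q) + \<psi> (\<eta> q) = 1 / \<alpha> * ln (1 + \<alpha> * (\<xi> q \<bullet> \<eta> q))"
  proof
    fix q assume q: "q \<in> U"
    have L: "ln (inverse (f0 q * h0 q)) = - ln (f0 q) - ln (h0 q)"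
      using pos[OF q] by (simp add: ln_inverse ln_mult)
    then show "\<phi> (\<xi> q) + \<psi> (\<eta> q) = 1 / \<alpha> * ln (1 + \<alpha> * (\<xi> q \<bullet> \<eta> q))"
      unfolding \<phi>(2)[OF q] \<psi>(2)[OF q] ip[OF q] L by (simp add: algebra_simps)
  qed
  have "\<forall>q\<in>U. 1 + \<alpha> * (\<Sum>l\<in>UNIV. \<xi> q $ l * \<eta> q $ l) > 0"
  proof
    fix q assume q: "q \<in> U"
    have "(\<Sum>l\<in>UNIV. \<xi> q $ l * \<eta> q $ l) = \<xi> q \<bullet> \<eta> q" by (simp add: inner_vec_def)
    then show "1 + \<alpha> * (\<Sum>l\<in>UNIV. \<xi> q $ l * \<eta> q $ l) > 0" using ip[OF q] pos[OF q] by simp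
  qed
  then show ?thesis using U(2) \<phi>(1) \<psi>(1) fenchel by blast
qed

section \<open>The two signs of the curvature\<close>

lemma locally_exp_convex_onI:
  assumes "open S" "\<And>N. open N \<Longrightarrow> convex N \<Longrightarrow> N \<subseteq> S \<Longrightarrow> convex_on N (\<lambda>y. exp (\<alpha> * \<phi> y))"
  shows "locally_exp_convex_on \<alpha> S \<phi>"
  unfolding locally_exp_convex_on_def exp_convex_on_def
proof
  fix x assume "x \<in> S"
  then obtain r where "r > 0" "ball x r \<subseteq> S" using assms(1) open_contains_ball by blast
  then show "\<exists>N. open N \<and> convex N \<and> x \<in> N \<and> N \<subseteq> S \<and> convex_on N (\<lambda>y. exp (\<alpha> * \<phi> y))"
    using assms(2)[of "ball x r"] by (intro exI[of _ "ball x r"]) simp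
qed

lemma locally_exp_concave_onI:
  assumes "open S" "\<And>N. open N \<Longrightarrow> convex N \<Longrightarrow> N \<subseteq> S \<Longrightarrow> convex_on N (\<lambda>y. - exp (\<alpha> * \<phi> y))"
  shows "locally_exp_concave_on \<alpha> S \<phi>"
  unfolding locally_exp_concave_on_def exp_concave_on_def concave_on_def
proof
  fix x assume "x \<in> S"
  then obtain r where "r > 0" "ball x r \<subseteq> S" using assms(1) open_contains_ball by blast
  then show "\<exists>N. open N \<and> convex N \<and> x \<in> N \<and> N \<subseteq> S \<and> convex_on N (\<lambda>y. - exp (\<alpha> * \<phi> y))"
    using assms(2)[of "ball x r"] by (intro exI[of _ "ball x r"]) simp
qed

text \<open>The case \<sigma> = - 1: convexity of the negative exponential is concavity of the
  exponential, and the sign in the metric formula reverses.\<close>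

lemma projective_potential_concave:
  assumes "projective_potential M A g D (- 1) \<alpha> (U, \<xi>) \<phi>"
  shows "coordinate_system M A (U, \<xi>)" "geodesics_straight M A D (U, \<xi>)" "smooth_on (\<xi> ` U) \<phi>"
    "locally_exp_concave_on \<alpha> (\<xi> ` U) \<phi>"
    "\<forall>q\<in>U. \<forall>i j. metric_coeff M A g (U, \<xi>) i j q = - pderiv_at i (pderiv_at j \<phi>) (\<xi> q)
        - \<alpha> * pderiv_at i \<phi> (\<xi> q) * pderiv_at j \<phi> (\<xi> q)"
  using assms is_chart_open_image[of M "(U, \<xi>)"]
  by (simp_all add: projective_potential_def coordinate_system_def locally_exp_concave_onI)

lemma projective_potential_convex:
  assumes "projective_potential M A g D 1 \<alpha> (U, \<xi>) \<phi>"
  shows "coordinate_system M A (U, \<xi>)" "geodesics_straight M A D (U, \<xi>)" "smooth_on (\<xi> ` U) \<phi>"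
    "locally_exp_convex_on \<alpha> (\<xi> ` U) \<phi>"
    "\<forall>q\<in>U. \<forall>i j. metric_coeff M A g (U, \<xi>) i j q = pderiv_at i (pderiv_at j \<phi>) (\<xi> q)
        + \<alpha> * pderiv_at i \<phi> (\<xi> q) * pderiv_at j \<phi> (\<xi> q)"
  using assms is_chart_open_image[of M "(U, \<xi>)"]
  by (simp_all add: projective_potential_def coordinate_system_def locally_exp_convex_onI)

theorem theorem18:
  fixes M :: "'m topology" and A :: "('m, 'd::finite) chart set"
    and g :: "'m \<Rightarrow> 'm tvec \<Rightarrow> 'm tvec \<Rightarrow> real" and D D' :: "'m conn" and \<alpha> :: real
  assumes "statistical_manifold M A g D D'"
    and "CARD('d) \<ge> 2"
    and "projectively_flat M A D" and "projectively_flat M A D'"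
    and "\<alpha> > 0"
  shows "
    (constant_sectional_curvature M A g D (- \<alpha>) \<and>
     constant_sectional_curvature M A g D' (- \<alpha>) \<longrightarrow>
     (\<forall>p\<in>topspace M. \<exists>U \<xi> \<eta>. p \<in> U \<and>
        coordinate_system M A (U, \<xi>) \<and> coordinate_system M A (U, \<eta>) \<and>
        geodesics_straight M A D (U, \<xi>) \<and> geodesics_straight M A D' (U, \<eta>) \<and>
        (\<forall>q\<in>U. 1 + \<alpha> * (\<Sum>l\<in>UNIV. \<xi> q $ l * \<eta> q $ l) > 0) \<and>
        (\<exists>\<phi> \<psi>.
           smooth_on (\<xi> ` U) \<phi> \<and> smooth_on (\<eta> ` U) \<psi> \<and>
           locally_exp_concave_on \<alpha> (\<xi> ` U) \<phi> \<and> locally_exp_concave_on \<alpha> (\<eta> ` U) \<psi> \<and>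
           (\<forall>q\<in>U. \<phi> (\<xi> q) + \<psi> (\<eta> q) = 1 / \<alpha> * ln (1 + \<alpha> * (\<xi> q \<bullet> \<eta> q))) \<and>
           (\<forall>q\<in>U. \<forall>i j.
              metric_coeff M A g (U, \<xi>) i j q =
                - pderiv_at i (pderiv_at j \<phi>) (\<xi> q)
                - \<alpha> * pderiv_at i \<phi> (\<xi> q) * pderiv_at j \<phi> (\<xi> q)) \<and>
           (\<forall>q\<in>U. \<forall>i j.
              metric_coeff M A g (U, \<eta>) i j q =
                - pderiv_at i (pderiv_at j \<psi>) (\<eta> q)
                - \<alpha> * pderiv_at i \<psi> (\<eta> q) * pderiv_at j \<psi> (\<eta> q))))) \<and>
    (constant_sectional_curvature M A g D \<alpha> \<and>
     constant_sectional_curvature M A g D' \<alpha> \<longrightarrow>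
     (\<forall>p\<in>topspace M. \<exists>U \<xi> \<eta>. p \<in> U \<and>
        coordinate_system M A (U, \<xi>) \<and> coordinate_system M A (U, \<eta>) \<and>
        geodesics_straight M A D (U, \<xi>) \<and> geodesics_straight M A D' (U, \<eta>) \<and>
        (\<forall>q\<in>U. 1 + \<alpha> * (\<Sum>l\<in>UNIV. \<xi> q $ l * \<eta> q $ l) > 0) \<and>
        (\<exists>\<phi> \<psi>.
           smooth_on (\<xi> ` U) \<phi> \<and> smooth_on (\<eta> ` U) \<psi> \<and>
           locally_exp_convex_on \<alpha> (\<xi> ` U) \<phi> \<and> locally_exp_convex_on \<alpha> (\<eta> ` U) \<psi> \<and>
           (\<forall>q\<in>U. \<phi> (\<xi> q) + \<psi> (\<eta> q) = 1 / \<alpha> * ln (1 + \<alpha> * (\<xi> q \<bullet> \<eta> q))) \<and>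
           (\<forall>q\<in>U. \<forall>i j.
              metric_coeff M A g (U, \<xi>) i j q =
                pderiv_at i (pderiv_at j \<phi>) (\<xi> q)
                + \<alpha> * pderiv_at i \<phi> (\<xi> q) * pderiv_at j \<phi> (\<xi> q)) \<and>
           (\<forall>q\<in>U. \<forall>i j.
              metric_coeff M A g (U, \<eta>) i j q =
                pderiv_at i (pderiv_at j \<psi>) (\<eta> q)
                + \<alpha> * pderiv_at i \<psi> (\<eta> q) * pderiv_at j \<psi> (\<eta> q)))))"
proof (intro conjI impI ballI, goal_cases)
  case (1 p)
  then have "constant_sectional_curvature M A g D (- 1 * \<alpha>)" "constant_sectional_curvature M A g D' (- 1 * \<alpha>)"
    by simp_all
  from dual_projective_coordinates[OF assms(1,5) _ this 1(2)]
  obtain U \<xi> \<eta> \<phi> \<psi> where "p \<in> U"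
    and \<phi>: "projective_potential M A g D (- 1) \<alpha> (U, \<xi>) \<phi>" and \<psi>: "projective_potential M A g D' (- 1) \<alpha> (U, \<eta>) \<psi>"
    and "\<forall>q\<in>U. 1 + \<alpha> * (\<Sum>l\<in>UNIV. \<xi> q $ l * \<eta> q $ l) > 0"
    and "\<forall>q\<in>U. \<phi> (\<xi> q) + \<psi> (\<eta> q) = 1 / \<alpha> * ln (1 + \<alpha> * (\<xi> q \<bullet> \<eta> q))"
    by auto
  then show ?case
    using projective_potential_concave[OF \<phi>] projective_potential_concave[OF \<psi>]
    by (intro exI[of _ U] exI[of _ \<xi>] exI[of _ \<eta>] conjI exI[of _ \<phi>] exI[of _ \<psi>]) assumption+
next
  case (2 p)
  then have "constant_sectional_curvature M A g D (1 * \<alpha>)" "constant_sectional_curvature M A g D' (1 * \<alpha>)"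
    by simp_all
  from dual_projective_coordinates[OF assms(1,5) _ this 2(2)]
  obtain U \<xi> \<eta> \<phi> \<psi> where "p \<in> U"
    and \<phi>: "projective_potential M A g D 1 \<alpha> (U, \<xi>) \<phi>" and \<psi>: "projective_potential M A g D' 1 \<alpha> (U, \<eta>) \<psi>"
    and "\<forall>q\<in>U. 1 + \<alpha> * (\<Sum>l\<in>UNIV. \<xi> q $ l * \<eta> q $ l) > 0"
    and "\<forall>q\<in>U. \<phi> (\<xi> q) + \<psi> (\<eta> q) = 1 / \<alpha> * ln (1 + \<alpha> * (\<xi> q \<bullet> \<eta> q))"
    by auto
  then show ?case
    using projective_potential_convex[OF \<phi>] projective_potential_convex[OF \<psi>]
    by (intro exI[of _ U] exI[of _ \<xi>] exI[of _ \<eta>] conjI exI[of _ \<phi>] exI[of _ \<psi>]) assumption+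
qed

end
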